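(* Let $n\geq 3d$ be a multiple of $d$, let $\Delta$ be a stacked cross-polytopal $(d-1)$-sphere on $n$ vertices, and let $\Gamma$ be any stacked cross-polytopal $(d-1)$-sphere on $n-d$ vertices. Then $$\beta_{i,i+j}(\mathbb{F}[\Delta])=\begin{cases}\displaystyle\sum_{\ell=0}^{d}\binom{d}{\ell}\beta_{i-\ell,i-\ell+1}(\mathbb{F}[\Gamma])+d\binom{n-2d}{i-1}+\sum_{\ell=1}^{\min\{i,d\}}\binom{d}{\ell}\binom{n-2d}{i+1-\ell}, & \text{if } j=1,\\ \displaystyle\sum_{\ell=0}^{d}\binom{d}{\ell}\beta_{i-\ell,i-\ell+j}(\mathbb{F}[\Gamma])+\binom{d}{j}\binom{n-2d}{i-j}, & \text{if } 2\leq j\leq d-2.\end{cases}$$ In particular, the graded Betti numbers of a stacked cross-polytopal $(d-1)$-sphere on $n$ vertices depend only on $n$ and $d$.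
   Context: $\mathbb{F}$ is a field; $\beta_{i,i+j}(\mathbb{F}[\Delta])=\dim_{\mathbb{F}}\mathrm{Tor}_i^S(\mathbb{F}[\Delta],\mathbb{F})_{i+j}$ for the Stanley–Reisner ring (set to $0$ for $i<0$); binomial coefficients with out-of-range lower index are $0$. $\mathcal{C}_d=\{v_1,w_1\}*\dots*\{v_d,w_d\}$ is the boundary complex of the $d$-dimensional cross-polytope. For pure $(d-1)$-dimensional complexes $\Delta,\Gamma$ on disjoint vertex sets with facets $F\in\Delta$, $G\in\Gamma$ and a bijection $\varphi:F\to G$, the connected sum is obtained from $(\Delta\setminus\{F\})\cup(\Gamma\setminus\{G\})$ by identifying $v$ with $\varphi(v)$ for $v\in F$. For $k\geq 2$, a stacked cross-polytopal $(d-1)$-sphere on $kd$ vertices is a complex obtained by iterated connected sums of $k-1$ copies of $\mathcal{C}_d$ (for $k=2$ it is $\mathcal{C}_d$).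
   Formalization: The case j=1 is also required to satisfy j ≤ d-2, i.e. d ≥ 3; for d=2 the printed j=1 formula is false (n=6, hexagon: β_{1,2}=9 but the formula gives 8). *)

theory Defs
  imports Complex_Main "HOL-Library.Poly_Mapping" "HOL-Library.Function_Algebras" "HOL-Library.Countable_Set"
begin

section \<open>Simplicial complexes and stacked cross-polytopal spheres\<close>

definition facets :: "'v set set \<Rightarrow> 'v set set" where
  "facets \<Delta> = {F \<in> \<Delta>. \<forall>G\<in>\<Delta>. F \<subseteq> G \<longrightarrow> F = G}"

(* The join {v_1,w_1} * ... * {v_d,w_d}: a face picks from each pair nothing, v_i or w_i. *)
definition cross_polytope_boundary :: "nat \<Rightarrow> 'v set set \<Rightarrow> bool" where
  "cross_polytope_boundary d \<Delta> \<longleftrightarrow>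
    (\<exists>v w :: nat \<Rightarrow> 'v.
       inj_on v {..<d} \<and> inj_on w {..<d} \<and> v ` {..<d} \<inter> w ` {..<d} = {} \<and>
       \<Delta> = {\<Union>(\<sigma> ` {..<d}) | \<sigma>. \<forall>i<d. \<sigma> i \<in> {{}, {v i}, {w i}}})"

(* The class of v and phi v under the identification is represented by v in F. *)
definition connected_sum ::
  "'v set set \<Rightarrow> 'v set \<Rightarrow> 'v set set \<Rightarrow> 'v set \<Rightarrow> ('v \<Rightarrow> 'v) \<Rightarrow> 'v set set" where
  "connected_sum \<Delta> F \<Gamma> G \<phi> =
     (\<Delta> - {F}) \<union> (\<lambda>A. (\<lambda>x. if x \<in> G then inv_into F \<phi> x else x) ` A) ` (\<Gamma> - {G})"

(* Over a finite vertex type there may be no room for a disjoint second summand; over an infinite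
   one, such as nat, every complex isomorphic to an iterated connected sum is obtained. *)
inductive stacked_cross_polytopal :: "nat \<Rightarrow> 'v set set \<Rightarrow> bool" for d :: nat where
  cross_polytope:
    "cross_polytope_boundary d \<Delta> \<Longrightarrow> stacked_cross_polytopal d \<Delta>"
| connected_sum:
    "\<lbrakk>stacked_cross_polytopal d \<Delta>; cross_polytope_boundary d \<Gamma>; \<Union>\<Delta> \<inter> \<Union>\<Gamma> = {};
      F \<in> facets \<Delta>; G \<in> facets \<Gamma>; bij_betw \<phi> F G\<rbrakk>
     \<Longrightarrow> stacked_cross_polytopal d (connected_sum \<Delta> F \<Gamma> G \<phi>)"

definition stacked_cross_polytopal_on :: "nat \<Rightarrow> nat \<Rightarrow> 'v set set \<Rightarrow> bool" where
  "stacked_cross_polytopal_on d n \<Delta> \<longleftrightarrow> stacked_cross_polytopal d \<Delta> \<and> card (\<Union>\<Delta>) = n"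


section \<open>Polynomial rings and Stanley--Reisner ideals\<close>

type_synonym ('v, 'a) mpoly = "('v \<Rightarrow>\<^sub>0 nat) \<Rightarrow>\<^sub>0 'a"

definition polys :: "'v set \<Rightarrow> ('v, 'a::comm_ring_1) mpoly set" where
  "polys V = {p. \<forall>m\<in>Poly_Mapping.keys p. Poly_Mapping.keys m \<subseteq> V}"

definition mdeg :: "('v \<Rightarrow>\<^sub>0 nat) \<Rightarrow> nat" where
  "mdeg m = (\<Sum>v\<in>Poly_Mapping.keys m. Poly_Mapping.lookup m v)"

definition Var :: "'v \<Rightarrow> ('v, 'a::comm_ring_1) mpoly" where
  "Var v = Poly_Mapping.single (Poly_Mapping.single v 1) 1"

definition Const :: "'a::comm_ring_1 \<Rightarrow> ('v, 'a) mpoly" where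
  "Const c = Poly_Mapping.single 0 c"

definition nonfaces :: "'v set set \<Rightarrow> 'v set set" where
  "nonfaces \<Delta> = {A. A \<subseteq> \<Union>\<Delta> \<and> A \<notin> \<Delta>}"

definition SR_ideal :: "'v set set \<Rightarrow> ('v, 'a::comm_ring_1) mpoly set" where
  "SR_ideal \<Delta> = {(\<Sum>A\<in>nonfaces \<Delta>. q A * (\<Prod>v\<in>A. Var v)) | q. \<forall>A. q A \<in> polys (\<Union>\<Delta>)}"


section \<open>Graded free resolutions of the residue field\<close>

text \<open>The polynomial ring \<open>S\<close> is \<open>polys V\<close>.  The free module \<open>P\<^sub>i\<close> has the basis \<open>basis P i\<close>, whose
  elements \<open>b\<close> sit in degree \<open>shift P i b\<close>; \<open>bd P i\<close> is the matrix of \<open>P\<^sub>i\<^sub>+\<^sub>1 \<rightarrow> P\<^sub>i\<close>, and \<open>\<epsilon>\<close> gives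
  the values of the augmentation of \<open>P\<^sub>0\<close> on basis elements.  On the \<open>S\<close>-module \<open>\<bbbF>\<close> all variables
  act as \<open>0\<close>.\<close>

record (overloaded) ('b, 'v, 'a) free_complex =
  basis :: "nat \<Rightarrow> 'b set"
  shift :: "nat \<Rightarrow> 'b \<Rightarrow> nat"
  bd :: "nat \<Rightarrow> 'b \<Rightarrow> 'b \<Rightarrow> ('v, 'a) mpoly"

definition free_mod :: "'v set \<Rightarrow> 'b set \<Rightarrow> ('b \<Rightarrow> ('v, 'a::comm_ring_1) mpoly) set" where
  "free_mod V B = {x. (\<forall>b\<in>B. x b \<in> polys V) \<and> (\<forall>b. b \<notin> B \<longrightarrow> x b = 0)}"

fun boundary ::
  "('b, 'v, 'a::comm_ring_1) free_complex \<Rightarrow> nat \<Rightarrow> ('b \<Rightarrow> ('v, 'a) mpoly) \<Rightarrow> 'b \<Rightarrow> ('v, 'a) mpoly"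
where
  "boundary P 0 x = (\<lambda>c. 0)"
| "boundary P (Suc i) x = (\<lambda>c. if c \<in> basis P i then \<Sum>b\<in>basis P (Suc i). x b * bd P i b c else 0)"

definition augment ::
  "('b, 'v, 'a::comm_ring_1) free_complex \<Rightarrow> ('b \<Rightarrow> 'a) \<Rightarrow> ('b \<Rightarrow> ('v, 'a) mpoly) \<Rightarrow> 'a"
where
  "augment P \<epsilon> x = (\<Sum>b\<in>basis P 0. Poly_Mapping.lookup (x b) 0 * \<epsilon> b)"

definition graded_free_resolution ::
  "'v set \<Rightarrow> ('b, 'v, 'a::field) free_complex \<Rightarrow> ('b \<Rightarrow> 'a) \<Rightarrow> bool"
where
  "graded_free_resolution V P \<epsilon> \<longleftrightarrow>
     (\<forall>i. finite (basis P i)) \<and>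
     (\<forall>i. \<forall>b\<in>basis P (Suc i). \<forall>c\<in>basis P i. bd P i b c \<in> polys V \<and>
        (\<forall>m\<in>Poly_Mapping.keys (bd P i b c). mdeg m + shift P i c = shift P (Suc i) b)) \<and>
     (\<forall>b\<in>basis P 0. \<epsilon> b \<noteq> 0 \<longrightarrow> shift P 0 b = 0) \<and>
     (\<forall>i. {x \<in> free_mod V (basis P (Suc i)). boundary P (Suc i) x = (\<lambda>c. 0)} =
          boundary P (Suc (Suc i)) ` free_mod V (basis P (Suc (Suc i)))) \<and>
     {x \<in> free_mod V (basis P 0). augment P \<epsilon> x = 0} =
       boundary P 1 ` free_mod V (basis P 1) \<and>
     augment P \<epsilon> ` free_mod V (basis P 0) = UNIV"


section \<open>Tor and graded Betti numbers\<close>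

definition scale :: "'a \<Rightarrow> ('b \<Rightarrow> ('v, 'a::field) mpoly) \<Rightarrow> 'b \<Rightarrow> ('v, 'a) mpoly" where
  "scale c x = (\<lambda>b. Const c * x b)"

lemma vector_space_scale:
  "vector_space (scale :: 'a::field \<Rightarrow> ('b \<Rightarrow> ('v, 'a) mpoly) \<Rightarrow> 'b \<Rightarrow> ('v, 'a) mpoly)"
proof -
  have "Const (a * b) = (Const a * Const b :: ('v, 'a) mpoly)" for a b :: 'a
    by (simp add: Const_def mult_single)
  then show ?thesis
    by unfold_locales
      (simp_all add: scale_def fun_eq_iff distrib_left distrib_right mult.assoc,
       simp_all add: Const_def single_add distrib_right)
qed

definition homogeneous_part ::
  "('b \<Rightarrow> nat) \<Rightarrow> int \<Rightarrow> ('b \<Rightarrow> ('v, 'a::comm_ring_1) mpoly) set"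
where
  "homogeneous_part s k = {x. \<forall>b. \<forall>m\<in>Poly_Mapping.keys (x b). int (mdeg m) + int (s b) = k}"

text \<open>The degree \<open>k\<close> part of the \<open>i\<close>-th homology of \<open>S/I \<otimes>\<^sub>S P\<close>, where \<open>I\<close> is a homogeneous ideal.
  As \<open>S/I \<otimes>\<^sub>S P\<^sub>i = P\<^sub>i/IP\<^sub>i\<close>, its cycles and boundaries are the images of the two subspaces
  below of \<open>P\<^sub>i\<close>, both of which contain \<open>IP\<^sub>i\<close> in degree \<open>k\<close>.  These subspaces are finite
  dimensional for finite \<open>V\<close> and finite bases.\<close>

definition Tor_cycles ::
  "'v set \<Rightarrow> ('v, 'a::comm_ring_1) mpoly set \<Rightarrow> ('b, 'v, 'a) free_complex \<Rightarrow> nat \<Rightarrow> int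
     \<Rightarrow> ('b \<Rightarrow> ('v, 'a) mpoly) set"
where
  "Tor_cycles V I P i k =
     {x \<in> free_mod V (basis P i) \<inter> homogeneous_part (shift P i) k. \<forall>c. boundary P i x c \<in> I}"

definition Tor_boundaries ::
  "'v set \<Rightarrow> ('v, 'a::comm_ring_1) mpoly set \<Rightarrow> ('b, 'v, 'a) free_complex \<Rightarrow> nat \<Rightarrow> int
     \<Rightarrow> ('b \<Rightarrow> ('v, 'a) mpoly) set"
where
  "Tor_boundaries V I P i k =
     {x \<in> free_mod V (basis P i) \<inter> homogeneous_part (shift P i) k.
        \<exists>y\<in>free_mod V (basis P (Suc i)). \<forall>b. x b - boundary P (Suc i) y b \<in> I}"

definition Tor_dim ::
  "'v set \<Rightarrow> ('v, 'a::field) mpoly set \<Rightarrow> ('b, 'v, 'a) free_complex \<Rightarrow> nat \<Rightarrow> int \<Rightarrow> nat"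
where
  "Tor_dim V I P i k =
     vector_space.dim scale (Tor_cycles V I P i k) - vector_space.dim scale (Tor_boundaries V I P i k)"

text \<open>\<open>Tor(S/I, \<bbbF>)\<close> may be computed from any graded free resolution of \<open>\<bbbF>\<close>.  We take the
  Koszul complex; theorem \<open>koszul_resolution\<close> below shows that it is one.\<close>

definition koszul_sign :: "'v set \<Rightarrow> 'v set \<Rightarrow> 'v \<Rightarrow> 'a::comm_ring_1" where
  "koszul_sign V A v = (-1) ^ card {u \<in> A. to_nat_on V u < to_nat_on V v}"

definition koszul :: "'v set \<Rightarrow> ('v set, 'v, 'a::comm_ring_1) free_complex" where
  "koszul V =
     \<lparr>basis = (\<lambda>i. {A. A \<subseteq> V \<and> card A = i}),
      shift = (\<lambda>i A. i),
      bd = (\<lambda>i A C. \<Sum>v\<in>A. if C = A - {v} then Const (koszul_sign V A v) * Var v else 0)\<rparr>"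

lemma lookup_times_Const_Var:
  "Poly_Mapping.lookup (p * (Const c * Var v)) m =
     (if v \<in> Poly_Mapping.keys m
      then Poly_Mapping.lookup p (m - Poly_Mapping.single v 1) * c else 0)"
proof -
  let ?t = "Poly_Mapping.single v (1::nat)"
  have cv: "Const c * Var v = Poly_Mapping.single ?t c"
    by (simp add: Const_def Var_def mult_single)
  have key: "k + ?t = m \<longleftrightarrow> v \<in> Poly_Mapping.keys m \<and> k = m - ?t" for k
  proof
    assume "k + ?t = m"
    then show "v \<in> Poly_Mapping.keys m \<and> k = m - ?t"
      by (auto simp: lookup_add in_keys_iff)
  next
    assume a: "v \<in> Poly_Mapping.keys m \<and> k = m - ?t"
    show "k + ?t = m"
    proof (rule poly_mapping_eqI)
      fix w show "Poly_Mapping.lookup (k + ?t) w = Poly_Mapping.lookup m w"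
        using a by (cases "w = v") (auto simp: lookup_add lookup_minus lookup_single in_keys_iff)
    qed
  qed
  have p: "p = (\<Sum>k\<in>Poly_Mapping.keys p. Poly_Mapping.single k (Poly_Mapping.lookup p k))"
    by (rule poly_mapping_eqI)
      (simp add: lookup_sum lookup_single when_def sum.delta' in_keys_iff)
  have "Poly_Mapping.lookup (p * Poly_Mapping.single ?t c) m =
      (\<Sum>k\<in>Poly_Mapping.keys p. if k + ?t = m then Poly_Mapping.lookup p k * c else 0)"
    by (subst p) (simp add: sum_distrib_right lookup_sum mult_single lookup_single when_def)
  also have "\<dots> = (\<Sum>k\<in>Poly_Mapping.keys p. if k = m - ?t then
      (if v \<in> Poly_Mapping.keys m then Poly_Mapping.lookup p k * c else 0) else 0)"
    by (intro sum.cong refl) (simp only: key, simp)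
  also have "\<dots> = (if v \<in> Poly_Mapping.keys m then Poly_Mapping.lookup p (m - ?t) * c else 0)"
    by (auto simp: sum.delta in_keys_iff)
  finally show ?thesis by (simp add: cv)
qed

lemma koszul_simps [simp]:
  "basis (koszul V) i = {A. A \<subseteq> V \<and> card A = i}"
  "shift (koszul V) i A = i"
  "bd (koszul V) i A C = (\<Sum>v\<in>A. if C = A - {v} then Const (koszul_sign V A v) * Var v else 0)"
  by (simp_all add: koszul_def)

lemma koszul_boundary:
  assumes V: "finite V" and C: "C \<subseteq> V" "card C = i"
  shows "boundary (koszul V) (Suc i) x C =
    (\<Sum>v\<in>V - C. x (insert v C) * (Const (koszul_sign V (insert v C) v) * Var v))"
proof -
  let ?B = "{A. A \<subseteq> V \<and> card A = Suc i}"
  let ?g = "\<lambda>A v. x A * (Const (koszul_sign V A v) * Var v)"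
  have finB: "\<forall>A\<in>?B. finite A"
    using V by (blast intro: finite_subset)
  have finC: "finite C" using V C finite_subset by blast
  have fB: "finite ?B" using V by simp
  have "boundary (koszul V) (Suc i) x C =
      (\<Sum>A\<in>?B. \<Sum>v\<in>A. if C = A - {v} then ?g A v else 0)"
    using C by (simp add: sum_distrib_left if_distrib cong: if_cong)
  also have "\<dots> = (\<Sum>(A,v)\<in>Sigma ?B (\<lambda>A. A). if C = A - {v} then ?g A v else 0)"
    by (rule sum.Sigma[OF fB finB])
  also have "\<dots> = (\<Sum>(A,v)\<in>(\<lambda>v. (insert v C, v)) ` (V - C). if C = A - {v} then ?g A v else 0)"
  proof (rule sum.mono_neutral_right)
    show "finite (Sigma ?B (\<lambda>A. A))"
      by (rule finite_SigmaI[OF fB]) (use finB in blast)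
    show "(\<lambda>v. (insert v C, v)) ` (V - C) \<subseteq> Sigma ?B (\<lambda>A. A)"
      using C finC by auto
    show "\<forall>p\<in>Sigma ?B (\<lambda>A. A) - (\<lambda>v. (insert v C, v)) ` (V - C).
        (case p of (A, v) \<Rightarrow> if C = A - {v} then ?g A v else 0) = 0"
      by (auto simp: image_iff)
  qed
  also have "\<dots> = (\<Sum>v\<in>V - C. ?g (insert v C) v)"
    by (subst sum.reindex) (auto simp: inj_on_def intro!: sum.cong)
  finally show ?thesis .
qed

lemma koszul_boundary_notin:
  "\<not> (C \<subseteq> V \<and> card C = i) \<Longrightarrow> boundary (koszul V) (Suc i) x C = 0"
  by auto

lemma lookup_koszul_boundary:
  assumes V: "finite V" and C: "C \<subseteq> V" "card C = i"
  shows "Poly_Mapping.lookup (boundary (koszul V) (Suc i) x C) m =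
    (\<Sum>v\<in>V - C. if v \<in> Poly_Mapping.keys m then
       Poly_Mapping.lookup (x (insert v C)) (m - Poly_Mapping.single v 1) *
         koszul_sign V (insert v C) v else 0)"
  by (simp only: koszul_boundary[OF assms] lookup_sum lookup_times_Const_Var)

lemma koszul_sign_insert:
  assumes "finite A" "u \<notin> A"
  shows "koszul_sign V (insert u A) v =
    (if to_nat_on V u < to_nat_on V v then - koszul_sign V A v else koszul_sign V A v)"
proof -
  have "{w \<in> insert u A. to_nat_on V w < to_nat_on V v} =
    (if to_nat_on V u < to_nat_on V v then insert u {w \<in> A. to_nat_on V w < to_nat_on V v}
     else {w \<in> A. to_nat_on V w < to_nat_on V v})" by auto
  then show ?thesis using assms by (simp add: koszul_sign_def)
qed

lemma sum_antisym_pairs: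
  fixes f :: "'b \<Rightarrow> 'b \<Rightarrow> 'c::ab_group_add" and r :: "'b \<Rightarrow> nat"
  assumes fin: "finite S" and r: "inj_on r S"
    and f: "\<And>v w. v \<in> S \<Longrightarrow> w \<in> S \<Longrightarrow> v \<noteq> w \<Longrightarrow> f v w = - f w v"
  shows "(\<Sum>v\<in>S. \<Sum>w\<in>S - {v}. f v w) = 0"
proof -
  let ?L = "{p \<in> S \<times> S. r (fst p) < r (snd p)}" and ?G = "{p \<in> S \<times> S. r (snd p) < r (fst p)}"
  have "(\<Sum>v\<in>S. \<Sum>w\<in>S - {v}. f v w) = (\<Sum>(v,w)\<in>Sigma S (\<lambda>v. S - {v}). f v w)"
    using fin by (subst sum.Sigma) auto
  also have "Sigma S (\<lambda>v. S - {v}) = ?L \<union> ?G"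
    using r by (auto simp: inj_on_def) (metis linorder_neqE_nat)
  also have "(\<Sum>(v,w)\<in>?L \<union> ?G. f v w) = (\<Sum>(v,w)\<in>?L. f v w) + (\<Sum>(v,w)\<in>?G. f v w)"
    using fin by (intro sum.union_disjoint) auto
  also have "(\<Sum>(v,w)\<in>?G. f v w) = (\<Sum>(v,w)\<in>?L. f w v)"
    by (rule sum.reindex_bij_witness[where i = prod.swap and j = prod.swap]) auto
  also have "\<dots> = (\<Sum>(v,w)\<in>?L. - f v w)"
    by (rule sum.cong) (auto intro!: f)
  finally show ?thesis by (simp add: case_prod_unfold sum_negf)
qed

lemma koszul_boundary_boundary:
  assumes V: "finite V"
  shows "boundary (koszul V) (Suc i) (boundary (koszul V) (Suc (Suc i)) x) = (\<lambda>c. 0)"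
proof
  fix C
  show "boundary (koszul V) (Suc i) (boundary (koszul V) (Suc (Suc i)) x) C = 0"
  proof (cases "C \<subseteq> V \<and> card C = i")
    case False
    then show ?thesis by (rule koszul_boundary_notin)
  next
    case True
    then have C: "C \<subseteq> V" "card C = i" by auto
    have finC: "finite C" using V C finite_subset by blast
    let ?s = "koszul_sign V :: 'a set \<Rightarrow> 'a \<Rightarrow> 'b"
    define f where "f v w = x (insert w (insert v C)) * (Const (?s (insert w (insert v C)) w) * Var w)
       * (Const (?s (insert v C) v) * Var v)" for v w
    have inj: "inj_on (to_nat_on V) V" using V by (simp add: countable_finite inj_on_to_nat_on)
    have "boundary (koszul V) (Suc i) (boundary (koszul V) (Suc (Suc i)) x) C =
        (\<Sum>v\<in>V - C. (\<Sum>w\<in>V - insert v C. f v w))"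
      unfolding koszul_boundary[OF V C]
    proof (rule sum.cong[OF refl])
      fix v assume v: "v \<in> V - C"
      then have "insert v C \<subseteq> V" "card (insert v C) = Suc i" using C finC by auto
      then show "boundary (koszul V) (Suc (Suc i)) x (insert v C) *
          (Const (?s (insert v C) v) * Var v) = (\<Sum>w\<in>V - insert v C. f v w)"
        unfolding f_def by (subst koszul_boundary[OF V]) (auto simp: sum_distrib_right)
    qed
    also have "\<dots> = (\<Sum>v\<in>V - C. (\<Sum>w\<in>(V - C) - {v}. f v w))"
      by (intro sum.cong) auto
    also have "\<dots> = 0"
    proof (rule sum_antisym_pairs)
      show "finite (V - C)" using V by simp
      show "inj_on (to_nat_on V) (V - C)" using inj inj_on_subset by blast
      fix v w assume vw: "v \<in> V - C" "w \<in> V - C" "v \<noteq> w"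
      then have ne: "to_nat_on V v \<noteq> to_nat_on V w" using inj by (auto dest: inj_onD)
      have s1: "?s (insert w (insert v C)) w = ?s (insert v (insert w C)) w"
        by (simp add: insert_commute)
      have a: "?s (insert v (insert w C)) w =
          (if to_nat_on V v < to_nat_on V w then - ?s (insert w C) w else ?s (insert w C) w)"
        using vw finC by (intro koszul_sign_insert) auto
      have b: "?s (insert w (insert v C)) v =
          (if to_nat_on V w < to_nat_on V v then - ?s (insert v C) v else ?s (insert v C) v)"
        using vw finC by (intro koszul_sign_insert) auto
      have e: "insert v (insert w C) = insert w (insert v C)" by auto
      have neg: "Const (- c) = - Const c" for c :: 'b
        by (simp add: Const_def single_uminus)
      show "f v w = - f w v"
        unfolding f_def e using a b ne
        by (cases "to_nat_on V v < to_nat_on V w") (auto simp: e neg algebra_simps)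
    qed
    finally show ?thesis .
  qed
qed

lemma polys_0 [simp]: "0 \<in> polys V" by (simp add: polys_def)

lemma polys_add: "p \<in> polys V \<Longrightarrow> q \<in> polys V \<Longrightarrow> p + q \<in> polys V"
  using Poly_Mapping.keys_add[of p q] by (auto simp: polys_def)

lemma polys_sum: "(\<And>a. a \<in> A \<Longrightarrow> f a \<in> polys V) \<Longrightarrow> sum f A \<in> polys V"
  by (induction A rule: infinite_finite_induct) (auto intro: polys_add)

lemma polys_times_Const_Var:
  assumes "p \<in> polys V" "v \<in> V"
  shows "p * (Const c * Var v) \<in> polys V"
  unfolding polys_def
proof (intro CollectI ballI subsetI)
  fix m u assume m: "m \<in> Poly_Mapping.keys (p * (Const c * Var v))"
    and u: "u \<in> Poly_Mapping.keys m"
  have "m - Poly_Mapping.single v 1 \<in> Poly_Mapping.keys p"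
    using m by (auto simp: in_keys_iff lookup_times_Const_Var split: if_splits)
  then have sub: "Poly_Mapping.keys (m - Poly_Mapping.single v 1) \<subseteq> V"
    using assms by (auto simp: polys_def)
  show "u \<in> V"
  proof (cases "u = v")
    case False
    then have "u \<in> Poly_Mapping.keys (m - Poly_Mapping.single v 1)"
      using u by (simp add: in_keys_iff lookup_minus lookup_single)
    then show ?thesis using sub by blast
  qed (use assms in simp)
qed

lemma koszul_boundary_free_mod:
  assumes V: "finite V" and x: "x \<in> free_mod V {A. A \<subseteq> V \<and> card A = Suc i}"
  shows "boundary (koszul V) (Suc i) x \<in> free_mod V {A. A \<subseteq> V \<and> card A = i}"
proof -
  have "boundary (koszul V) (Suc i) x C \<in> polys V" if C: "C \<subseteq> V" "card C = i" for C
  proof -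
    have "finite C" using V C finite_subset by blast
    then have "x (insert v C) \<in> polys V" if "v \<in> V - C" for v
      using that x C by (auto simp: free_mod_def)
    then show ?thesis
      unfolding koszul_boundary[OF V C] by (intro polys_sum polys_times_Const_Var) auto
  qed
  then show ?thesis
    by (auto simp: free_mod_def koszul_boundary_notin simp del: boundary.simps)
qed

text \<open>The contracting homotopy divides by the first variable of the multidegree and multiplies by
  the corresponding exterior generator.\<close>

definition first_var :: "'v set \<Rightarrow> ('v \<Rightarrow>\<^sub>0 nat) \<Rightarrow> 'v set \<Rightarrow> 'v" where
  "first_var V m A = arg_min_on (to_nat_on V) (Poly_Mapping.keys m \<union> A)"

definition koszul_homotopy ::
  "'v set \<Rightarrow> nat \<Rightarrow> ('v set \<Rightarrow> ('v, 'a::comm_ring_1) mpoly) \<Rightarrow> 'v set \<Rightarrow> ('v, 'a) mpoly"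
where
  "koszul_homotopy V i x A = (if A \<subseteq> V \<and> card A = i then
     Abs_poly_mapping (\<lambda>m. if first_var V m A \<in> A then
       Poly_Mapping.lookup (x (A - {first_var V m A}))
         (m + Poly_Mapping.single (first_var V m A) 1) else 0) else 0)"

lemma lookup_koszul_homotopy:
  assumes V: "finite V" and A: "A \<subseteq> V" "card A = i"
  shows "Poly_Mapping.lookup (koszul_homotopy V i x A) m =
    (if first_var V m A \<in> A then Poly_Mapping.lookup (x (A - {first_var V m A}))
         (m + Poly_Mapping.single (first_var V m A) 1) else 0)"
proof -
  let ?f = "\<lambda>m. if first_var V m A \<in> A then Poly_Mapping.lookup (x (A - {first_var V m A}))
         (m + Poly_Mapping.single (first_var V m A) 1) else 0"
  have "{m. ?f m \<noteq> 0} \<subseteq>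
      (\<Union>v\<in>A. (\<lambda>m. m - Poly_Mapping.single v 1) ` Poly_Mapping.keys (x (A - {v})))"
  proof
    fix m assume "m \<in> {m. ?f m \<noteq> 0}"
    then have v: "first_var V m A \<in> A" and
      k: "m + Poly_Mapping.single (first_var V m A) 1 \<in> Poly_Mapping.keys (x (A - {first_var V m A}))"
      by (auto simp: in_keys_iff split: if_splits)
    have "m = (m + Poly_Mapping.single (first_var V m A) 1) - Poly_Mapping.single (first_var V m A) 1"
      by simp
    then show "m \<in> (\<Union>v\<in>A. (\<lambda>m. m - Poly_Mapping.single v 1) ` Poly_Mapping.keys (x (A - {v})))"
      using v k by blast
  qed
  moreover have "finite A" using V A finite_subset by blast
  then have "finite (\<Union>v\<in>A. (\<lambda>m. m - Poly_Mapping.single v 1) ` Poly_Mapping.keys (x (A - {v})))"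
    by simp
  ultimately have "finite {m. ?f m \<noteq> 0}" by (rule finite_subset)
  then show ?thesis using A by (simp add: koszul_homotopy_def)
qed

lemma koszul_homotopy_free_mod:
  assumes V: "finite V" and x: "x \<in> free_mod V {A. A \<subseteq> V \<and> card A = i}"
  shows "koszul_homotopy V (Suc i) x \<in> free_mod V {A. A \<subseteq> V \<and> card A = Suc i}"
proof -
  have "koszul_homotopy V (Suc i) x A \<in> polys V" if A: "A \<subseteq> V" "card A = Suc i" for A
    unfolding polys_def
  proof (intro CollectI ballI)
    fix m assume "m \<in> Poly_Mapping.keys (koszul_homotopy V (Suc i) x A)"
    then have v: "first_var V m A \<in> A" and
      k: "m + Poly_Mapping.single (first_var V m A) 1 \<in> Poly_Mapping.keys (x (A - {first_var V m A}))"
      by (auto simp: in_keys_iff lookup_koszul_homotopy[OF V A] split: if_splits)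
    have "card (A - {first_var V m A}) = i" "A - {first_var V m A} \<subseteq> V" using v A by auto
    then have "x (A - {first_var V m A}) \<in> polys V"
      using x by (simp add: free_mod_def)
    then have "Poly_Mapping.keys (m + Poly_Mapping.single (first_var V m A) 1) \<subseteq> V"
      using k by (auto simp: polys_def)
    then show "Poly_Mapping.keys m \<subseteq> V"
      by (auto simp: in_keys_iff lookup_add subset_iff)
  qed
  then show ?thesis by (auto simp: free_mod_def koszul_homotopy_def)
qed

lemma koszul_exact:
  assumes V: "finite V" and x: "x \<in> free_mod V {A. A \<subseteq> V \<and> card A = i}"
    and z: "boundary (koszul V) i x = (\<lambda>c. 0)"
    and z0: "i = 0 \<Longrightarrow> Poly_Mapping.lookup (x {}) 0 = 0"
  shows "boundary (koszul V) (Suc i) (koszul_homotopy V (Suc i) x) = x"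
proof
  fix A
  note One_nat_def [simp del]
  let ?h = "koszul_homotopy V (Suc i) x" and ?s = "koszul_sign V :: 'a set \<Rightarrow> 'a \<Rightarrow> 'b"
  let ?t = "\<lambda>v. Poly_Mapping.single v (1::nat)" and ?r = "to_nat_on V"
  have inj: "inj_on ?r V" using V by (simp add: countable_finite inj_on_to_nat_on)
  show "boundary (koszul V) (Suc i) ?h A = x A"
  proof (cases "A \<subseteq> V \<and> card A = i")
    case False
    then show ?thesis using x by (auto simp: free_mod_def)
  next
    case True
    then have A: "A \<subseteq> V" "card A = i" by auto
    have finA: "finite A" using V A finite_subset by blast
    have bh: "boundary (koszul V) (Suc i) ?h A \<in> polys V" "x A \<in> polys V"
      using koszul_boundary_free_mod[OF V koszul_homotopy_free_mod[OF V x]] x A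
      by (auto simp: free_mod_def simp del: boundary.simps)
    show ?thesis
    proof (rule poly_mapping_eqI)
      fix m
      show "Poly_Mapping.lookup (boundary (koszul V) (Suc i) ?h A) m = Poly_Mapping.lookup (x A) m"
      proof (cases "Poly_Mapping.keys m \<subseteq> V")
        case False
        then show ?thesis using bh unfolding polys_def by (metis (mono_tags, lifting) in_keys_iff mem_Collect_eq)
      next
        case m: True
        let ?S = "Poly_Mapping.keys m \<union> A"
        define v where "v = first_var V m A"
        have fin: "finite ?S" using finA by simp
        have hl: "Poly_Mapping.lookup (?h (insert u A)) (m - ?t u) =
            (if v \<in> insert u A then Poly_Mapping.lookup (x (insert u A - {v})) (m - ?t u + ?t v) else 0)"
          if u: "u \<in> V - A" "u \<in> Poly_Mapping.keys m" for u
        proof -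
          have "Poly_Mapping.keys (m - ?t u) \<union> insert u A = ?S"
          proof (intro equalityI subsetI)
            fix w assume "w \<in> Poly_Mapping.keys (m - ?t u) \<union> insert u A"
            then show "w \<in> ?S" using u by (auto simp: in_keys_iff lookup_minus)
          next
            fix w assume "w \<in> ?S"
            then show "w \<in> Poly_Mapping.keys (m - ?t u) \<union> insert u A"
              by (cases "w = u") (auto simp: in_keys_iff lookup_minus lookup_single)
          qed
          then have "first_var V (m - ?t u) (insert u A) = v" by (simp add: first_var_def v_def)
          moreover have "insert u A \<subseteq> V" "card (insert u A) = Suc i" using u A finA by auto
          ultimately show ?thesis by (simp add: lookup_koszul_homotopy[OF V])
        qed
        have lhs: "Poly_Mapping.lookup (boundary (koszul V) (Suc i) ?h A) m =
           (\<Sum>u\<in>V - A. if u \<in> Poly_Mapping.keys m then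
              (if v \<in> insert u A then Poly_Mapping.lookup (x (insert u A - {v})) (m - ?t u + ?t v) else 0)
               * ?s (insert u A) u else 0)"
          unfolding lookup_koszul_boundary[OF V A] by (intro sum.cong refl) (simp add: hl)
        show ?thesis
        proof (cases "?S = {}")
          case True
          then have "A = {}" "Poly_Mapping.keys m = {}" by auto
          then have "A = {}" "m = 0" by auto
          then show ?thesis using z0 A unfolding lhs by simp
        next
          case ne: False
          have v: "v \<in> ?S" "\<And>u. u \<in> ?S \<Longrightarrow> ?r v \<le> ?r u"
            using arg_min_if_finite[OF fin ne, of ?r]
            unfolding v_def first_var_def by (auto simp: not_less)
          have vV: "v \<in> V" using v(1) m A by auto
          have sv: "?s B v = 1" if "B \<subseteq> ?S" for B
          proof -
            have "{u \<in> B. ?r u < ?r v} = {}" using v(2) that by (auto simp: not_less[symmetric])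
            then show ?thesis unfolding koszul_sign_def by (simp only: card.empty power_0)
          qed
          show ?thesis
          proof (cases "v \<in> A")
            case False
            then have vm: "v \<in> Poly_Mapping.keys m" using v by auto
            have mm: "m - ?t v + ?t v = m"
            proof (rule poly_mapping_eqI)
              fix w show "Poly_Mapping.lookup (m - ?t v + ?t v) w = Poly_Mapping.lookup m w"
                using vm by (cases "w = v") (auto simp: lookup_add lookup_minus lookup_single in_keys_iff)
            qed
            have "Poly_Mapping.lookup (boundary (koszul V) (Suc i) ?h A) m =
              (\<Sum>u\<in>V - A. if u = v then Poly_Mapping.lookup (x A) m else 0)"
              unfolding lhs using False vm mm sv[of "insert v A"] v
              by (intro sum.cong refl) auto
            also have "\<dots> = Poly_Mapping.lookup (x A) m"
              using V vV False by (simp add: sum.delta)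
            finally show ?thesis .
          next
            case vA: True
            let ?C = "A - {v}" and ?m = "m + ?t v"
            have iC: "insert v ?C = A" using vA by auto
            obtain k where k: "i = Suc k" using vA A finA by (cases i) auto
            have C: "?C \<subseteq> V" "card ?C = k" using A vA finA k by auto
            define g where "g u = (if u \<in> Poly_Mapping.keys m then
                Poly_Mapping.lookup (x (insert u A - {v})) (m - ?t u + ?t v) * ?s (insert u A) u else 0)" for u
            have "0 = Poly_Mapping.lookup (boundary (koszul V) (Suc k) x ?C) ?m"
              using z k by simp
            also have "\<dots> = (\<Sum>u\<in>V - ?C. if u \<in> Poly_Mapping.keys ?m then
                 Poly_Mapping.lookup (x (insert u ?C)) (?m - ?t u) * ?s (insert u ?C) u else 0)"
              by (rule lookup_koszul_boundary[OF V C])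
            also have "V - ?C = insert v (V - A)" using vV by auto
            also have "(\<Sum>u\<in>insert v (V - A). if u \<in> Poly_Mapping.keys ?m then
                 Poly_Mapping.lookup (x (insert u ?C)) (?m - ?t u) * ?s (insert u ?C) u else 0) =
                 Poly_Mapping.lookup (x A) m +
                 (\<Sum>u\<in>V - A. if u \<in> Poly_Mapping.keys ?m then
                   Poly_Mapping.lookup (x (insert u ?C)) (?m - ?t u) * ?s (insert u ?C) u else 0)"
              using V vA iC sv[of A]
              by (subst sum.insert) (auto simp: in_keys_iff lookup_add)
            also have "(\<Sum>u\<in>V - A. if u \<in> Poly_Mapping.keys ?m then
                   Poly_Mapping.lookup (x (insert u ?C)) (?m - ?t u) * ?s (insert u ?C) u else 0)
                 = (\<Sum>u\<in>V - A. - g u)"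
            proof (intro sum.cong refl)
              fix u assume u: "u \<in> V - A"
              then have uv: "u \<noteq> v" using vA by auto
              have km: "u \<in> Poly_Mapping.keys ?m \<longleftrightarrow> u \<in> Poly_Mapping.keys m"
                using uv by (simp add: in_keys_iff lookup_add lookup_single)
              have "?s (insert u ?C) u = - ?s (insert u A) u" if um: "u \<in> Poly_Mapping.keys m"
              proof -
                have "?r v \<le> ?r u" using v um by auto
                moreover have "?r v \<noteq> ?r u" using uv u vV inj by (auto dest: inj_onD)
                ultimately have lt: "?r v < ?r u" by simp
                have "insert v (insert u ?C) = insert u A" using vA by auto
                moreover have "?s (insert v (insert u ?C)) u = - ?s (insert u ?C) u"
                  using lt uv finA by (subst koszul_sign_insert) auto
                ultimately show ?thesis by simp
              qed
              moreover have "insert u ?C = insert u A - {v}" using uv by auto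
              moreover have "?m - ?t u = m - ?t u + ?t v"
              proof (rule poly_mapping_eqI)
                fix w show "Poly_Mapping.lookup (?m - ?t u) w = Poly_Mapping.lookup (m - ?t u + ?t v) w"
                  using uv by (cases "w = v"; cases "w = u") (auto simp: lookup_add lookup_minus lookup_single)
              qed
              ultimately show "(if u \<in> Poly_Mapping.keys ?m then
                   Poly_Mapping.lookup (x (insert u ?C)) (?m - ?t u) * ?s (insert u ?C) u else 0) = - g u"
                using km by (simp add: g_def)
            qed
            finally have "Poly_Mapping.lookup (x A) m = (\<Sum>u\<in>V - A. g u)" by (simp add: sum_negf)
            also have "\<dots> = Poly_Mapping.lookup (boundary (koszul V) (Suc i) ?h A) m"
              unfolding lhs g_def using vA by (intro sum.cong refl) auto
            finally show ?thesis by simp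
          qed
        qed
      qed
    qed
  qed
qed

theorem koszul_resolution:
  assumes V: "finite V"
  shows "graded_free_resolution V (koszul V :: ('v set, 'v, 'a::field) free_complex) (\<lambda>_. 1)"
  unfolding graded_free_resolution_def
proof (intro conjI allI ballI)
  let ?K = "koszul V :: ('v set, 'v, 'a::field) free_complex"
  have basis0: "{A. A \<subseteq> V \<and> card A = 0} = {{}}"
    using V by (auto dest: finite_subset)
  have aug: "augment ?K (\<lambda>_. 1) x = Poly_Mapping.lookup (x {}) 0" for x
    by (simp add: augment_def basis0 del: card_eq_0_iff)
  fix i
  show "finite (basis ?K i)" using V by simp
  show "{x \<in> free_mod V (basis ?K (Suc i)). boundary ?K (Suc i) x = (\<lambda>c. 0)} =
      boundary ?K (Suc (Suc i)) ` free_mod V (basis ?K (Suc (Suc i)))" (is "?Z = ?B")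
  proof (intro equalityI subsetI)
    fix x assume "x \<in> ?Z"
    then have x: "x \<in> free_mod V {A. A \<subseteq> V \<and> card A = Suc i}" "boundary ?K (Suc i) x = (\<lambda>c. 0)"
      by (auto simp del: boundary.simps)
    show "x \<in> ?B"
      using koszul_exact[OF V x] koszul_homotopy_free_mod[OF V x(1)]
      by (auto simp del: boundary.simps intro!: image_eqI[OF sym])
  next
    fix x assume "x \<in> ?B"
    then show "x \<in> ?Z"
      using koszul_boundary_free_mod[OF V] koszul_boundary_boundary[OF V]
      by (auto simp del: boundary.simps)
  qed
  show "{x \<in> free_mod V (basis ?K 0). augment ?K (\<lambda>_. 1) x = 0} =
      boundary ?K 1 ` free_mod V (basis ?K 1)" (is "?Z0 = ?B0")
  proof (intro equalityI subsetI)
    fix x assume "x \<in> ?Z0"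
    then have x: "x \<in> free_mod V {A. A \<subseteq> V \<and> card A = 0}" "Poly_Mapping.lookup (x {}) 0 = 0"
      by (auto simp: aug simp del: card_eq_0_iff)
    have "boundary ?K (Suc 0) (koszul_homotopy V (Suc 0) x) = x"
      by (rule koszul_exact[OF V x(1)]) (use x in auto)
    then show "x \<in> ?B0"
      using koszul_homotopy_free_mod[OF V x(1)]
      by (auto simp del: boundary.simps intro!: image_eqI[OF sym])
  next
    fix x assume "x \<in> ?B0"
    then obtain y where y: "y \<in> free_mod V {A. A \<subseteq> V \<and> card A = Suc 0}"
      and x: "x = boundary ?K (Suc 0) y" by (auto simp del: boundary.simps)
    have "Poly_Mapping.lookup (x {}) 0 = 0"
      unfolding x by (subst lookup_koszul_boundary[OF V]) auto
    then show "x \<in> ?Z0"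
      using koszul_boundary_free_mod[OF V y] by (simp add: aug x del: boundary.simps card_eq_0_iff)
  qed
  show "augment ?K (\<lambda>_. 1) ` free_mod V (basis ?K 0) = UNIV"
  proof (intro equalityI subsetI UNIV_I)
    fix c :: 'a
    let ?x = "\<lambda>A. if A = {} then Const c else 0 :: ('v, 'a) mpoly"
    have "?x \<in> free_mod V (basis ?K 0)"
      by (auto simp: free_mod_def polys_def Const_def split: if_splits)
    moreover have "augment ?K (\<lambda>_. 1) ?x = c" by (simp add: aug Const_def)
    ultimately show "c \<in> augment ?K (\<lambda>_. 1) ` free_mod V (basis ?K 0)" by (metis image_eqI)
  qed
  {
    fix A assume "A \<in> basis ?K 0" show "(1::'a) \<noteq> 0 \<longrightarrow> shift ?K 0 A = 0" by simp
  }
  {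
    fix A C assume A: "A \<in> basis ?K (Suc i)"
    have "1 * (Const (koszul_sign V A v) * Var v) \<in> polys V" if "v \<in> A" for v
      by (rule polys_times_Const_Var) (use A that in \<open>auto simp: polys_def simp flip: single_one\<close>)
    then show "bd ?K i A C \<in> polys V" by (auto intro!: polys_sum)
    fix m assume C: "C \<in> basis ?K i" and m: "m \<in> Poly_Mapping.keys (bd ?K i A C)"
    from m obtain v where "m \<in> Poly_Mapping.keys (Const (koszul_sign V A v) * Var v :: ('v,'a) mpoly)"
      by (auto dest!: subsetD[OF keys_sum] split: if_splits)
    then have "m = Poly_Mapping.single v 1"
      by (auto simp: Const_def Var_def mult_single split: if_splits)
    then show "mdeg m + shift ?K i C = shift ?K (Suc i) A" by (simp add: mdeg_def)
  }
qed

(* Here i is the homological and k the internal degree; beta_{i,i+j} is betti F Delta i (i + j). *)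
definition betti :: "'a::field itself \<Rightarrow> 'v set set \<Rightarrow> int \<Rightarrow> int \<Rightarrow> nat" where
  "betti F \<Delta> i k =
     (if i < 0 then 0
      else Tor_dim (\<Union>\<Delta>) (SR_ideal \<Delta> :: ('v, 'a) mpoly set) (koszul (\<Union>\<Delta>)) (nat i) k)"

definition binom :: "nat \<Rightarrow> int \<Rightarrow> nat" where
  "binom n k = (if k < 0 then 0 else n choose nat k)"

end

(*
  Koszul homology of F[Delta] splits by multidegree. In a squarefree multidegree W it is the reduced
  cohomology of the induced subcomplex Delta_W, and in every other multidegree toggling a repeated
  variable is a contracting homotopy; this is Hochster's formula.

  Let Delta be the connected sum of Delta' and a cross-polytope along a facet F, with N the set of new
  vertices, and compare Delta_W with Delta'_{W'}, where W' are the old vertices of W and T the new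
  ones. If some vertex of the cross-polytope occurs in W without its antipode, the new faces can be
  removed by collapses, except that T is an extra connected component when W' avoids F. If T is
  exactly antipodal to W' Int F, all new faces but the face T collapse, and T carries the
  fundamental class of a cross-polytope. Removing F from Delta'_{W'} creates a class in degree d - 2,
  or kills the fundamental class when W' is everything. The dimensions therefore change by explicit
  indicator functions of (W', T), whose sum over all W of given size only involves binomial
  coefficients. This recursion determines all Betti numbers, over every field.
*)
theory Submission
  imports Defs
begin

section \<open>Linear algebra\<close>

text \<open>Signs are the main obstacle. Hochster's formula gives every \<open>W\<close> its own
  coboundary, with signs computed from \<open>W - \<tau>\<close>, while the gluing step restricts a
  complex on \<open>W \<union> T\<close> to \<open>W\<close>, so no common orientation is available.
  Every topological statement is therefore proved for arbitrary \<open>incidence\<close> functions,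
  and the numerical invariant lets the signs vary with \<open>W\<close>. Apart from direct sums,
  exact sequences are replaced by two operations: deleting an acyclic upper set of faces and
  deleting one facet. The effect of the second depends on whether the indicator cochain of the facet
  is a coboundary. Hence the induction carries, besides cohomology, the statement that no facet of
  the sphere is null. In the final formula \<open>n - 2 * d\<close> is the number of old vertices
  outside the gluing facet, and the factors \<open>d choose s\<close> count the sets of new
  vertices. The range \<open>1 \<le> j \<le> d - 2\<close> avoids the effects of the empty old part
  in degree 0 and of the deleted facet in degrees \<open>d - 1\<close> and \<open>d\<close>. For
  \<open>d = 1\<close> the glued vertices themselves disappear, so that case stands apart.\<close>

lemma (in vector_space) dim_mono_finite:
  assumes "A \<subseteq> B" "B \<subseteq> span S" "finite S"
  shows "dim A \<le> dim B"
proof -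
  obtain K where K: "K \<subseteq> A" "independent K" "A \<subseteq> span K" "card K = dim A"
    using basis_exists by blast
  obtain L where L: "K \<subseteq> L" "L \<subseteq> B" "independent L" "B \<subseteq> span L"
    using maximal_independent_subset_extend[of K B] K assms by blast
  have "finite L"
    using independent_span_bound[OF assms(3) L(3)] L(2) assms(2) by blast
  then have "card K \<le> card L" using L(1) by (rule card_mono)
  then show ?thesis using K(4) basis_card_eq_dim[OF L(2,4,3)] by simp
qed

text \<open>Rank-nullity inside a subspace of a possibly infinite-dimensional space: a basis
  \<open>K\<close> of the kernel extends to a basis \<open>L\<close> of \<open>S\<close>, and
  \<open>f\<close> is injective on the span of \<open>L - K\<close>. The finite set \<open>G\<close>
  guards against \<open>dim\<close> being the cardinality of an infinite basis, which is 0.\<close>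

lemma (in vector_space_pair) dim_kernel_image:
  assumes f: "Vector_Spaces.linear s1 s2 f" and S: "vs1.subspace S"
    and fin: "S \<subseteq> vs1.span G" "finite G"
  shows "vs1.dim S = vs2.dim (f ` S) + vs1.dim {x \<in> S. f x = 0}"
proof -
  let ?N = "{x \<in> S. f x = 0}"
  have N: "vs1.subspace ?N"
    using S by (auto simp: vs1.subspace_def linear_0[OF f] linear_add[OF f] linear_scale[OF f])
  obtain K where K: "K \<subseteq> ?N" "vs1.independent K" "?N \<subseteq> vs1.span K" "card K = vs1.dim ?N"
    using vs1.basis_exists by blast
  obtain L where L: "K \<subseteq> L" "L \<subseteq> S" "vs1.independent L" "S \<subseteq> vs1.span L"
    using vs1.maximal_independent_subset_extend[of K S] K(1,2) by blast
  have finL: "finite L"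
    using vs1.independent_span_bound[OF fin(2) L(3)] L(2) fin(1) by blast
  have indLK: "vs1.independent (L - K)"
    using L(3) vs1.independent_mono by blast
  have inj: "inj_on f (vs1.span (L - K))"
  proof (subst linear_inj_on_iff_eq_0[OF f])
    show "vs1.subspace (vs1.span (L - K))" by (rule vs1.subspace_span)
    show "\<forall>x\<in>vs1.span (L - K). f x = 0 \<longrightarrow> x = 0"
    proof (intro ballI impI)
      fix x assume x: "x \<in> vs1.span (L - K)" "f x = 0"
      have "x \<in> S" using x(1) L(2) S vs1.span_minimal[of "L - K" S] by blast
      then have "x \<in> vs1.span K" using x(2) K(3) by blast
      \<comment> \<open>A vector in both spans has the same coordinates over \<open>K\<close>, over
        \<open>L - K\<close> and over \<open>L\<close>, so every coordinate vanishes.\<close>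
      moreover have "vs1.span (L - K) \<inter> vs1.span K = {0}"
      proof -
        have "y = 0" if y: "y \<in> vs1.span (L - K)" "y \<in> vs1.span K" for y
        proof -
          have "vs1.representation (L - K) y = vs1.representation L y"
            "vs1.representation K y = vs1.representation L y"
            using vs1.representation_extend[OF L(3)] y L(1) by (metis Diff_subset)+
          then have "vs1.representation L y b = 0" for b
            using vs1.representation_ne_zero[of "L - K" y b] vs1.representation_ne_zero[of K y b] by (metis Diff_iff)
          moreover have "y \<in> vs1.span L" using y(2) vs1.span_mono[OF L(1)] by blast
          ultimately show "y = 0"
            using vs1.sum_representation_eq[OF L(3) _ finL subset_refl, of y] by simp
        qed
        then show ?thesis using vs1.span_zero by auto
      qed
      ultimately show "x = 0" using x(1) by blast
    qed
  qed
  have "vs2.dim (f ` S) = card (f ` (L - K))"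
  proof (rule sym, rule vs2.basis_card_eq_dim)
    show "f ` (L - K) \<subseteq> f ` S" using L by blast
    show "vs2.independent (f ` (L - K))"
      by (rule linear_independent_injective_image[OF f indLK inj])
    have "f ` S \<subseteq> f ` vs1.span L" using L(4) by (rule image_mono)
    also have "\<dots> = vs2.span (f ` L)" by (rule linear_span_image[OF f, symmetric])
    also have "f ` L \<subseteq> insert 0 (f ` (L - K))" using K(1) by auto
    then have "vs2.span (f ` L) \<subseteq> vs2.span (insert 0 (f ` (L - K)))" by (rule vs2.span_mono)
    finally show "f ` S \<subseteq> vs2.span (f ` (L - K))" by simp
  qed
  also have "\<dots> = card (L - K)"
    by (rule card_image) (rule inj_on_subset[OF inj vs1.span_superset])
  finally have "vs2.dim (f ` S) = card (L - K)" .
  moreover have "card (L - K) + card K = card L"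
    using finL L(1) by (metis card_Diff_subset card_mono finite_subset le_add_diff_inverse2)
  ultimately show ?thesis
    using K(4) vs1.basis_card_eq_dim[OF L(2,4,3)] by simp
qed

text \<open>The map has the same kernel on \<open>Z\<close> and on \<open>B\<close>, so the quotient
  keeps its dimension. Truncated subtraction is harmless, since rank-nullity adds the same number to
  both terms.\<close>

lemma (in vector_space_pair) dim_diff_image:
  assumes f: "Vector_Spaces.linear s1 s2 f" and Z: "vs1.subspace Z" and B: "vs1.subspace B"
    and sub: "B \<subseteq> Z" and ker: "\<And>x. x \<in> Z \<Longrightarrow> f x = 0 \<Longrightarrow> x \<in> B"
    and fin: "Z \<subseteq> vs1.span G" "finite G"
  shows "vs1.dim Z - vs1.dim B = vs2.dim (f ` Z) - vs2.dim (f ` B)"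
proof -
  have "{x \<in> Z. f x = 0} = {x \<in> B. f x = 0}" using sub ker by blast
  then show ?thesis
    using dim_kernel_image[OF f Z fin] dim_kernel_image[OF f B _ fin(2)] sub fin(1) by auto
qed

section \<open>Spaces of functions supported on finite sets of cells\<close>

definition fscale :: "'a \<Rightarrow> ('c \<Rightarrow> 'a::field) \<Rightarrow> 'c \<Rightarrow> 'a" where
  "fscale a f = (\<lambda>c. a * f c)"

lemma fscale_apply [simp]: "fscale a f c = a * f c" by (simp add: fscale_def)

interpretation fun_space: vector_space "fscale :: 'a::field \<Rightarrow> ('c \<Rightarrow> 'a) \<Rightarrow> 'c \<Rightarrow> 'a"
  by unfold_locales (simp_all add: fun_eq_iff algebra_simps)

abbreviation fdim :: "('c \<Rightarrow> 'a::field) set \<Rightarrow> nat" where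
  "fdim \<equiv> vector_space.dim fscale"

abbreviation flinear :: "(('c \<Rightarrow> 'a::field) \<Rightarrow> 'd \<Rightarrow> 'a) \<Rightarrow> bool" where
  "flinear \<equiv> Vector_Spaces.linear fscale fscale"

lemma flinear_iff:
  "flinear \<phi> \<longleftrightarrow> (\<forall>f h. \<phi> (f + h) = \<phi> f + \<phi> h) \<and> (\<forall>a f. \<phi> (fscale a f) = fscale a (\<phi> f))"
  by (simp add: Vector_Spaces.linear_iff fun_space.vector_space_axioms)

interpretation fun_pair: vector_space_pair
  "fscale :: 'a::field \<Rightarrow> ('c \<Rightarrow> 'a) \<Rightarrow> 'c \<Rightarrow> 'a" "fscale :: 'a \<Rightarrow> ('d \<Rightarrow> 'a) \<Rightarrow> 'd \<Rightarrow> 'a"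
  by unfold_locales

text \<open>Cochains are total functions that vanish off a set of cells. All subsets of cells thus
  share one ambient space, and passing to a subset changes no type.\<close>

definition supported :: "'c set \<Rightarrow> ('c \<Rightarrow> 'a::zero) set" where
  "supported S = {f. \<forall>c. c \<notin> S \<longrightarrow> f c = 0}"

definition unit_fun :: "'c \<Rightarrow> 'c \<Rightarrow> 'a::field" where
  "unit_fun c = (\<lambda>c'. if c' = c then 1 else 0)"

lemma supported_in_span:
  assumes "finite S"
  shows "supported S \<subseteq> fun_space.span (unit_fun ` S)"
proof
  fix f :: "'a \<Rightarrow> 'b" assume f: "f \<in> supported S"
  have "(\<Sum>c\<in>S. fscale (f c) (unit_fun c)) d = f d" for d
  proof -
    have "(\<Sum>c\<in>T. fscale (f c) (unit_fun c)) d = (\<Sum>c\<in>T. if d = c then f c else 0)" for T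
      by (induction T rule: infinite_finite_induct) (auto simp: unit_fun_def)
    then show ?thesis using assms f by (auto simp: supported_def sum.delta')
  qed
  then have "f = (\<Sum>c\<in>S. fscale (f c) (unit_fun c))" by (rule ext[symmetric, of _ "_"])
  also have "\<dots> \<in> fun_space.span (unit_fun ` S)"
    by (intro fun_space.span_sum fun_space.span_scale fun_space.span_base imageI)
  finally show "f \<in> fun_space.span (unit_fun ` S)" .
qed

lemma fdim_unit: "fdim {f. \<exists>a. f = fscale a (unit_fun c :: 'c \<Rightarrow> 'a::field)} = 1"
proof -
  have "unit_fun c \<noteq> (0 :: 'c \<Rightarrow> 'a)" by (auto simp: unit_fun_def fun_eq_iff)
  then have "fun_space.independent {unit_fun c :: 'c \<Rightarrow> 'a}" by simp
  then have "fdim (fun_space.span {unit_fun c :: 'c \<Rightarrow> 'a}) = 1"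
    using fun_space.dim_eq_card_independent[of "{unit_fun c :: 'c \<Rightarrow> 'a}"] by simp
  also have "fun_space.span {unit_fun c :: 'c \<Rightarrow> 'a} = {f. \<exists>a. f = fscale a (unit_fun c)}"
    by (auto simp: fun_space.span_singleton)
  finally show ?thesis .
qed

lemma fdim_zero: "fdim {0 :: 'c \<Rightarrow> 'a::field} = 0"
  using fun_space.dim_eq_card_independent[OF fun_space.independent_empty] fun_space.dim_span[of "{} :: ('c \<Rightarrow> 'a) set"]
  by simp

section \<open>Cochain complexes on finite sets of cells\<close>

definition restrict_fun :: "'c set \<Rightarrow> ('c \<Rightarrow> 'a::zero) \<Rightarrow> 'c \<Rightarrow> 'a" where
  "restrict_fun Q f = (\<lambda>c. if c \<in> Q then f c else 0)"

lemma restrict_fun_apply: "restrict_fun Q f c = (if c \<in> Q then f c else 0)"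
  by (simp add: restrict_fun_def)

text \<open>Only the values of \<open>\<delta>\<close> on \<open>Q\<close> count, so a single
  operator serves every subset of cells.\<close>

definition cocycles ::
  "(('c \<Rightarrow> 'a::field) \<Rightarrow> 'c \<Rightarrow> 'a) \<Rightarrow> ('c \<Rightarrow> nat) \<Rightarrow> 'c set \<Rightarrow> nat \<Rightarrow> ('c \<Rightarrow> 'a) set" where
  "cocycles \<delta> g Q j = {f \<in> supported {c \<in> Q. g c = j}. \<forall>c\<in>Q. \<delta> f c = 0}"

text \<open>The source degree is expressed by \<open>Suc (g c) = j\<close> instead of
  \<open>j - 1\<close>, so that degree 0 receives nothing.\<close>

definition coboundaries ::
  "(('c \<Rightarrow> 'a::field) \<Rightarrow> 'c \<Rightarrow> 'a) \<Rightarrow> ('c \<Rightarrow> nat) \<Rightarrow> 'c set \<Rightarrow> nat \<Rightarrow> ('c \<Rightarrow> 'a) set" where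
  "coboundaries \<delta> g Q j = (\<lambda>f. restrict_fun Q (\<delta> f)) ` supported {c \<in> Q. Suc (g c) = j}"

definition hdim ::
  "(('c \<Rightarrow> 'a::field) \<Rightarrow> 'c \<Rightarrow> 'a) \<Rightarrow> ('c \<Rightarrow> nat) \<Rightarrow> 'c set \<Rightarrow> nat \<Rightarrow> nat" where
  "hdim \<delta> g Q j = fdim (cocycles \<delta> g Q j) - fdim (coboundaries \<delta> g Q j)"

definition acyclic_on ::
  "(('c \<Rightarrow> 'a::field) \<Rightarrow> 'c \<Rightarrow> 'a) \<Rightarrow> ('c \<Rightarrow> nat) \<Rightarrow> 'c set \<Rightarrow> bool" where
  "acyclic_on \<delta> g Q \<longleftrightarrow> (\<forall>j. cocycles \<delta> g Q j \<subseteq> coboundaries \<delta> g Q j)"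

text \<open>Cutting values off outside \<open>Q\<close> can destroy the vanishing of the square, so
  the last conjunct speaks of the cut-down operator. For families of faces it will follow from
  convexity.\<close>

definition cochain_complex ::
  "(('c \<Rightarrow> 'a::field) \<Rightarrow> 'c \<Rightarrow> 'a) \<Rightarrow> ('c \<Rightarrow> nat) \<Rightarrow> 'c set \<Rightarrow> bool" where
  "cochain_complex \<delta> g Q \<longleftrightarrow> flinear \<delta> \<and> finite Q \<and>
     (\<forall>j. \<forall>f\<in>supported {c \<in> Q. g c = j}. \<forall>c\<in>Q. g c \<noteq> Suc j \<longrightarrow> \<delta> f c = 0) \<and>
     (\<forall>f\<in>supported Q. \<forall>c\<in>Q. \<delta> (restrict_fun Q (\<delta> f)) c = 0)"

lemma subspace_supported: "fun_space.subspace (supported S)"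
  by (auto simp: fun_space.subspace_def supported_def)

lemma flinear_restrict_fun: "flinear (restrict_fun Q)"
  by (auto simp: flinear_iff restrict_fun_def fun_eq_iff)

lemma flinear_add: "flinear \<phi> \<Longrightarrow> \<phi> (f + h) = \<phi> f + \<phi> h"
  and flinear_scale: "flinear \<phi> \<Longrightarrow> \<phi> (fscale a f) = fscale a (\<phi> f)"
  by (simp_all add: flinear_iff)

lemma flinear_zero: "flinear \<phi> \<Longrightarrow> \<phi> 0 = 0"
  by (rule fun_pair.linear_0)

lemma flinear_diff: "flinear \<phi> \<Longrightarrow> \<phi> (f - h) = \<phi> f - \<phi> h"
  by (rule fun_pair.linear_diff)

lemma flinear_compose: "flinear \<phi> \<Longrightarrow> flinear \<psi> \<Longrightarrow> flinear (\<lambda>f. \<phi> (\<psi> f))"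
  by (simp add: flinear_iff)

lemma subspace_cocycles: "flinear \<delta> \<Longrightarrow> fun_space.subspace (cocycles \<delta> g Q j)"
  using subspace_supported[of "{c \<in> Q. g c = j}"]
  by (auto simp: cocycles_def fun_space.subspace_def flinear_add flinear_scale flinear_zero)

lemma subspace_coboundaries:
  assumes "flinear \<delta>"
  shows "fun_space.subspace (coboundaries \<delta> g Q j)"
  unfolding coboundaries_def
  by (rule fun_pair.linear_subspace_image[OF _ subspace_supported])
    (rule flinear_compose[OF flinear_restrict_fun assms])

lemma cocycles_supported: "cocycles \<delta> g Q j \<subseteq> supported Q"
  by (auto simp: cocycles_def supported_def)

lemma coboundaries_supported: "coboundaries \<delta> g Q j \<subseteq> supported Q"
  by (auto simp: coboundaries_def supported_def restrict_fun_def)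

lemma fdim_supported_mono:
  assumes "A \<subseteq> B" "B \<subseteq> supported Q" "finite Q"
  shows "fdim A \<le> fdim B"
  by (rule fun_space.dim_mono_finite[OF assms(1), of "unit_fun ` Q"])
    (use assms supported_in_span[of Q] in auto)

lemma fdim_kernel_image:
  assumes "flinear \<phi>" "fun_space.subspace S" "S \<subseteq> supported Q" "finite Q"
  shows "fdim S = fdim (\<phi> ` S) + fdim {f \<in> S. \<phi> f = 0}"
  by (rule fun_pair.dim_kernel_image[OF assms(1,2), of "unit_fun ` Q"])
    (use assms supported_in_span[of Q] in auto)

lemma fdim_diff_image:
  assumes "flinear \<phi>" "fun_space.subspace Z" "fun_space.subspace B" "B \<subseteq> Z"
    "\<And>f. f \<in> Z \<Longrightarrow> \<phi> f = 0 \<Longrightarrow> f \<in> B" "Z \<subseteq> supported Q" "finite Q"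
  shows "fdim Z - fdim B = fdim (\<phi> ` Z) - fdim (\<phi> ` B)"
  by (rule fun_pair.dim_diff_image[OF assms(1-5), of "unit_fun ` Q"])
    (use assms supported_in_span[of Q] in auto)

lemma coboundaries_subset_cocycles:
  assumes "cochain_complex \<delta> g Q"
  shows "coboundaries \<delta> g Q j \<subseteq> cocycles \<delta> g Q j"
proof
  fix f assume "f \<in> coboundaries \<delta> g Q j"
  then obtain h where h: "h \<in> supported {c \<in> Q. Suc (g c) = j}" and f: "f = restrict_fun Q (\<delta> h)"
    by (auto simp: coboundaries_def)
  have hQ: "h \<in> supported Q" using h by (auto simp: supported_def)
  have "\<delta> h c = 0" if "c \<in> Q" "g c \<noteq> j" for c
  proof (cases j)
    case 0
    then have "h = 0" using h by (auto simp: supported_def)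
    then show ?thesis using assms flinear_zero[of \<delta>] by (auto simp: cochain_complex_def)
  next
    case (Suc i)
    then show ?thesis using assms h that by (auto simp: cochain_complex_def)
  qed
  then have "f \<in> supported {c \<in> Q. g c = j}"
    by (auto simp: f supported_def restrict_fun_def)
  then show "f \<in> cocycles \<delta> g Q j"
    using assms hQ by (auto simp: cocycles_def f cochain_complex_def)
qed

lemma hdim_acyclic:
  assumes "cochain_complex \<delta> g Q" "acyclic_on \<delta> g Q"
  shows "hdim \<delta> g Q j = 0"
proof -
  have "cocycles \<delta> g Q j = coboundaries \<delta> g Q j"
    using assms coboundaries_subset_cocycles[OF assms(1), of j] by (auto simp: acyclic_on_def)
  then show ?thesis by (simp add: hdim_def)
qed

lemma fdim_coboundaries_le:
  assumes "cochain_complex \<delta> g Q"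
  shows "fdim (coboundaries \<delta> g Q j) \<le> fdim (cocycles \<delta> g Q j)"
  using assms by (intro fdim_supported_mono[OF coboundaries_subset_cocycles cocycles_supported])
    (auto simp: cochain_complex_def)

lemma restrict_coboundaries:
  assumes QY: "Y \<subseteq> Q"
    and R: "\<And>f c. f \<in> supported Q \<Longrightarrow> c \<in> Y \<Longrightarrow> \<delta> (restrict_fun Y f) c = \<delta> f c"
  shows "restrict_fun Y ` coboundaries \<delta> g Q j = coboundaries \<delta> g Y j" (is "?R ` ?B = _")
proof (intro equalityI subsetI)
  fix f assume "f \<in> ?R ` ?B"
  then obtain h where h: "h \<in> supported {c \<in> Q. Suc (g c) = j}" "f = ?R (restrict_fun Q (\<delta> h))"
    by (auto simp: coboundaries_def)
  have "h \<in> supported Q" using h by (auto simp: supported_def)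
  then have "f = restrict_fun Y (\<delta> (?R h))"
    using R QY unfolding h(2) by (intro ext) (auto simp: restrict_fun_apply)
  moreover have "?R h \<in> supported {c \<in> Y. Suc (g c) = j}"
    using h(1) by (auto simp: supported_def restrict_fun_def)
  ultimately show "f \<in> coboundaries \<delta> g Y j" unfolding coboundaries_def by blast
next
  fix f assume "f \<in> coboundaries \<delta> g Y j"
  then obtain h where h: "h \<in> supported {c \<in> Y. Suc (g c) = j}" "f = restrict_fun Y (\<delta> h)"
    by (auto simp: coboundaries_def)
  then have "f = ?R (restrict_fun Q (\<delta> h))"
    using QY by (intro ext) (auto simp: restrict_fun_apply)
  moreover have "h \<in> supported {c \<in> Q. Suc (g c) = j}" using h(1) QY by (auto simp: supported_def)
  ultimately show "f \<in> ?R ` ?B" unfolding coboundaries_def by blast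
qed

text \<open>Cochains on \<open>U\<close> form an acyclic subcomplex with quotient the cochains on
  \<open>Y\<close>. In place of the long exact sequence, restriction to \<open>Y\<close> is shown to
  map cocycles onto cocycles and coboundaries onto coboundaries, with a kernel on cocycles that
  consists of coboundaries.\<close>

lemma hdim_remove_upper:
  assumes Q: "cochain_complex \<delta> g Q" and QY: "Q = Y \<union> U" "Y \<inter> U = {}"
    and up: "\<And>f c. f \<in> supported U \<Longrightarrow> c \<in> Y \<Longrightarrow> \<delta> f c = 0"
    and U: "acyclic_on \<delta> g U"
  shows "hdim \<delta> g Q j = hdim \<delta> g Y j"
proof -
  have lin: "flinear \<delta>" and fin: "finite Q"
    and deg: "\<And>j f c. f \<in> supported {c \<in> Q. g c = j} \<Longrightarrow> c \<in> Q \<Longrightarrow> g c \<noteq> Suc j \<Longrightarrow> \<delta> f c = 0"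
    and sq: "\<And>f c. f \<in> supported Q \<Longrightarrow> c \<in> Q \<Longrightarrow> \<delta> (restrict_fun Q (\<delta> f)) c = 0"
    using Q by (auto simp: cochain_complex_def)
  let ?R = "restrict_fun Y :: ('a \<Rightarrow> 'b) \<Rightarrow> 'a \<Rightarrow> 'b"
  let ?Z = "cocycles \<delta> g Q j" and ?B = "coboundaries \<delta> g Q j"
  have R: "\<delta> (?R f) c = \<delta> f c" if "f \<in> supported Q" "c \<in> Y" for f c
  proof -
    have "f - ?R f \<in> supported U" using that QY by (auto simp: supported_def restrict_fun_def)
    then have "\<delta> (f - ?R f) c = 0" using up that by blast
    then show ?thesis by (simp add: flinear_diff[OF lin])
  qed
  have Z: "?R ` ?Z = cocycles \<delta> g Y j"
  proof (intro equalityI subsetI)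
    fix f assume "f \<in> ?R ` ?Z"
    then obtain h where h: "h \<in> ?Z" "f = ?R h" by blast
    moreover have "h \<in> supported Q" using h cocycles_supported by blast
    ultimately show "f \<in> cocycles \<delta> g Y j"
      using R[of h] QY by (auto simp: cocycles_def supported_def restrict_fun_def)
  next
    fix f assume f: "f \<in> cocycles \<delta> g Y j"
    \<comment> \<open>The obstruction to \<open>f\<close> being a cocycle of \<open>Q\<close>. It
      lives on \<open>U\<close> and is itself a cocycle there, hence the coboundary of some
      \<open>u\<close>, and \<open>f - u\<close> is the required lift.\<close>
    let ?w = "restrict_fun U (\<delta> f)"
    have fQ: "f \<in> supported {c \<in> Q. g c = j}" using f QY by (auto simp: cocycles_def supported_def)
    have w: "restrict_fun Q (\<delta> f) = ?w"
      using f QY by (auto simp: cocycles_def restrict_fun_def fun_eq_iff)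
    have "?w \<in> cocycles \<delta> g U (Suc j)"
      using deg[OF fQ] sq[of f] fQ QY unfolding w
      by (auto simp: cocycles_def supported_def restrict_fun_def)
    then obtain u where u: "u \<in> supported {c \<in> U. Suc (g c) = Suc j}" "?w = restrict_fun U (\<delta> u)"
      using U by (force simp: acyclic_on_def coboundaries_def)
    have uU: "u \<in> supported U" using u by (auto simp: supported_def)
    have "f - u \<in> ?Z"
    proof -
      have "\<delta> (f - u) c = 0" if "c \<in> Q" for c
      proof (cases "c \<in> Y")
        case True
        then show ?thesis using f up[OF uU] by (simp add: flinear_diff[OF lin] cocycles_def)
      next
        case False
        then have "c \<in> U" using that QY by blast
        then show ?thesis using fun_cong[OF u(2), of c]
          by (simp add: flinear_diff[OF lin] restrict_fun_def)
      qed
      moreover have "f - u \<in> supported {c \<in> Q. g c = j}"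
        using fQ u(1) QY by (auto simp: supported_def)
      ultimately show ?thesis by (simp add: cocycles_def)
    qed
    moreover have "?R (f - u) = f"
      using f uU QY by (auto simp: cocycles_def supported_def restrict_fun_def fun_eq_iff)
    ultimately show "f \<in> ?R ` ?Z" by force
  qed
  have B: "?R ` ?B = coboundaries \<delta> g Y j"
    by (rule restrict_coboundaries) (use QY R in auto)
  \<comment> \<open>A cocycle killed by restriction lives on \<open>U\<close> and has a primitive
    there. The same primitive works in \<open>Q\<close>, because cochains on \<open>U\<close> have
    no coboundary on \<open>Y\<close>.\<close>
  have ker: "f \<in> ?B" if f: "f \<in> ?Z" "?R f = 0" for f
  proof -
    have "f c = 0" if "c \<in> Y" for c using fun_cong[OF f(2), of c] that by (simp add: restrict_fun_def)
    then have "f \<in> cocycles \<delta> g U j"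
      using f(1) QY by (auto simp: cocycles_def supported_def)
    then obtain u where u: "u \<in> supported {c \<in> U. Suc (g c) = j}" "f = restrict_fun U (\<delta> u)"
      using U by (force simp: acyclic_on_def coboundaries_def)
    have "u \<in> supported U" using u by (auto simp: supported_def)
    then have "f = restrict_fun Q (\<delta> u)"
      using up QY unfolding u(2) by (intro ext) (auto simp: restrict_fun_apply)
    moreover have "u \<in> supported {c \<in> Q. Suc (g c) = j}" using u QY by (auto simp: supported_def)
    ultimately show ?thesis unfolding coboundaries_def by blast
  qed
  show ?thesis
    unfolding hdim_def
    using fdim_diff_image[OF flinear_restrict_fun[of Y] subspace_cocycles[OF lin] subspace_coboundaries[OF lin]
        coboundaries_subset_cocycles[OF Q] ker cocycles_supported fin]
    by (simp add: Z B)
qed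

lemma supported_singleton: "f \<in> supported {c} \<longleftrightarrow> f = fscale (f c) (unit_fun c)"
  by (auto simp: supported_def unit_fun_def fun_eq_iff)

text \<open>Adding a cell above all others kills a class one degree below it if its indicator is a
  coboundary, and otherwise creates a class in its own degree. Cocycles and coboundaries are
  compared by restriction to \<open>Y\<close>, whose kernel is at most the line \<open>?L\<close>
  spanned by the indicator.\<close>

lemma hdim_remove_top_cell:
  assumes Q: "cochain_complex \<delta> g Q" and QY: "Q = insert c0 Y" "c0 \<notin> Y"
    and top: "\<And>c. c \<in> Y \<Longrightarrow> \<delta> (unit_fun c0) c = 0"
  shows "int (hdim \<delta> g Q j) =
    (if unit_fun c0 \<in> coboundaries \<delta> g Q (g c0)
     then int (hdim \<delta> g Y j) - (if Suc j = g c0 then 1 else 0)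
     else int (hdim \<delta> g Y j) + (if j = g c0 then 1 else 0))"
proof -
  have lin: "flinear \<delta>" and fin: "finite Q"
    and deg: "\<And>j f c. f \<in> supported {c \<in> Q. g c = j} \<Longrightarrow> c \<in> Q \<Longrightarrow> g c \<noteq> Suc j \<Longrightarrow> \<delta> f c = 0"
    and sq: "\<And>f c. f \<in> supported Q \<Longrightarrow> c \<in> Q \<Longrightarrow> \<delta> (restrict_fun Q (\<delta> f)) c = 0"
    using Q by (auto simp: cochain_complex_def)
  let ?u = "unit_fun c0 :: 'a \<Rightarrow> 'b" and ?L = "{f. \<exists>a. f = fscale a (unit_fun c0 :: 'a \<Rightarrow> 'b)}"
  let ?R = "restrict_fun Y :: ('a \<Rightarrow> 'b) \<Rightarrow> 'a \<Rightarrow> 'b"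
  let ?Z = "cocycles \<delta> g Q j" and ?B = "coboundaries \<delta> g Q j"
  let ?cob = "?u \<in> coboundaries \<delta> g Q (g c0)"
  have us: "?u \<in> supported {c \<in> Q. g c = g c0}"
    using QY by (auto simp: supported_def unit_fun_def)
  have du: "\<delta> ?u c = 0" if "c \<in> Q" for c
    using top deg[OF us, of c0] that QY by auto
  have dL: "\<delta> f c = 0" if "f \<in> supported {c0}" "c \<in> Q" for f c
  proof -
    have "f = fscale (f c0) ?u" using that(1) by (rule supported_singleton[THEN iffD1])
    then have "\<delta> f c = \<delta> (fscale (f c0) ?u) c" by simp
    then show ?thesis using du[OF that(2)] by (simp add: flinear_scale[OF lin])
  qed
  have R: "\<delta> (?R f) c = \<delta> f c" if "f \<in> supported Q" "c \<in> Q" for f c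
  proof -
    have "f - ?R f \<in> supported {c0}" using that QY by (auto simp: supported_def restrict_fun_def)
    then have "\<delta> (f - ?R f) c = 0" using dL that by blast
    then show ?thesis by (simp add: flinear_diff[OF lin])
  qed
  have RZ: "?R ` ?Z = {f \<in> cocycles \<delta> g Y j. \<delta> f c0 = 0}"
  proof (intro equalityI subsetI)
    fix f assume "f \<in> ?R ` ?Z"
    then obtain h where h: "h \<in> ?Z" "f = ?R h" by blast
    moreover have "h \<in> supported Q" using h cocycles_supported by blast
    ultimately show "f \<in> {f \<in> cocycles \<delta> g Y j. \<delta> f c0 = 0}"
      using R[of h] QY by (auto simp: cocycles_def supported_def restrict_fun_def)
  next
    fix f assume f: "f \<in> {f \<in> cocycles \<delta> g Y j. \<delta> f c0 = 0}"
    then have "?R f = f" by (auto simp: cocycles_def supported_def restrict_fun_def fun_eq_iff)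
    moreover have "f \<in> ?Z" using f QY by (auto simp: cocycles_def supported_def)
    ultimately show "f \<in> ?R ` ?Z" by force
  qed
  have RB: "?R ` ?B = coboundaries \<delta> g Y j"
    by (rule restrict_coboundaries) (use QY R in auto)
  have R0: "?R f = 0 \<longleftrightarrow> f \<in> supported {c0}" if "f \<in> supported Q" for f
    using that QY by (auto simp: restrict_fun_def supported_def fun_eq_iff)
  have L: "f \<in> ?L \<longleftrightarrow> f \<in> supported {c0}" for f
    by (auto simp: supported_singleton) (auto simp: supported_def unit_fun_def)
  have dimL: "fdim ?L = 1" by (rule fdim_unit)
  have ZL: "{f \<in> ?Z. ?R f = 0} = (if j = g c0 then ?L else {0})"
  proof -
    have "f \<in> ?Z \<and> ?R f = 0 \<longleftrightarrow> f \<in> (if j = g c0 then ?L else {0})" for f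
    proof -
      have "f \<in> ?Z \<and> ?R f = 0 \<longleftrightarrow> f \<in> supported {c \<in> Q. g c = j} \<and> f \<in> supported {c0}"
        using R0[of f] dL[of f] cocycles_supported[of \<delta> g Q j] by (auto simp: cocycles_def supported_def)
      also have "\<dots> \<longleftrightarrow> f \<in> (if j = g c0 then ?L else {0})"
        unfolding if_distrib[of "(\<in>) f"] L using QY by (auto simp: supported_def fun_eq_iff)
      finally show ?thesis .
    qed
    then show ?thesis by (intro set_eqI) simp
  qed
  have BL: "{f \<in> ?B. ?R f = 0} = (if j = g c0 \<and> ?cob then ?L else {0})"
  proof (cases "j = g c0 \<and> ?cob")
    case True
    have "?L \<subseteq> {f \<in> ?B. ?R f = 0}"
    proof
      fix f assume f: "f \<in> ?L"
      then have "f \<in> ?B"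
        using True subspace_coboundaries[OF lin, of g Q j] by (auto simp: fun_space.subspace_def)
      then show "f \<in> {f \<in> ?B. ?R f = 0}"
        using R0[of f] f L coboundaries_supported[of \<delta> g Q j] by blast
    qed
    moreover have "{f \<in> ?B. ?R f = 0} \<subseteq> ?L"
      using coboundaries_subset_cocycles[OF Q, of j] ZL True by auto
    ultimately have "{f \<in> ?B. ?R f = 0} = ?L" by (rule subset_antisym[rotated])
    then show ?thesis using True by (simp only: if_True simp_thms)
  next
    case False
    have "f = 0" if f: "f \<in> ?B" "?R f = 0" for f
    proof (rule ccontr)
      assume "f \<noteq> 0"
      moreover have "f \<in> {f \<in> ?Z. ?R f = 0}" using f coboundaries_subset_cocycles[OF Q, of j] by blast
      ultimately have j: "j = g c0" and "f \<in> ?L" unfolding ZL by (auto split: if_splits)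
      then obtain a where a: "f = fscale a ?u" by blast
      then have "a \<noteq> 0" using \<open>f \<noteq> 0\<close> by (auto simp: fun_eq_iff)
      then have "?u = fscale (1 / a) f" using a by (simp add: fun_eq_iff)
      then have ?cob using f(1) j subspace_coboundaries[OF lin, of g Q j] by (auto simp: fun_space.subspace_def)
      then show False using False j by blast
    qed
    moreover have "0 \<in> ?B" "?R 0 = 0"
      using subspace_coboundaries[OF lin, of g Q j] by (auto simp: fun_space.subspace_def restrict_fun_def fun_eq_iff)
    ultimately show ?thesis using False by auto
  qed
  have Zdim: "fdim ?Z = fdim {f \<in> cocycles \<delta> g Y j. \<delta> f c0 = 0} + (if j = g c0 then 1 else 0)"
    using fdim_kernel_image[OF flinear_restrict_fun[of Y] subspace_cocycles[OF lin] cocycles_supported fin, of g j]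
    unfolding RZ ZL by (simp add: fdim_zero dimL del: fscale_apply split: if_splits)
  have Bdim: "fdim ?B = fdim (coboundaries \<delta> g Y j) + (if j = g c0 \<and> ?cob then 1 else 0)"
    using fdim_kernel_image[OF flinear_restrict_fun[of Y] subspace_coboundaries[OF lin] coboundaries_supported fin, of g j]
    unfolding RB BL by (simp add: fdim_zero dimL del: fscale_apply split: if_splits)
  have finY: "finite Y" using fin QY by auto
  \<comment> \<open>A cocycle of \<open>Y\<close> fails to be one of \<open>Q\<close> only through
    its coboundary at \<open>c0\<close>. This happens only one degree below \<open>c0\<close>, and
    rescaling such a cocycle exhibits the indicator as a coboundary.\<close>
  have Ydim: "fdim (cocycles \<delta> g Y j) =
      fdim {f \<in> cocycles \<delta> g Y j. \<delta> f c0 = 0} + (if Suc j = g c0 \<and> ?cob then 1 else 0)"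
  proof (cases "Suc j = g c0 \<and> ?cob")
    case False
    have "\<delta> f c0 = 0" if f: "f \<in> cocycles \<delta> g Y j" for f
    proof (rule ccontr)
      assume nz: "\<delta> f c0 \<noteq> 0"
      have fQ: "f \<in> supported {c \<in> Q. g c = j}" using f QY by (auto simp: cocycles_def supported_def)
      then have j: "g c0 = Suc j" using deg[OF fQ, of c0] nz QY by blast
      have "?u = restrict_fun Q (\<delta> (fscale (1 / \<delta> f c0) f))"
        using f nz QY by (auto simp: flinear_scale[OF lin] restrict_fun_def unit_fun_def fun_eq_iff cocycles_def)
      moreover have "fscale (1 / \<delta> f c0) f \<in> supported {c \<in> Q. Suc (g c) = g c0}"
        using fQ j by (auto simp: supported_def)
      ultimately have ?cob unfolding coboundaries_def by blast
      then show False using False j by simp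
    qed
    then have "{f \<in> cocycles \<delta> g Y j. \<delta> f c0 = 0} = cocycles \<delta> g Y j" by blast
    then show ?thesis using False by simp
  next
    case True
    \<comment> \<open>The functional sending \<open>f\<close> to \<open>\<delta> f c0\<close>,
      written as a map into the line \<open>?L\<close> so that rank-nullity for function spaces
      applies.\<close>
    let ?\<phi> = "\<lambda>f. fscale (\<delta> f c0) ?u"
    have \<phi>: "flinear ?\<phi>"
      by (auto simp: flinear_iff flinear_add[OF lin] flinear_scale[OF lin] fun_eq_iff algebra_simps)
    obtain h where h: "h \<in> supported {c \<in> Q. Suc (g c) = g c0}" "?u = restrict_fun Q (\<delta> h)"
      using True unfolding coboundaries_def by blast
    have hc: "\<delta> h c = unit_fun c0 c" if "c \<in> Q" for c
      using fun_cong[OF h(2), of c] that by (simp add: restrict_fun_def)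
    have "g c0 \<noteq> j" using True by simp
    then have "h \<in> cocycles \<delta> g Y j"
      using h(1) hc QY True by (auto simp: cocycles_def supported_def unit_fun_def) (metis n_not_Suc_n)
    then have "fscale a h \<in> cocycles \<delta> g Y j" for a
      using subspace_cocycles[OF lin, of g Y j] by (auto simp: fun_space.subspace_def)
    moreover have \<phi>h: "?\<phi> (fscale a h) = fscale a ?u" for a
      using hc[of c0] QY by (simp add: flinear_scale[OF lin] unit_fun_def fun_eq_iff)
    ultimately have "fscale a ?u \<in> ?\<phi> ` cocycles \<delta> g Y j" for a
      by (metis imageI)
    then have "?\<phi> ` cocycles \<delta> g Y j = ?L" by blast
    moreover have "?\<phi> f = 0 \<longleftrightarrow> \<delta> f c0 = 0" for f by (auto simp: fun_eq_iff unit_fun_def)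
    ultimately show ?thesis
      using fdim_kernel_image[OF \<phi> subspace_cocycles[OF lin] cocycles_supported finY, of g j] True
      by (simp only: dimL) simp
  qed
  have "fdim ?B \<le> fdim ?Z" by (rule fdim_coboundaries_le[OF Q])
  moreover have "fdim (coboundaries \<delta> g Y j) \<le> fdim (cocycles \<delta> g Y j)"
  proof (rule fdim_supported_mono[OF _ cocycles_supported finY])
    show "coboundaries \<delta> g Y j \<subseteq> cocycles \<delta> g Y j"
    proof
      fix f assume "f \<in> coboundaries \<delta> g Y j"
      then obtain h where "h \<in> ?B" "f = ?R h" using RB by blast
      then show "f \<in> cocycles \<delta> g Y j" using coboundaries_subset_cocycles[OF Q, of j] RZ by blast
    qed
  qed
  ultimately show ?thesis
    using Zdim Bdim Ydim unfolding hdim_def by (auto split: if_splits)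
qed

section \<open>Direct sums of cochain complexes\<close>

definition sigma_op ::
  "('i \<Rightarrow> ('c \<Rightarrow> 'a::field) \<Rightarrow> 'c \<Rightarrow> 'a) \<Rightarrow> ('i \<times> 'c \<Rightarrow> 'a) \<Rightarrow> 'i \<times> 'c \<Rightarrow> 'a" where
  "sigma_op \<delta> f = (\<lambda>(i, c). \<delta> i (\<lambda>c'. f (i, c')) c)"

lemma flinear_sigma_op:
  fixes \<delta> :: "'a \<Rightarrow> ('b \<Rightarrow> 'c::field) \<Rightarrow> 'b \<Rightarrow> 'c"
  assumes "\<And>i. flinear (\<delta> i)"
  shows "flinear (sigma_op \<delta>)"
proof -
  have "(\<lambda>c. (f + h) (i, c)) = (\<lambda>c. f (i, c)) + (\<lambda>c. h (i, c))" for f h :: "'a \<times> 'b \<Rightarrow> 'c" and i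
    by (simp add: fun_eq_iff)
  moreover have "(\<lambda>c. fscale a f (i, c)) = fscale a (\<lambda>c. f (i, c))" for a and f :: "'a \<times> 'b \<Rightarrow> 'c" and i
    by (simp add: fun_eq_iff)
  ultimately show ?thesis
    unfolding flinear_iff sigma_op_def
    by (simp only: flinear_add[OF assms] flinear_scale[OF assms]) (simp add: fun_eq_iff)
qed

lemma cochain_complex_sigma:
  fixes \<delta> :: "'a \<Rightarrow> ('b \<Rightarrow> 'c::field) \<Rightarrow> 'b \<Rightarrow> 'c"
  assumes "finite I" and lin: "\<And>i. flinear (\<delta> i)"
    and X: "\<And>i. i \<in> I \<Longrightarrow> cochain_complex (\<delta> i) (g i) (X i)"
  shows "cochain_complex (sigma_op \<delta>) (\<lambda>(i, c). g i c) (Sigma I X)"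
proof -
  have slice: "(\<lambda>c. restrict_fun (Sigma I X) f (i, c)) = restrict_fun (X i) (\<lambda>c. f (i, c))"
    if "i \<in> I" for f :: "'a \<times> 'b \<Rightarrow> 'c" and i
    using that by (auto simp: restrict_fun_def fun_eq_iff)
  show ?thesis
    unfolding cochain_complex_def
  proof (intro conjI allI ballI impI)
    show "flinear (sigma_op \<delta>)" by (rule flinear_sigma_op[OF lin])
    show "finite (Sigma I X)" using assms(1) X by (auto simp: cochain_complex_def)
    fix j c and f :: "'a \<times> 'b \<Rightarrow> 'c"
    assume f: "f \<in> supported {c \<in> Sigma I X. (case c of (i, c) \<Rightarrow> g i c) = j}" and c: "c \<in> Sigma I X"
      and gc: "(case c of (i, c) \<Rightarrow> g i c) \<noteq> Suc j"
    obtain i c' where ic: "c = (i, c')" "i \<in> I" "c' \<in> X i" using c by blast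
    have "(\<lambda>c. f (i, c)) \<in> supported {c \<in> X i. g i c = j}" using f by (auto simp: supported_def)
    then show "sigma_op \<delta> f c = 0" using X[OF ic(2)] ic gc by (auto simp: cochain_complex_def sigma_op_def)
  next
    fix f :: "'a \<times> 'b \<Rightarrow> 'c" and c
    assume f: "f \<in> supported (Sigma I X)" and c: "c \<in> Sigma I X"
    obtain i c' where ic: "c = (i, c')" "i \<in> I" "c' \<in> X i" using c by blast
    have "(\<lambda>c. f (i, c)) \<in> supported (X i)" using f by (auto simp: supported_def)
    then show "sigma_op \<delta> (restrict_fun (Sigma I X) (sigma_op \<delta> f)) c = 0"
      using X[OF ic(2)] ic slice[OF ic(2), of "sigma_op \<delta> f"]
      by (simp add: cochain_complex_def sigma_op_def)
  qed
qed

text \<open>Induction on \<open>I\<close>. Restriction to the slice \<open>a\<close> is onto for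
  cocycles and for coboundaries, and its kernels are the cocycles and coboundaries of the remaining
  sum, so rank-nullity adds the dimensions.\<close>

lemma hdim_sigma:
  fixes \<delta> :: "'a \<Rightarrow> ('b \<Rightarrow> 'c::field) \<Rightarrow> 'b \<Rightarrow> 'c"
  assumes "finite I" and lin: "\<And>i. flinear (\<delta> i)"
    and X: "\<And>i. i \<in> I \<Longrightarrow> cochain_complex (\<delta> i) (g i) (X i)"
  shows "hdim (sigma_op \<delta>) (\<lambda>(i, c). g i c) (Sigma I X) j = (\<Sum>i\<in>I. hdim (\<delta> i) (g i) (X i) j)"
  using assms(1) X
proof (induction I rule: finite_induct)
  case empty
  have "cocycles (sigma_op \<delta>) (\<lambda>(i, c). g i c) (Sigma {} X) j = {0}"
    by (auto simp: cocycles_def supported_def fun_eq_iff)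
  then show ?case by (simp add: hdim_def fdim_zero)
next
  case (insert a I)
  let ?s = "sigma_op \<delta>" and ?g = "\<lambda>(i, c). g i c" and ?Q = "Sigma (insert a I) X" and ?Q' = "Sigma I X"
  let ?r = "\<lambda>(f :: 'a \<times> 'b \<Rightarrow> 'c) c. f (a, c)"
  let ?e = "\<lambda>(f :: 'b \<Rightarrow> 'c) (i, c). if i = a then f c else 0"
  have Q: "cochain_complex ?s ?g ?Q" "cochain_complex ?s ?g ?Q'"
    using insert by (intro cochain_complex_sigma lin; auto)+
  have fin: "finite ?Q" using Q(1) by (auto simp: cochain_complex_def)
  have r: "flinear ?r" by (simp add: flinear_iff fun_eq_iff)
  have sl: "flinear ?s" by (rule flinear_sigma_op[OF lin])
  have z: "\<delta> i (\<lambda>c. 0) c = 0" for i c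
    using flinear_zero[OF lin, of i] by (simp add: zero_fun_def)
  have se: "?s (?e f) (i, c) = (if i = a then \<delta> a f c else 0)" for f i c
    by (auto simp: sigma_op_def z)
  have Z: "?r ` cocycles ?s ?g ?Q j = cocycles (\<delta> a) (g a) (X a) j"
  proof (intro equalityI subsetI)
    fix f assume "f \<in> ?r ` cocycles ?s ?g ?Q j"
    then show "f \<in> cocycles (\<delta> a) (g a) (X a) j"
      by (auto simp: cocycles_def supported_def sigma_op_def)
  next
    fix f assume f: "f \<in> cocycles (\<delta> a) (g a) (X a) j"
    have "?e f \<in> cocycles ?s ?g ?Q j"
      using f by (auto simp: cocycles_def supported_def se)
    then show "f \<in> ?r ` cocycles ?s ?g ?Q j" by (rule rev_image_eqI) simp
  qed
  have B: "?r ` coboundaries ?s ?g ?Q j = coboundaries (\<delta> a) (g a) (X a) j"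
  proof (intro equalityI subsetI)
    fix f assume "f \<in> ?r ` coboundaries ?s ?g ?Q j"
    then obtain h where h: "h \<in> supported {c \<in> ?Q. Suc (?g c) = j}" "f = ?r (restrict_fun ?Q (?s h))"
      by (auto simp: coboundaries_def)
    have "f = restrict_fun (X a) (\<delta> a (?r h))"
      using h(2) by (auto simp: restrict_fun_def sigma_op_def fun_eq_iff)
    moreover have "?r h \<in> supported {c \<in> X a. Suc (g a c) = j}" using h(1) by (auto simp: supported_def)
    ultimately show "f \<in> coboundaries (\<delta> a) (g a) (X a) j" by (auto simp: coboundaries_def)
  next
    fix f assume "f \<in> coboundaries (\<delta> a) (g a) (X a) j"
    then obtain h where h: "h \<in> supported {c \<in> X a. Suc (g a c) = j}" "f = restrict_fun (X a) (\<delta> a h)"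
      by (auto simp: coboundaries_def)
    have "f = ?r (restrict_fun ?Q (?s (?e h)))"
      unfolding h(2) by (intro ext) (simp add: restrict_fun_def se)
    moreover have "?e h \<in> supported {c \<in> ?Q. Suc (?g c) = j}" using h(1) by (auto simp: supported_def)
    ultimately show "f \<in> ?r ` coboundaries ?s ?g ?Q j" unfolding coboundaries_def by blast
  qed
  have kZ: "{f \<in> cocycles ?s ?g ?Q j. ?r f = 0} = cocycles ?s ?g ?Q' j"
  proof (intro equalityI subsetI)
    fix f assume "f \<in> {f \<in> cocycles ?s ?g ?Q j. ?r f = 0}"
    then show "f \<in> cocycles ?s ?g ?Q' j"
      by (auto simp: cocycles_def supported_def fun_eq_iff) metis
  next
    fix f assume f: "f \<in> cocycles ?s ?g ?Q' j"
    have fa: "?r f = (\<lambda>c. 0)" using f insert(2) by (auto simp: cocycles_def supported_def)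
    then have "?s f (a, c) = 0" for c by (simp add: sigma_op_def z)
    then have "f \<in> cocycles ?s ?g ?Q j" using f by (auto simp: cocycles_def supported_def)
    then show "f \<in> {f \<in> cocycles ?s ?g ?Q j. ?r f = 0}" using fa by (simp add: zero_fun_def)
  qed
  have kB: "{f \<in> coboundaries ?s ?g ?Q j. ?r f = 0} = coboundaries ?s ?g ?Q' j"
  proof (intro equalityI subsetI)
    fix f assume f: "f \<in> {f \<in> coboundaries ?s ?g ?Q j. ?r f = 0}"
    then obtain h where h: "h \<in> supported {c \<in> ?Q. Suc (?g c) = j}" "f = restrict_fun ?Q (?s h)"
      by (auto simp: coboundaries_def)
    \<comment> \<open>The primitive is reset to zero on the slice \<open>a\<close>, where its
      coboundary vanishes anyway.\<close>
    let ?h = "\<lambda>(i, c). if i = a then 0 else h (i, c)"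
    have fa: "f (a, c) = 0" for c using f by (auto simp: fun_eq_iff)
    have "f (i, c) = restrict_fun ?Q' (?s ?h) (i, c)" for i c
      using fa[of c] insert(2) by (cases "i = a") (auto simp: h(2) restrict_fun_def sigma_op_def)
    then have "f = restrict_fun ?Q' (?s ?h)" by (simp add: fun_eq_iff)
    moreover have "?h \<in> supported {c \<in> ?Q'. Suc (?g c) = j}" using h(1) by (auto simp: supported_def)
    ultimately show "f \<in> coboundaries ?s ?g ?Q' j" unfolding coboundaries_def by blast
  next
    fix f assume "f \<in> coboundaries ?s ?g ?Q' j"
    then obtain h where h: "h \<in> supported {c \<in> ?Q'. Suc (?g c) = j}" "f = restrict_fun ?Q' (?s h)"
      by (auto simp: coboundaries_def)
    have "?r h = (\<lambda>c. 0)" using h(1) insert(2) by (auto simp: supported_def)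
    then have sa: "?s h (a, c) = 0" for c by (simp add: sigma_op_def z)
    have "f (i, c) = restrict_fun ?Q (?s h) (i, c)" for i c
      using sa by (cases "i = a") (simp_all add: h(2) restrict_fun_def)
    then have "f = restrict_fun ?Q (?s h)" by (simp add: fun_eq_iff)
    moreover have "h \<in> supported {c \<in> ?Q. Suc (?g c) = j}" using h(1) by (auto simp: supported_def)
    moreover have "?r f = 0" using insert(2) by (auto simp: h(2) restrict_fun_def fun_eq_iff)
    ultimately show "f \<in> {f \<in> coboundaries ?s ?g ?Q j. ?r f = 0}" unfolding coboundaries_def by blast
  qed
  have "hdim ?s ?g ?Q j = hdim (\<delta> a) (g a) (X a) j + hdim ?s ?g ?Q' j"
    using fdim_kernel_image[OF r subspace_cocycles[OF sl] cocycles_supported fin, of ?g j]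
      fdim_kernel_image[OF r subspace_coboundaries[OF sl] coboundaries_supported fin, of ?g j]
      fdim_coboundaries_le[OF Q(2), of j] fdim_coboundaries_le[OF insert(4)[OF insertI1], of j]
    unfolding hdim_def Z B kZ kB by linarith
  then show ?case using insert by simp
qed

section \<open>Families of sets\<close>

text \<open>\<open>t \<tau> v\<close> is the sign with which the face \<open>\<tau> - {v}\<close>
  enters the coboundary at \<open>\<tau>\<close>; the second clause makes the two orders of removing
  \<open>u\<close> and \<open>v\<close> cancel. Axioms are used instead of a vertex order because
  the signs delivered by the Koszul complex depend on the ambient set.\<close>

definition incidence :: "'v set \<Rightarrow> ('v set \<Rightarrow> 'v \<Rightarrow> 'a::field) \<Rightarrow> bool" where
  "incidence W t \<longleftrightarrow>
     (\<forall>\<tau>\<subseteq>W. \<forall>v\<in>\<tau>. t \<tau> v * t \<tau> v = 1) \<and>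
     (\<forall>\<tau>\<subseteq>W. \<forall>u\<in>\<tau>. \<forall>v\<in>\<tau>. u \<noteq> v \<longrightarrow> t \<tau> u * t (\<tau> - {u}) v = - (t \<tau> v * t (\<tau> - {v}) u))"

definition coface :: "('v set \<Rightarrow> 'v \<Rightarrow> 'a::field) \<Rightarrow> ('v set \<Rightarrow> 'a) \<Rightarrow> 'v set \<Rightarrow> 'a" where
  "coface t f \<tau> = (\<Sum>v\<in>\<tau>. t \<tau> v * f (\<tau> - {v}))"

definition convex_family :: "'v set set \<Rightarrow> bool" where
  "convex_family X \<longleftrightarrow> (\<forall>\<sigma>\<in>X. \<forall>\<rho>\<in>X. \<forall>\<tau>. \<sigma> \<subseteq> \<tau> \<and> \<tau> \<subseteq> \<rho> \<longrightarrow> \<tau> \<in> X)"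

definition down_closed :: "'v set set \<Rightarrow> bool" where
  "down_closed X \<longleftrightarrow> (\<forall>\<sigma>\<in>X. \<forall>\<tau>\<subseteq>\<sigma>. \<tau> \<in> X)"

text \<open>The grade is not fixed to be the cardinality: in a given multidegree the Koszul cells
  are graded by \<open>multideg_grade\<close>, which differs from the cardinality by a
  shift.\<close>

definition graded_family :: "('v set \<Rightarrow> nat) \<Rightarrow> 'v set set \<Rightarrow> bool" where
  "graded_family g X \<longleftrightarrow>
     (\<forall>\<sigma> v. \<sigma> \<in> X \<longrightarrow> v \<notin> \<sigma> \<longrightarrow> insert v \<sigma> \<in> X \<longrightarrow> g (insert v \<sigma>) = Suc (g \<sigma>))"

lemma down_closedD: "down_closed X \<Longrightarrow> \<sigma> \<in> X \<Longrightarrow> \<tau> \<subseteq> \<sigma> \<Longrightarrow> \<tau> \<in> X"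
  by (simp add: down_closed_def)

lemma down_closed_convex: "down_closed X \<Longrightarrow> convex_family X"
  by (auto simp: down_closed_def convex_family_def)

lemma incidence_square: "incidence W t \<Longrightarrow> \<tau> \<subseteq> W \<Longrightarrow> v \<in> \<tau> \<Longrightarrow> t \<tau> v * t \<tau> v = 1"
  unfolding incidence_def by blast

lemma incidence_antisym:
  "incidence W t \<Longrightarrow> \<tau> \<subseteq> W \<Longrightarrow> u \<in> \<tau> \<Longrightarrow> v \<in> \<tau> \<Longrightarrow> u \<noteq> v \<Longrightarrow>
    t \<tau> u * t (\<tau> - {u}) v = - (t \<tau> v * t (\<tau> - {v}) u)"
  unfolding incidence_def by blast

lemma incidence_mono:
  assumes t: "incidence W t" and W': "W' \<subseteq> W"
  shows "incidence W' t"
  unfolding incidence_def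
proof (intro conjI allI ballI impI)
  fix \<tau> v assume "\<tau> \<subseteq> W'" "v \<in> \<tau>"
  then show "t \<tau> v * t \<tau> v = 1" using W' by (intro incidence_square[OF t]) auto
next
  fix \<tau> u v assume "\<tau> \<subseteq> W'" "u \<in> \<tau>" "v \<in> \<tau>" "u \<noteq> v"
  then show "t \<tau> u * t (\<tau> - {u}) v = - (t \<tau> v * t (\<tau> - {v}) u)"
    using W' by (intro incidence_antisym[OF t]) auto
qed

lemma flinear_coface:
  fixes t :: "'v set \<Rightarrow> 'v \<Rightarrow> 'a::field"
  shows "flinear (coface t)"
  unfolding flinear_iff
proof (intro conjI allI ext)
  fix f h :: "'v set \<Rightarrow> 'a" and \<tau>
  show "coface t (f + h) \<tau> = (coface t f + coface t h) \<tau>"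
    by (simp add: coface_def distrib_left sum.distrib)
next
  fix a and f :: "'v set \<Rightarrow> 'a" and \<tau>
  show "coface t (fscale a f) \<tau> = fscale a (coface t f) \<tau>"
    by (simp add: coface_def sum_distrib_left mult.left_commute)
qed

lemma coface_cong: "(\<And>v. v \<in> \<tau> \<Longrightarrow> f (\<tau> - {v}) = h (\<tau> - {v})) \<Longrightarrow> coface t f \<tau> = coface t h \<tau>"
  unfolding coface_def by (rule sum.cong) simp_all

lemma coface_eq_0: "(\<And>v. v \<in> \<tau> \<Longrightarrow> f (\<tau> - {v}) = 0) \<Longrightarrow> coface t f \<tau> = 0"
  unfolding coface_def by (rule sum.neutral) simp

text \<open>The two orders of removing a pair of vertices carry opposite signs, so the double sum
  cancels in pairs.\<close>

lemma coface_coface: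
  assumes t: "incidence W t" and \<tau>: "finite \<tau>" "\<tau> \<subseteq> W"
  shows "coface t (coface t f) \<tau> = 0"
proof -
  define F where "F u v = t \<tau> u * (t (\<tau> - {u}) v * f (\<tau> - {u} - {v}))" for u v
  have "coface t (coface t f) \<tau> = (\<Sum>u\<in>\<tau>. \<Sum>v\<in>\<tau> - {u}. F u v)"
    by (simp add: coface_def F_def sum_distrib_left)
  also have "\<dots> = 0"
  proof (rule sum_antisym_pairs[where r = "to_nat_on \<tau>"])
    show "inj_on (to_nat_on \<tau>) \<tau>" using \<tau>(1) by (simp add: countable_finite inj_on_to_nat_on)
    fix u v assume uv: "u \<in> \<tau>" "v \<in> \<tau>" "u \<noteq> v"
    have "t \<tau> u * t (\<tau> - {u}) v = - (t \<tau> v * t (\<tau> - {v}) u)"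
      by (rule incidence_antisym[OF t \<tau>(2) uv])
    moreover have "\<tau> - {u} - {v} = \<tau> - {v} - {u}" by auto
    ultimately show "F u v = - F v u"
      unfolding F_def mult.assoc[symmetric] by simp
  qed (use \<tau> in auto)
  finally show ?thesis .
qed

lemma cochain_complex_family:
  fixes t :: "'v set \<Rightarrow> 'v \<Rightarrow> 'a::field"
  assumes W: "finite W" "incidence W t" "X \<subseteq> Pow W" and X: "convex_family X" "graded_family g X"
  shows "cochain_complex (coface t) g X"
  unfolding cochain_complex_def
proof (intro conjI allI ballI impI)
  show "flinear (coface t)" by (rule flinear_coface)
  show "finite X" using W by (meson finite_Pow_iff finite_subset)
  fix j \<tau> and f :: "'v set \<Rightarrow> 'a" assume f: "f \<in> supported {c \<in> X. g c = j}" and \<tau>: "\<tau> \<in> X" "g \<tau> \<noteq> Suc j"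
  show "coface t f \<tau> = 0"
  proof (rule coface_eq_0, rule ccontr)
    fix v assume v: "v \<in> \<tau>" "f (\<tau> - {v}) \<noteq> 0"
    then have "\<tau> - {v} \<in> X" "g (\<tau> - {v}) = j" using f by (auto simp: supported_def)
    moreover have "insert v (\<tau> - {v}) = \<tau>" using v by auto
    ultimately have "g \<tau> = Suc j" using X(2) \<tau>(1) by (metis Diff_iff graded_family_def singletonI)
    then show False using \<tau> by simp
  qed
next
  fix f :: "'v set \<Rightarrow> 'a" and \<tau> assume f: "f \<in> supported X" and \<tau>: "\<tau> \<in> X"
  have "restrict_fun X (coface t f) (\<tau> - {v}) = coface t f (\<tau> - {v})" if "v \<in> \<tau>" for v
  proof (cases "\<tau> - {v} \<in> X")
    \<comment> \<open>Cutting off at \<open>\<tau> - {v}\<close> loses nothing: a nonzero value of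
      \<open>f\<close> on one of its facets would put \<open>\<tau> - {v}\<close> between two
      members of the convex family \<open>X\<close>.\<close>
    case False
    have "f (\<tau> - {v} - {u}) = 0" for u
    proof (rule ccontr)
      assume "f (\<tau> - {v} - {u}) \<noteq> 0"
      then have "\<tau> - {v} - {u} \<in> X" using f by (auto simp: supported_def)
      then have "\<tau> - {v} \<in> X" using X(1) \<tau> unfolding convex_family_def by (metis Diff_subset)
      then show False using False by simp
    qed
    then show ?thesis using False by (simp add: restrict_fun_apply coface_eq_0)
  qed (simp add: restrict_fun_apply)
  then have "coface t (restrict_fun X (coface t f)) \<tau> = coface t (coface t f) \<tau>"
    by (rule coface_cong)
  also have "\<dots> = 0" using \<tau> W by (intro coface_coface) (auto intro: finite_subset)
  finally show "coface t (restrict_fun X (coface t f)) \<tau> = 0" .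
qed

text \<open>The contraction of a cone: faces are matched by adding or removing \<open>v\<close>. As
  the family need not be down-closed, the argument also covers the upper sets deleted by
  collapses.\<close>

lemma acyclic_toggle:
  assumes W: "finite W" "incidence W t" "X \<subseteq> Pow W" and g: "graded_family g X"
    and toggle: "\<And>\<sigma>. \<sigma> \<in> X \<Longrightarrow> insert v \<sigma> \<in> X \<and> \<sigma> - {v} \<in> X"
  shows "acyclic_on (coface t) g X"
  unfolding acyclic_on_def
proof (intro allI subsetI)
  fix j f assume f: "f \<in> cocycles (coface t) g X j"
  \<comment> \<open>The contracting homotopy: it reads \<open>f\<close> on the face with
    \<open>v\<close> added, with the sign that undoes the coboundary.\<close>
  define h where "h \<sigma> = (if v \<in> \<sigma> then 0 else t (insert v \<sigma>) v * f (insert v \<sigma>))" for \<sigma>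
  have one: "t \<tau> u * t \<tau> u = 1" if "\<tau> \<in> X" "u \<in> \<tau>" for \<tau> u
    using incidence_square[OF W(2)] W(3) that by blast
  have h: "h \<in> supported {\<sigma> \<in> X. Suc (g \<sigma>) = j}"
    unfolding supported_def
  proof (intro CollectI allI impI)
    fix \<sigma> assume \<sigma>: "\<sigma> \<notin> {\<sigma> \<in> X. Suc (g \<sigma>) = j}"
    show "h \<sigma> = 0"
    proof (rule ccontr)
      assume "h \<sigma> \<noteq> 0"
      then have v: "v \<notin> \<sigma>" and "f (insert v \<sigma>) \<noteq> 0" by (auto simp: h_def split: if_splits)
      then have i: "insert v \<sigma> \<in> X" "g (insert v \<sigma>) = j" using f by (auto simp: cocycles_def supported_def)
      then have "\<sigma> \<in> X" using toggle[OF i(1)] v by simp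
      then show False using \<sigma> g i v by (auto simp: graded_family_def)
    qed
  qed
  have "coface t h \<tau> = f \<tau>" if \<tau>: "\<tau> \<in> X" for \<tau>
  proof (cases "v \<in> \<tau>")
    case True
    have fin: "finite \<tau>" using \<tau> W finite_subset by blast
    have "coface t h \<tau> = (\<Sum>u\<in>\<tau>. if u = v then t \<tau> v * (t \<tau> v * f \<tau>) else 0)"
      unfolding coface_def using True by (intro sum.cong) (auto simp: h_def insert_absorb)
    also have "\<dots> = t \<tau> v * t \<tau> v * f \<tau>" using fin True by (simp add: mult.assoc)
    finally show ?thesis using one[OF \<tau> True] by simp
  next
    case False
    let ?\<tau> = "insert v \<tau>"
    have it: "?\<tau> \<in> X" using toggle \<tau> by blast
    have fin: "finite \<tau>" using \<tau> W finite_subset by blast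
    \<comment> \<open>For a face without \<open>v\<close>, the cocycle condition at
      \<open>insert v \<tau>\<close> expresses \<open>f \<tau>\<close> by the values on faces that
      contain \<open>v\<close>. Antisymmetry of the signs identifies the result with the coboundary
      of \<open>h\<close>.\<close>
    have "0 = coface t f ?\<tau>" using f it by (simp add: cocycles_def)
    also have "\<dots> = t ?\<tau> v * f \<tau> + (\<Sum>u\<in>\<tau>. t ?\<tau> u * f (?\<tau> - {u}))"
      unfolding coface_def using False fin by simp
    finally have *: "t ?\<tau> v * f \<tau> = - (\<Sum>u\<in>\<tau>. t ?\<tau> u * f (?\<tau> - {u}))"
      by (simp add: eq_neg_iff_add_eq_0)
    have "f \<tau> = (t ?\<tau> v * t ?\<tau> v) * f \<tau>" using one[OF it, of v] by simp
    also have "\<dots> = t ?\<tau> v * - (\<Sum>u\<in>\<tau>. t ?\<tau> u * f (?\<tau> - {u}))" by (simp only: mult.assoc *)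
    also have "\<dots> = (\<Sum>u\<in>\<tau>. - (t ?\<tau> v * t ?\<tau> u * f (?\<tau> - {u})))"
      by (simp add: sum_distrib_left sum_negf mult.assoc)
    also have "\<dots> = coface t h \<tau>"
      unfolding coface_def
    proof (rule sum.cong[OF refl])
      fix u assume u: "u \<in> \<tau>"
      then have uv: "u \<noteq> v" using False by auto
      have d: "?\<tau> - {v} = \<tau>" "insert v (\<tau> - {u}) = ?\<tau> - {u}" using False uv by auto
      have an: "t ?\<tau> u * t (?\<tau> - {u}) v = - (t ?\<tau> v * t \<tau> u)"
        using incidence_antisym[OF W(2), of ?\<tau> u v] W(3) it u uv d(1) by auto
      have "t ?\<tau> v * t ?\<tau> u = - (t \<tau> u * t (?\<tau> - {u}) v)"
      proof -
        have "t ?\<tau> v * t ?\<tau> u = t ?\<tau> v * (t ?\<tau> u * (t (?\<tau> - {u}) v * t (?\<tau> - {u}) v))"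
        proof -
          have "?\<tau> - {u} \<subseteq> W" "v \<in> ?\<tau> - {u}" using W it uv by auto
          then have "t (?\<tau> - {u}) v * t (?\<tau> - {u}) v = 1" by (rule incidence_square[OF W(2)])
          then show ?thesis by simp
        qed
        also have "\<dots> = t ?\<tau> v * (t ?\<tau> u * t (?\<tau> - {u}) v) * t (?\<tau> - {u}) v" by (simp only: mult.assoc)
        also have "\<dots> = - ((t ?\<tau> v * t ?\<tau> v) * (t \<tau> u * t (?\<tau> - {u}) v))" unfolding an by simp
        also have "\<dots> = - (t \<tau> u * t (?\<tau> - {u}) v)" using one[OF it, of v] by simp
        finally show ?thesis .
      qed
      then show "- (t ?\<tau> v * t ?\<tau> u * f (?\<tau> - {u})) = t \<tau> u * h (\<tau> - {u})"
        using False d(2) by (simp add: h_def)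
    qed
    finally show ?thesis by simp
  qed
  then have "f = restrict_fun X (coface t h)"
    using f by (intro ext) (auto simp: restrict_fun_apply cocycles_def supported_def)
  then show "f \<in> coboundaries (coface t) g X j" using h unfolding coboundaries_def by blast
qed

section \<open>Reduced simplicial cohomology, collapses and deletion of a facet\<close>

lemma graded_family_card: "finite W \<Longrightarrow> X \<subseteq> Pow W \<Longrightarrow> graded_family card X"
  unfolding graded_family_def by (intro allI impI card_insert_disjoint) (auto intro: finite_subset)

text \<open>Faces are graded by cardinality, with the empty face in degree 0, so degree
  \<open>j\<close> is reduced cohomology in dimension \<open>j - 1\<close>. With this shift
  \<open>j\<close> is the same \<open>j\<close> as in the internal degree \<open>i + j\<close> of
  the Betti numbers.\<close>

abbreviation face_hdim :: "('v set \<Rightarrow> 'v \<Rightarrow> 'a::field) \<Rightarrow> 'v set set \<Rightarrow> nat \<Rightarrow> nat" where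
  "face_hdim t \<equiv> hdim (coface t) card"

text \<open>\<open>null_face t X \<sigma>\<close> says that the indicator cochain of the face \<open>\<sigma>\<close> is a coboundary.  For a facet this
  decides whether adding \<open>\<sigma>\<close> to \<open>X - {\<sigma>}\<close> kills a class or creates one.\<close>

definition null_face :: "('v set \<Rightarrow> 'v \<Rightarrow> 'a::field) \<Rightarrow> 'v set set \<Rightarrow> 'v set \<Rightarrow> bool" where
  "null_face t X \<sigma> \<longleftrightarrow> unit_fun \<sigma> \<in> coboundaries (coface t) card X (card \<sigma>)"

definition is_complex_on :: "'v set \<Rightarrow> ('v set \<Rightarrow> 'v \<Rightarrow> 'a::field) \<Rightarrow> 'v set set \<Rightarrow> bool" where
  "is_complex_on W t X \<longleftrightarrow> finite W \<and> incidence W t \<and> X \<subseteq> Pow W \<and> down_closed X"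

lemma is_complex_onD:
  assumes "is_complex_on W t X"
  shows "finite W" "incidence W t" "X \<subseteq> Pow W" "down_closed X" "graded_family card X"
    "convex_family X" "cochain_complex (coface t) card X" "finite X"
proof -
  show "finite W" "incidence W t" "X \<subseteq> Pow W" "down_closed X"
    using assms by (auto simp: is_complex_on_def)
  then show "graded_family card X" "convex_family X" "finite X"
    by (auto intro: graded_family_card down_closed_convex finite_subset[of X "Pow W"])
  then show "cochain_complex (coface t) card X"
    using assms by (intro cochain_complex_family) (auto simp: is_complex_on_def)
qed

lemma is_complex_on_subset: "is_complex_on W t X \<Longrightarrow> Y \<subseteq> X \<Longrightarrow> down_closed Y \<Longrightarrow> is_complex_on W t Y"
  by (auto simp: is_complex_on_def)

text \<open>Many elementary collapses at once: the deleted faces are closed upwards in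
  \<open>X\<close>, hence a subcomplex of cochains, and toggling \<open>v\<close> contracts
  it.\<close>

lemma hdim_remove_toggle:
  assumes X: "is_complex_on W t X" and U: "U \<subseteq> X"
    and up: "\<And>\<sigma> \<tau>. \<sigma> \<in> U \<Longrightarrow> \<tau> \<in> X \<Longrightarrow> \<sigma> \<subseteq> \<tau> \<Longrightarrow> \<tau> \<in> U"
    and toggle: "\<And>\<sigma>. \<sigma> \<in> U \<Longrightarrow> insert v \<sigma> \<in> U \<and> \<sigma> - {v} \<in> U"
  shows "face_hdim t X j = face_hdim t (X - U) j"
proof (rule hdim_remove_upper)
  note D = is_complex_onD[OF X]
  show "cochain_complex (coface t) card X" by (rule D)
  show "X = (X - U) \<union> U" "(X - U) \<inter> U = {}" using U by auto
  show "coface t f c = 0" if f: "f \<in> supported U" and c: "c \<in> X - U" for f c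
  proof (rule coface_eq_0, rule ccontr)
    fix u assume "f (c - {u}) \<noteq> 0"
    then have "c - {u} \<in> U" using f by (auto simp: supported_def)
    then show False using up[of "c - {u}" c] c by auto
  qed
  have sub: "U \<subseteq> Pow W" using U D(3) by blast
  show "acyclic_on (coface t) card U"
    by (rule acyclic_toggle[OF D(1,2) sub graded_family_card[OF D(1) sub] toggle])
qed

lemma hdim_remove_facet:
  assumes X: "is_complex_on W t X" and \<sigma>: "\<sigma> \<in> X"
    and top: "\<And>\<tau>. \<tau> \<in> X \<Longrightarrow> \<sigma> \<subseteq> \<tau> \<Longrightarrow> \<tau> = \<sigma>"
  shows "int (face_hdim t X j) =
    (if null_face t X \<sigma> then int (face_hdim t (X - {\<sigma>}) j) - (if Suc j = card \<sigma> then 1 else 0)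
     else int (face_hdim t (X - {\<sigma>}) j) + (if j = card \<sigma> then 1 else 0))"
  unfolding null_face_def
proof (rule hdim_remove_top_cell)
  show "cochain_complex (coface t) card X" by (rule is_complex_onD[OF X])
  show "X = insert \<sigma> (X - {\<sigma>})" "\<sigma> \<notin> X - {\<sigma>}" using \<sigma> by auto
  fix c assume c: "c \<in> X - {\<sigma>}"
  then have "c - {v} \<noteq> \<sigma>" for v using top[of c] by auto
  then show "coface t (unit_fun \<sigma>) c = 0" by (intro coface_eq_0) (simp add: unit_fun_def)
qed

text \<open>The faces are sorted by their trace \<open>B\<close> on \<open>T\<close>. Over each
  nonempty \<open>B\<close> the vertex \<open>p B\<close> outside \<open>T\<close> can be toggled
  freely, so the fibre collapses. The fibres are removed one after another, larger traces before
  smaller ones, until only the faces avoiding \<open>T\<close> are left. The cone vertex may depend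
  on the trace but not on the face.\<close>

lemma hdim_fibres:
  assumes "is_complex_on W t X"
    and "\<And>\<sigma>. \<sigma> \<in> X \<Longrightarrow> \<sigma> \<inter> T \<noteq> {} \<Longrightarrow> p (\<sigma> \<inter> T) \<notin> T \<and> insert (p (\<sigma> \<inter> T)) \<sigma> \<in> X"
  shows "face_hdim t X j = face_hdim t {\<sigma> \<in> X. \<sigma> \<inter> T = {}} j"
  using assms
proof (induction "card X" arbitrary: X rule: less_induct)
  case less
  note X = less(2) and p = less(3)
  show ?case
  proof (cases "\<forall>\<sigma>\<in>X. \<sigma> \<inter> T = {}")
    case True
    then have "{\<sigma> \<in> X. \<sigma> \<inter> T = {}} = X" by auto
    then show ?thesis by simp
  next
    case False
    note D = is_complex_onD[OF X]
    let ?S = "{\<sigma> \<in> X. \<sigma> \<inter> T \<noteq> {}}"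
    \<comment> \<open>A fibre over a trace of largest cardinality is closed upwards in
      \<open>X\<close>, hence can be deleted next.\<close>
    have "\<exists>\<sigma>\<in>?S. \<forall>\<tau>\<in>?S. card (\<tau> \<inter> T) \<le> card (\<sigma> \<inter> T)"
    proof -
      have fin: "finite ((\<lambda>\<sigma>. card (\<sigma> \<inter> T)) ` ?S)" and ne: "(\<lambda>\<sigma>. card (\<sigma> \<inter> T)) ` ?S \<noteq> {}"
        using D(8) False by auto
      obtain \<sigma> where s: "Max ((\<lambda>\<sigma>. card (\<sigma> \<inter> T)) ` ?S) = card (\<sigma> \<inter> T)" "\<sigma> \<in> ?S"
        using Max_in[OF fin ne] by (rule imageE)
      have "\<forall>\<tau>\<in>?S. card (\<tau> \<inter> T) \<le> card (\<sigma> \<inter> T)"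
        unfolding s(1)[symmetric] by (intro ballI Max_ge[OF fin] imageI)
      then show ?thesis using s(2) by blast
    qed
    then obtain \<sigma>0 where \<sigma>0: "\<sigma>0 \<in> ?S" and max: "\<And>\<tau>. \<tau> \<in> ?S \<Longrightarrow> card (\<tau> \<inter> T) \<le> card (\<sigma>0 \<inter> T)"
      by blast
    define B where "B = \<sigma>0 \<inter> T"
    have Bmax: "\<tau> \<inter> T = B" if "\<tau> \<in> X" "B \<subseteq> \<tau> \<inter> T" for \<tau>
    proof -
      have "finite (\<tau> \<inter> T)" using that(1) D(1,3) by (auto intro: finite_subset)
      moreover have "\<tau> \<in> ?S" using that \<sigma>0 by (auto simp: B_def)
      ultimately show ?thesis using max[of \<tau>] that(2) card_seteq[of "\<tau> \<inter> T" B] by (simp add: B_def)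
    qed
    define U where "U = {\<sigma> \<in> X. \<sigma> \<inter> T = B}"
    have B: "B \<noteq> {}" using \<sigma>0 by (simp add: B_def)
    have pB: "p B \<notin> T" "insert (p B) \<sigma> \<in> X" if "\<sigma> \<in> U" for \<sigma>
      using p[of \<sigma>] that B by (auto simp: U_def)
    have "face_hdim t X j = face_hdim t (X - U) j"
    proof (rule hdim_remove_toggle[OF X, where v = "p B"])
      show "U \<subseteq> X" by (auto simp: U_def)
      show "\<tau> \<in> U" if "\<sigma> \<in> U" "\<tau> \<in> X" "\<sigma> \<subseteq> \<tau>" for \<sigma> \<tau>
        using that Bmax[of \<tau>] by (auto simp: U_def)
      fix \<sigma> assume s: "\<sigma> \<in> U"
      then have "\<sigma> - {p B} \<in> X" using D(4) down_closedD[of X \<sigma>] by (auto simp: U_def)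
      then show "insert (p B) \<sigma> \<in> U \<and> \<sigma> - {p B} \<in> U"
        using pB[OF s] s by (auto simp: U_def)
    qed
    also have "\<dots> = face_hdim t {\<sigma> \<in> X - U. \<sigma> \<inter> T = {}} j"
    proof (rule less(1))
      have "U \<noteq> {}" "U \<subseteq> X" using \<sigma>0 by (auto simp: U_def B_def)
      then show "card (X - U) < card X" using D(8) by (intro psubset_card_mono) auto
      have "down_closed (X - U)"
        unfolding down_closed_def
      proof (intro ballI allI impI)
        fix \<sigma> \<tau> assume s: "\<sigma> \<in> X - U" "\<tau> \<subseteq> \<sigma>"
        then have "\<tau> \<in> X" using D(4) by (auto dest: down_closedD)
        moreover have "\<tau> \<notin> U" using s Bmax[of \<sigma>] by (auto simp: U_def)
        ultimately show "\<tau> \<in> X - U" by blast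
      qed
      then show "is_complex_on W t (X - U)" using X by (auto intro: is_complex_on_subset)
      fix \<sigma> assume s: "\<sigma> \<in> X - U" "\<sigma> \<inter> T \<noteq> {}"
      then have "p (\<sigma> \<inter> T) \<notin> T" "insert (p (\<sigma> \<inter> T)) \<sigma> \<in> X" using p by auto
      \<comment> \<open>The cone vertex lies outside \<open>T\<close>, so adding it keeps the trace,
        and the face stays out of the deleted fibre.\<close>
      moreover have "insert (p (\<sigma> \<inter> T)) \<sigma> \<inter> T = \<sigma> \<inter> T" using calculation by auto
      ultimately show "p (\<sigma> \<inter> T) \<notin> T \<and> insert (p (\<sigma> \<inter> T)) \<sigma> \<in> X - U" using s by (auto simp: U_def)
    qed
    also have "{\<sigma> \<in> X - U. \<sigma> \<inter> T = {}} = {\<sigma> \<in> X. \<sigma> \<inter> T = {}}" using B by (auto simp: U_def)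
    finally show ?thesis .
  qed
qed

lemma hdim_cone:
  assumes X: "is_complex_on W t X" and "\<And>\<sigma>. \<sigma> \<in> X \<Longrightarrow> insert v \<sigma> \<in> X"
  shows "face_hdim t X j = 0"
proof (rule hdim_acyclic)
  note D = is_complex_onD[OF X]
  show "cochain_complex (coface t) card X" by (rule D)
  have "insert v \<sigma> \<in> X \<and> \<sigma> - {v} \<in> X" if "\<sigma> \<in> X" for \<sigma>
    using assms(2)[OF that] down_closedD[OF D(4) that, of "\<sigma> - {v}"] by blast
  then show "acyclic_on (coface t) card X"
    by (rule acyclic_toggle[OF D(1,2,3,5)])
qed

lemma null_face_0:
  fixes t :: "'v set \<Rightarrow> 'v \<Rightarrow> 'a::field"
  shows "\<not> null_face t X {}"
proof
  assume "null_face t X {}"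
  then obtain h where h: "unit_fun {} = restrict_fun X (coface t h)"
    by (auto simp: null_face_def coboundaries_def)
  show False using fun_cong[OF h, of "{}"] by (simp add: unit_fun_def restrict_fun_def coface_def split: if_splits)
qed

lemma hdim_no_faces: "face_hdim t {} j = 0"
proof -
  have "cocycles (coface t) card {} j = {0}"
    by (auto simp: cocycles_def supported_def fun_eq_iff)
  then show ?thesis by (simp add: hdim_def fdim_zero)
qed

text \<open>In contrast to the family without faces, the complex with only the empty face has a
  class, in degree 0. It is what accounts for the Betti number 1 in homological and internal degree
  0.\<close>

lemma hdim_empty_face:
  assumes "finite W" "incidence W t"
  shows "face_hdim t {{}} j = (if j = 0 then 1 else 0)"
proof -
  have "is_complex_on W t {{}}" using assms by (auto simp: is_complex_on_def down_closed_def)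
  then have "int (face_hdim t {{}} j) = (if j = 0 then 1 else 0)"
    using hdim_remove_facet[of W t "{{}}" "{}" j] null_face_0[of t "{{}}"] by (simp add: hdim_no_faces)
  then show ?thesis by (simp split: if_splits)
qed

lemma restrict_coface:
  assumes "down_closed Y" "\<tau> \<in> Y"
  shows "coface t (restrict_fun Y f) \<tau> = coface t f \<tau>"
proof (rule coface_cong)
  fix v
  have "\<tau> - {v} \<in> Y" by (rule down_closedD[OF assms]) auto
  then show "restrict_fun Y f (\<tau> - {v}) = f (\<tau> - {v})" by (simp add: restrict_fun_apply)
qed

text \<open>A primitive restricts to subcomplexes. Used in contrapositive form: a facet cochain that
  is nonzero in cohomology on an embedded cross-polytope remains nonzero on the whole
  complex.\<close>

lemma null_face_subcomplex:
  assumes "null_face t X \<sigma>" "Y \<subseteq> X" "down_closed Y" "\<sigma> \<in> Y"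
  shows "null_face t Y \<sigma>"
proof -
  obtain h where h: "h \<in> supported {c \<in> X. Suc (card c) = card \<sigma>}" "unit_fun \<sigma> = restrict_fun X (coface t h)"
    using assms(1) by (auto simp: null_face_def coboundaries_def)
  have "unit_fun \<sigma> c = restrict_fun Y (coface t (restrict_fun Y h)) c" for c
  proof (cases "c \<in> Y")
    case True
    then show ?thesis
      using fun_cong[OF h(2), of c] assms(2,3) by (auto simp: restrict_fun_apply restrict_coface)
  qed (use assms in \<open>auto simp: restrict_fun_apply unit_fun_def\<close>)
  then have "unit_fun \<sigma> = restrict_fun Y (coface t (restrict_fun Y h))" by (rule ext)
  moreover have "restrict_fun Y h \<in> supported {c \<in> Y. Suc (card c) = card \<sigma>}"
    using h(1) by (auto simp: supported_def restrict_fun_def)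
  ultimately show ?thesis unfolding null_face_def coboundaries_def by blast
qed

text \<open>A null facet would kill a class one degree below it, but the complex without the facet
  has none there.\<close>

lemma not_null_face_if_acyclic:
  assumes X: "is_complex_on W t X" and \<sigma>: "\<sigma> \<in> X" "\<sigma> \<noteq> {}"
    and top: "\<And>\<tau>. \<tau> \<in> X \<Longrightarrow> \<sigma> \<subseteq> \<tau> \<Longrightarrow> \<tau> = \<sigma>"
    and ac: "face_hdim t (X - {\<sigma>}) (card \<sigma> - 1) = 0"
  shows "\<not> null_face t X \<sigma>"
proof
  assume "null_face t X \<sigma>"
  moreover have "finite \<sigma>" using is_complex_onD[OF X] \<sigma>(1) finite_subset by blast
  ultimately show False
    using hdim_remove_facet[OF X \<sigma>(1) top, of "card \<sigma> - 1"] ac \<sigma>(2)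
    by (simp add: card_gt_0_iff)
qed

text \<open>A facet that is not null contributes a class in its own degree.\<close>

lemma null_face_if_hdim_zero:
  assumes X: "is_complex_on W t X" and \<sigma>: "\<sigma> \<in> X"
    and top: "\<And>\<tau>. \<tau> \<in> X \<Longrightarrow> \<sigma> \<subseteq> \<tau> \<Longrightarrow> \<tau> = \<sigma>"
    and h: "face_hdim t X (card \<sigma>) = 0"
  shows "null_face t X \<sigma>"
  using hdim_remove_facet[OF X \<sigma> top, of "card \<sigma>"] h by (auto split: if_splits)

section \<open>Hochster's formula\<close>

abbreviation keys :: "('b \<Rightarrow>\<^sub>0 'c::zero) \<Rightarrow> 'b set" where "keys \<equiv> Poly_Mapping.keys"

abbreviation lookup :: "('b \<Rightarrow>\<^sub>0 'c::zero) \<Rightarrow> 'b \<Rightarrow> 'c" where "lookup \<equiv> Poly_Mapping.lookup"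

section \<open>Monomials and membership in the Stanley-Reisner ideal\<close>

definition mon :: "'v set \<Rightarrow> 'v \<Rightarrow>\<^sub>0 nat" where
  "mon A = (\<Sum>v\<in>A. Poly_Mapping.single v 1)"

lemma lookup_mon: "finite A \<Longrightarrow> lookup (mon A) v = (if v \<in> A then 1 else 0)"
  by (simp add: mon_def lookup_sum lookup_single when_def sum.delta')

lemma mdeg_eq_sum:
  assumes "finite V" "keys a \<subseteq> V"
  shows "mdeg a = (\<Sum>v\<in>V. lookup a v)"
  unfolding mdeg_def using assms by (intro sum.mono_neutral_left) (auto simp: in_keys_iff)

lemma mdeg_add: "mdeg (a + b) = mdeg a + mdeg b"
proof -
  let ?V = "keys a \<union> keys b"
  have "mdeg (a + b) = (\<Sum>v\<in>?V. lookup (a + b) v)"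
    using Poly_Mapping.keys_add[of a b] by (intro mdeg_eq_sum) auto
  also have "\<dots> = mdeg a + mdeg b"
    by (simp add: lookup_add sum.distrib mdeg_eq_sum[of ?V a] mdeg_eq_sum[of ?V b])
  finally show ?thesis .
qed

lemma keys_add_nat:
  fixes a b :: "'v \<Rightarrow>\<^sub>0 nat"
  shows "keys (a + b) = keys a \<union> keys b"
  by (auto simp: in_keys_iff lookup_add)

lemma keys_mon: "finite A \<Longrightarrow> keys (mon A) = A"
  by (auto simp: in_keys_iff lookup_mon split: if_splits)

lemma mdeg_mon: "finite A \<Longrightarrow> mdeg (mon A) = card A"
  by (simp add: mdeg_def keys_mon lookup_mon)

lemma minus_mon_add_mon:
  assumes "A \<subseteq> keys a"
  shows "a - mon A + mon A = a"
proof (rule poly_mapping_eqI)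
  fix v
  have "finite A" by (rule finite_subset[OF assms finite_keys])
  then show "lookup (a - mon A + mon A) v = lookup a v"
    using assms by (auto simp: lookup_add lookup_minus lookup_mon in_keys_iff)
qed

lemma add_mon_minus_mon: "m + mon A - mon A = m"
  by (rule poly_mapping_eqI) (simp add: lookup_add lookup_minus)

lemma keys_minus_mon:
  assumes "A \<subseteq> keys a"
  shows "keys (a - mon A) \<subseteq> keys a"
    and "keys a - A \<subseteq> keys (a - mon A)"
proof -
  have "finite A" by (rule finite_subset[OF assms finite_keys])
  then show "keys (a - mon A) \<subseteq> keys a"
    "keys a - A \<subseteq> keys (a - mon A)"
    by (auto simp: in_keys_iff lookup_minus lookup_mon split: if_splits)
qed

lemma minus_mon_antimono:
  assumes "A \<subseteq> B" "B \<subseteq> keys a"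
  shows "keys (a - mon B) \<subseteq> keys (a - mon A)"
proof -
  have "finite B" by (rule finite_subset[OF assms(2) finite_keys])
  moreover have "finite A" by (rule finite_subset[OF assms(1) calculation])
  ultimately have "finite A" "finite B" by simp_all
  then show ?thesis using assms(1) by (auto simp: in_keys_iff lookup_minus lookup_mon split: if_splits)
qed

lemma mdeg_minus_mon:
  assumes "A \<subseteq> keys a"
  shows "mdeg (a - mon A) + card A = mdeg a"
proof -
  have "finite A" by (rule finite_subset[OF assms finite_keys])
  then show ?thesis using mdeg_add[of "a - mon A" "mon A"] minus_mon_add_mon[OF assms] mdeg_mon[of A] by simp
qed

definition monomials :: "'v set \<Rightarrow> nat \<Rightarrow> ('v \<Rightarrow>\<^sub>0 nat) set" where
  "monomials V k = {a. keys a \<subseteq> V \<and> mdeg a = k}"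

lemma finite_monomials:
  assumes "finite V"
  shows "finite (monomials V k)"
proof (induction k)
  case 0
  have "monomials V 0 \<subseteq> {0}" by (auto simp: monomials_def mdeg_def in_keys_iff intro!: poly_mapping_eqI)
  then show ?case using finite_subset by blast
next
  case (Suc k)
  have "monomials V (Suc k) \<subseteq> (\<Union>v\<in>V. (\<lambda>a. a + mon {v}) ` monomials V k)"
  proof
    fix a assume a: "a \<in> monomials V (Suc k)"
    then have "keys a \<noteq> {}" by (auto simp: monomials_def mdeg_def)
    then obtain v where "v \<in> keys a" by (meson ex_in_conv)
    then have v: "{v} \<subseteq> keys a" by blast
    then have "a = (a - mon {v}) + mon {v}" by (rule minus_mon_add_mon[symmetric])
    moreover have "a - mon {v} \<in> monomials V k"
      using a keys_minus_mon(1)[OF v] mdeg_minus_mon[OF v] by (auto simp: monomials_def)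
    moreover have "v \<in> V" using a v by (auto simp: monomials_def)
    ultimately show "a \<in> (\<Union>v\<in>V. (\<lambda>a. a + mon {v}) ` monomials V k)" by blast
  qed
  then show ?case using assms Suc finite_subset by blast
qed

lemma lookup_Const_times: "lookup (Const c * p) m = c * lookup p m"
proof -
  have "Const c * p = Poly_Mapping.map ((*) c) p" by (simp add: Const_def mult_map_scale_conv_mult)
  then show ?thesis by (simp add: Poly_Mapping.map.rep_eq when_def)
qed

lemma prod_Var: "finite A \<Longrightarrow> (\<Prod>v\<in>A. Var v) = (Poly_Mapping.single (mon A) 1 :: ('v, 'a::comm_ring_1) mpoly)"
  by (induction A rule: finite_induct) (simp_all add: mon_def Var_def mult_single flip: single_one)

lemma poly_eq_sum_single:
  "p = (\<Sum>k\<in>keys p. Poly_Mapping.single k (lookup p k))"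
  by (rule poly_mapping_eqI) (simp add: lookup_sum lookup_single when_def sum.delta' in_keys_iff)

text \<open>The ideal is generated by monomials, so membership is decided term by term, and only the
  support of a term matters because nonfaces are closed upwards.\<close>

lemma SR_ideal_iff:
  fixes p :: "('v, 'a::comm_ring_1) mpoly"
  assumes fin: "finite (\<Union>\<Delta>)" and dc: "down_closed \<Delta>" and p: "p \<in> polys (\<Union>\<Delta>)"
  shows "p \<in> SR_ideal \<Delta> \<longleftrightarrow> (\<forall>m\<in>keys p. keys m \<notin> \<Delta>)"
proof
  assume "p \<in> SR_ideal \<Delta>"
  then obtain q where q: "p = (\<Sum>A\<in>nonfaces \<Delta>. q A * (\<Prod>v\<in>A. Var v))"
    by (auto simp: SR_ideal_def)
  show "\<forall>m\<in>keys p. keys m \<notin> \<Delta>"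
  proof
    fix m assume "m \<in> keys p"
    then obtain A where A: "A \<in> nonfaces \<Delta>" "m \<in> keys (q A * (\<Prod>v\<in>A. Var v))"
      using keys_sum[of "\<lambda>A. q A * (\<Prod>v\<in>A. Var v)" "nonfaces \<Delta>"] unfolding q by blast
    have finA: "finite A" using A(1) fin finite_subset by (auto simp: nonfaces_def)
    have "m \<in> {a + b |a b. a \<in> keys (q A) \<and> b \<in> keys (Poly_Mapping.single (mon A) (1::'a))}"
      using A(2) keys_mult[of "q A" "Poly_Mapping.single (mon A) (1::'a)"] unfolding prod_Var[OF finA] by blast
    then obtain b where "m = b + mon A" by (auto split: if_splits)
    then have "A \<subseteq> keys m" by (simp add: keys_add_nat keys_mon finA)
    then show "keys m \<notin> \<Delta>" using dc A(1) by (auto simp: nonfaces_def dest: down_closedD)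
  qed
next
  assume nf: "\<forall>m\<in>keys p. keys m \<notin> \<Delta>"
  \<comment> \<open>The terms are grouped by their exact support, which is itself a nonface. No
    choice of a minimal nonface is needed, and \<open>q A\<close> is the group of \<open>A\<close>
    divided by the generator of \<open>A\<close>.\<close>
  define S where "S A = {m \<in> keys p. keys m = A}" for A
  define q where "q A = (\<Sum>m\<in>S A. Poly_Mapping.single (m - mon A) (lookup p m))" for A
  have finN: "finite (nonfaces \<Delta>)" using fin by (auto simp: nonfaces_def)
  have kV: "keys m \<subseteq> \<Union>\<Delta>" if "m \<in> keys p" for m
    using p that by (auto simp: polys_def)
  have qV: "q A \<in> polys (\<Union>\<Delta>)" for A
    unfolding q_def
  proof (rule polys_sum)
    fix m assume "m \<in> S A"
    then have "A \<subseteq> keys m" "keys m \<subseteq> \<Union>\<Delta>" using kV by (auto simp: S_def)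
    then show "Poly_Mapping.single (m - mon A) (lookup p m) \<in> polys (\<Union>\<Delta>)"
      using keys_minus_mon(1)[of A m] by (auto simp: polys_def split: if_splits)
  qed
  have "q A * (\<Prod>v\<in>A. Var v) = (\<Sum>m\<in>S A. Poly_Mapping.single m (lookup p m))"
    if "A \<in> nonfaces \<Delta>" for A
  proof -
    have finA: "finite A" using that fin finite_subset by (auto simp: nonfaces_def)
    have "Poly_Mapping.single (m - mon A) (lookup p m) * Poly_Mapping.single (mon A) 1
        = Poly_Mapping.single m (lookup p m)" if "m \<in> S A" for m
      using that minus_mon_add_mon[of A m] by (simp add: mult_single S_def)
    then show ?thesis by (simp add: q_def prod_Var[OF finA] sum_distrib_right)
  qed
  then have "(\<Sum>A\<in>nonfaces \<Delta>. q A * (\<Prod>v\<in>A. Var v)) =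
      (\<Sum>A\<in>nonfaces \<Delta>. \<Sum>m\<in>S A. Poly_Mapping.single m (lookup p m))"
    by (rule sum.cong[OF refl])
  also have "\<dots> = (\<Sum>m\<in>(\<Union>A\<in>nonfaces \<Delta>. S A). Poly_Mapping.single m (lookup p m))"
    using finN by (intro sum.UNION_disjoint[symmetric]) (auto simp: S_def)
  also have "(\<Union>A\<in>nonfaces \<Delta>. S A) = keys p"
    using nf kV by (auto simp: S_def nonfaces_def)
  also have "(\<Sum>m\<in>keys p. Poly_Mapping.single m (lookup p m)) = p"
    by (rule poly_eq_sum_single[symmetric])
  finally show "p \<in> SR_ideal \<Delta>" unfolding SR_ideal_def using qV by blast
qed

text \<open>In a squarefree multidegree \<open>W\<close> the exterior generator \<open>A\<close> corresponds to the face \<open>W - A\<close>, so the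
  Koszul differential, which removes elements of \<open>A\<close>, becomes a coboundary map on faces.\<close>

definition hsign :: "'v set \<Rightarrow> 'v set \<Rightarrow> 'v set \<Rightarrow> 'v \<Rightarrow> 'a::comm_ring_1" where
  "hsign V W \<tau> v = koszul_sign V (W - \<tau>) v"

lemma koszul_sign_square: "koszul_sign V A v * koszul_sign V A v = 1"
  by (simp add: koszul_sign_def flip: power_add mult_2)

text \<open>Removing \<open>u\<close> from \<open>\<tau>\<close> adds it to the exterior part, which
  flips the sign of \<open>v\<close> exactly if \<open>u\<close> precedes \<open>v\<close>. Of the
  two orders of removal exactly one produces a flip.\<close>

lemma incidence_hsign:
  assumes V: "finite V" "W \<subseteq> V"
  shows "incidence W (hsign V W)"
  unfolding incidence_def
proof (intro conjI allI ballI impI)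
  fix \<tau> v show "hsign V W \<tau> v * hsign V W \<tau> v = 1"
    unfolding hsign_def by (rule koszul_sign_square)
next
  fix \<tau> u v assume \<tau>: "\<tau> \<subseteq> W" "u \<in> \<tau>" "v \<in> \<tau>" "u \<noteq> v"
  let ?A = "W - \<tau>" and ?r = "to_nat_on V"
  have fin: "finite ?A" using V finite_subset by blast
  have "inj_on ?r V" using V by (simp add: countable_finite inj_on_to_nat_on)
  then have ne: "?r u \<noteq> ?r v" using \<tau> V by (auto dest: inj_onD)
  have e: "W - (\<tau> - {u}) = insert u ?A" "W - (\<tau> - {v}) = insert v ?A" using \<tau> by auto
  have n: "u \<notin> ?A" "v \<notin> ?A" using \<tau> by auto
  show "hsign V W \<tau> u * hsign V W (\<tau> - {u}) v = - (hsign V W \<tau> v * hsign V W (\<tau> - {v}) u)"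
    unfolding hsign_def e koszul_sign_insert[OF fin n(1)] koszul_sign_insert[OF fin n(2)]
    using ne by (auto simp: mult.commute)
qed

lemma hdim_grade_cong:
  assumes "\<And>c. c \<in> Q \<Longrightarrow> g c = g' c"
  shows "hdim \<delta> g Q j = hdim \<delta> g' Q j"
proof -
  have "{c \<in> Q. g c = j} = {c \<in> Q. g' c = j}" "{c \<in> Q. Suc (g c) = j} = {c \<in> Q. Suc (g' c) = j}"
    using assms by auto
  then show ?thesis by (simp add: hdim_def cocycles_def coboundaries_def)
qed

section \<open>The Koszul complex of the Stanley-Reisner ring, split by multidegree\<close>

definition induced :: "'v set set \<Rightarrow> 'v set \<Rightarrow> 'v set set" where
  "induced \<Delta> W = {\<sigma> \<in> \<Delta>. \<sigma> \<subseteq> W}"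

text \<open>The set \<open>\<sigma>\<close> encodes the Koszul generator with exterior part
  \<open>keys a - \<sigma>\<close>. Its polynomial factor is the monomial of exponent
  \<open>a\<close> divided by the exterior variables, and it is nonzero modulo the ideal exactly if
  the support of that factor is a face.\<close>

definition multideg_faces :: "'v set set \<Rightarrow> ('v \<Rightarrow>\<^sub>0 nat) \<Rightarrow> 'v set set" where
  "multideg_faces \<Delta> a =
     {\<sigma>. \<sigma> \<subseteq> keys a \<and> keys (a - mon (keys a - \<sigma>)) \<in> \<Delta>}"

definition multideg_cells :: "'v set set \<Rightarrow> nat \<Rightarrow> (('v \<Rightarrow>\<^sub>0 nat) \<times> 'v set) set" where
  "multideg_cells \<Delta> k = Sigma (monomials (\<Union>\<Delta>) k) (multideg_faces \<Delta>)"

text \<open>The Koszul differential lowers the homological degree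
  \<open>card (keys a - \<sigma>)\<close>. Subtracting it from \<open>k\<close> yields a cochain
  degree, which in squarefree multidegrees is the cardinality of \<open>\<sigma>\<close>.\<close>

definition multideg_grade :: "nat \<Rightarrow> ('v \<Rightarrow>\<^sub>0 nat) \<Rightarrow> 'v set \<Rightarrow> nat" where
  "multideg_grade k a \<sigma> = k - card (keys a - \<sigma>)"

definition multideg_op ::
  "'v set \<Rightarrow> (('v \<Rightarrow>\<^sub>0 nat) \<times> 'v set \<Rightarrow> 'a::field) \<Rightarrow> ('v \<Rightarrow>\<^sub>0 nat) \<times> 'v set \<Rightarrow> 'a" where
  "multideg_op V = sigma_op (\<lambda>a. coface (hsign V (keys a)))"

text \<open>Shrinking \<open>\<sigma>\<close> enlarges the exterior part, so the remaining
  polynomial factor can only lose variables.\<close>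

lemma down_closed_multideg_faces:
  assumes "down_closed \<Delta>"
  shows "down_closed (multideg_faces \<Delta> a)"
  unfolding down_closed_def
proof (intro ballI allI impI)
  fix \<sigma> \<tau> assume s: "\<sigma> \<in> multideg_faces \<Delta> a" "\<tau> \<subseteq> \<sigma>"
  let ?K = "keys a"
  have "keys (a - mon (?K - \<tau>)) \<subseteq> keys (a - mon (?K - \<sigma>))"
    using s by (intro minus_mon_antimono) auto
  then show "\<tau> \<in> multideg_faces \<Delta> a"
    using s assms by (auto simp: multideg_faces_def dest: down_closedD)
qed

lemma card_keys_le_mdeg: "card (keys a) \<le> mdeg a"
  using mdeg_minus_mon[of "keys a" a] by simp

lemma card_keys_diff_le:
  assumes "mdeg a = k"
  shows "card (keys a - \<sigma>) \<le> k"
  using card_mono[OF finite_keys, of "keys a - \<sigma>" a] card_keys_le_mdeg[of a] assms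
  by auto

lemma multideg_grade_insert:
  assumes "mdeg a = k" "v \<in> keys a" "v \<notin> \<sigma>"
  shows "multideg_grade k a (insert v \<sigma>) = Suc (multideg_grade k a \<sigma>)"
proof -
  let ?A = "keys a - \<sigma>"
  have "keys a - insert v \<sigma> = ?A - {v}" by auto
  moreover have "card ?A = Suc (card (?A - {v}))"
    using assms by (intro card.remove) auto
  ultimately show ?thesis
    using card_keys_diff_le[OF assms(1), of \<sigma>] by (simp add: multideg_grade_def)
qed

lemma multideg_family:
  assumes fin: "finite (\<Union>\<Delta>)" and dc: "down_closed \<Delta>" and a: "a \<in> monomials (\<Union>\<Delta>) k"
  shows "incidence (keys a) (hsign (\<Union>\<Delta>) (keys a) :: 'v set \<Rightarrow> 'v \<Rightarrow> 'a::field)"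
    and "multideg_faces \<Delta> a \<subseteq> Pow (keys a)"
    and "graded_family (multideg_grade k a) (multideg_faces \<Delta> a)"
    and "cochain_complex (coface (hsign (\<Union>\<Delta>) (keys a) :: 'v set \<Rightarrow> 'v \<Rightarrow> 'a))
      (multideg_grade k a) (multideg_faces \<Delta> a)"
proof -
  let ?t = "hsign (\<Union>\<Delta>) (keys a) :: 'v set \<Rightarrow> 'v \<Rightarrow> 'a"
  show inc: "incidence (keys a) ?t"
    using a fin by (intro incidence_hsign) (auto simp: monomials_def)
  show sub: "multideg_faces \<Delta> a \<subseteq> Pow (keys a)"
    by (auto simp: multideg_faces_def)
  show gr: "graded_family (multideg_grade k a) (multideg_faces \<Delta> a)"
    unfolding graded_family_def
  proof (intro allI impI)
    fix \<sigma> v assume "v \<notin> \<sigma>" "insert v \<sigma> \<in> multideg_faces \<Delta> a"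
    then show "multideg_grade k a (insert v \<sigma>) = Suc (multideg_grade k a \<sigma>)"
      using a by (intro multideg_grade_insert) (auto simp: monomials_def multideg_faces_def)
  qed
  show "cochain_complex (coface ?t) (multideg_grade k a) (multideg_faces \<Delta> a)"
    by (rule cochain_complex_family[OF finite_keys inc sub down_closed_convex[OF down_closed_multideg_faces[OF dc]] gr])
qed

text \<open>Only squarefree multidegrees contribute: if \<open>a v \<ge> 2\<close>, then deleting the exterior generator of
  \<open>v\<close> does not change the support of the complementary monomial.\<close>

lemma hdim_nonsquarefree:
  assumes fin: "finite (\<Union>\<Delta>)" and dc: "down_closed \<Delta>" and a: "a \<in> monomials (\<Union>\<Delta>) k"
    and v: "lookup a v \<ge> 2"
  shows "hdim (coface (hsign (\<Union>\<Delta>) (keys a) :: 'v set \<Rightarrow> 'v \<Rightarrow> 'a::field))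
    (multideg_grade k a) (multideg_faces \<Delta> a) j = 0"
proof (rule hdim_acyclic)
  note F = multideg_family[OF fin dc a]
  show "cochain_complex (coface (hsign (\<Union>\<Delta>) (keys a) :: 'v set \<Rightarrow> 'v \<Rightarrow> 'a))
    (multideg_grade k a) (multideg_faces \<Delta> a)" by (rule F)
  have vk: "v \<in> keys a" using v by (simp add: in_keys_iff)
  let ?K = "keys a"
  have eq: "keys (a - mon (?K - insert v \<sigma>)) = keys (a - mon (?K - \<sigma>))" for \<sigma>
    using v by (auto simp: in_keys_iff lookup_minus lookup_mon split: if_splits)
  show "acyclic_on (coface (hsign (\<Union>\<Delta>) ?K :: 'v set \<Rightarrow> 'v \<Rightarrow> 'a)) (multideg_grade k a) (multideg_faces \<Delta> a)"
  proof (rule acyclic_toggle[OF finite_keys F(1-3), of v])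
    fix \<sigma> assume s: "\<sigma> \<in> multideg_faces \<Delta> a"
    have "\<sigma> - {v} \<in> multideg_faces \<Delta> a"
      by (rule down_closedD[OF down_closed_multideg_faces[OF dc] s]) auto
    moreover have "insert v \<sigma> \<in> multideg_faces \<Delta> a"
      using s vk eq[of \<sigma>] by (simp add: multideg_faces_def)
    ultimately show "insert v \<sigma> \<in> multideg_faces \<Delta> a \<and> \<sigma> - {v} \<in> multideg_faces \<Delta> a" by blast
  qed
qed

text \<open>When all exponents are at most 1, dividing by the variables of
  \<open>W - \<sigma>\<close> leaves a monomial with support exactly \<open>\<sigma>\<close>, so the
  cells are the faces contained in \<open>W\<close>.\<close>

lemma hdim_squarefree:
  assumes W: "finite W" "card W = k" and sub: "W \<subseteq> \<Union>\<Delta>"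
  shows "hdim (coface (hsign (\<Union>\<Delta>) (keys (mon W)) :: 'v set \<Rightarrow> 'v \<Rightarrow> 'a::field))
    (multideg_grade k (mon W)) (multideg_faces \<Delta> (mon W)) j =
    face_hdim (hsign (\<Union>\<Delta>) W :: 'v set \<Rightarrow> 'v \<Rightarrow> 'a) (induced \<Delta> W) j"
proof -
  have k: "keys (mon W) = W" by (rule keys_mon[OF W(1)])
  have "mon W - mon (W - \<sigma>) = mon \<sigma>" if "\<sigma> \<subseteq> W" for \<sigma>
    using that W(1) finite_subset[OF that W(1)] by (intro poly_mapping_eqI) (auto simp: lookup_minus lookup_mon)
  then have "keys (mon W - mon (W - \<sigma>)) = \<sigma>" if "\<sigma> \<subseteq> W" for \<sigma>
    using keys_mon finite_subset[OF that W(1)] that by metis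
  then have fam: "multideg_faces \<Delta> (mon W) = induced \<Delta> W"
    unfolding multideg_faces_def induced_def k by auto
  have *: "multideg_grade k (mon W) \<sigma> = card \<sigma>" if "\<sigma> \<in> induced \<Delta> W" for \<sigma>
  proof -
    have s: "\<sigma> \<subseteq> W" using that by (simp add: induced_def)
    then show ?thesis
      unfolding multideg_grade_def k W(2)[symmetric]
      using card_Diff_subset[OF finite_subset[OF s W(1)] s] card_mono[OF W(1) s] by simp
  qed
  show ?thesis unfolding fam k by (rule hdim_grade_cong) (rule *)
qed

lemma hdim_multideg_cells:
  assumes fin: "finite (\<Union>\<Delta>)" and dc: "down_closed \<Delta>"
  shows "hdim (multideg_op (\<Union>\<Delta>) :: (('v \<Rightarrow>\<^sub>0 nat) \<times> 'v set \<Rightarrow> 'a::field) \<Rightarrow> _)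
      (\<lambda>(a, \<sigma>). multideg_grade k a \<sigma>) (multideg_cells \<Delta> k) j =
    (\<Sum>W | W \<subseteq> \<Union>\<Delta> \<and> card W = k. face_hdim (hsign (\<Union>\<Delta>) W :: 'v set \<Rightarrow> 'v \<Rightarrow> 'a) (induced \<Delta> W) j)"
proof -
  let ?V = "\<Union>\<Delta>"
  let ?h = "\<lambda>a. hdim (coface (hsign ?V (keys a) :: 'v set \<Rightarrow> 'v \<Rightarrow> 'a))
      (multideg_grade k a) (multideg_faces \<Delta> a) j"
  have "hdim (multideg_op ?V :: (('v \<Rightarrow>\<^sub>0 nat) \<times> 'v set \<Rightarrow> 'a) \<Rightarrow> _)
      (\<lambda>(a, \<sigma>). multideg_grade k a \<sigma>) (multideg_cells \<Delta> k) j = (\<Sum>a\<in>monomials ?V k. ?h a)"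
    unfolding multideg_op_def multideg_cells_def
    by (rule hdim_sigma[OF finite_monomials[OF fin] flinear_coface multideg_family(4)[OF fin dc]])
  also have "\<dots> = (\<Sum>a\<in>mon ` {W. W \<subseteq> ?V \<and> card W = k}. ?h a)"
  proof (rule sum.mono_neutral_right[OF finite_monomials[OF fin]])
    show "mon ` {W. W \<subseteq> ?V \<and> card W = k} \<subseteq> monomials ?V k"
    proof (intro image_subsetI)
      fix W assume W: "W \<in> {W. W \<subseteq> ?V \<and> card W = k}"
      then have "finite W" using fin finite_subset by auto
      then show "mon W \<in> monomials ?V k" using W by (simp add: monomials_def keys_mon mdeg_mon)
    qed
    show "\<forall>a\<in>monomials ?V k - mon ` {W. W \<subseteq> ?V \<and> card W = k}. ?h a = 0"
    proof
      fix a assume a: "a \<in> monomials ?V k - mon ` {W. W \<subseteq> ?V \<and> card W = k}"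
      have "\<exists>v. lookup a v \<ge> 2"
      proof (rule ccontr)
        assume "\<nexists>v. lookup a v \<ge> 2"
        then have le: "lookup a v \<le> 1" for v by (metis Suc_1 not_less_eq_eq)
        have "a = mon (keys a)"
        proof (rule poly_mapping_eqI)
          fix v show "lookup a v = lookup (mon (keys a)) v"
            using le[of v] by (auto simp: lookup_mon in_keys_iff)
        qed
        moreover have "card (keys a) = k"
          using a calculation mdeg_mon[of "keys a"] by (auto simp: monomials_def)
        ultimately show False using a by (auto simp: monomials_def)
      qed
      then show "?h a = 0" using hdim_nonsquarefree[OF fin dc] a by blast
    qed
  qed
  also have "\<dots> = (\<Sum>W | W \<subseteq> ?V \<and> card W = k. ?h (mon W))"
  proof (rule sum.reindex_cong[OF _ refl refl])
    show "inj_on mon {W. W \<subseteq> ?V \<and> card W = k}"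
    proof (rule inj_onI)
      fix A B assume "A \<in> {W. W \<subseteq> ?V \<and> card W = k}" "B \<in> {W. W \<subseteq> ?V \<and> card W = k}"
        and e: "mon A = mon B"
      then have "finite A" "finite B" using fin finite_subset by auto
      then show "A = B" using keys_mon e by metis
    qed
  qed
  also have "\<dots> = (\<Sum>W | W \<subseteq> ?V \<and> card W = k. face_hdim (hsign ?V W :: 'v set \<Rightarrow> 'v \<Rightarrow> 'a) (induced \<Delta> W) j)"
    using fin by (intro sum.cong refl hdim_squarefree) (auto intro: finite_subset)
  finally show ?thesis .
qed

section \<open>Koszul chains modulo the ideal as cochains on cells\<close>

definition koszul_coeffs ::
  "'v set set \<Rightarrow> nat \<Rightarrow> nat \<Rightarrow> ('v set \<Rightarrow> ('v, 'a::field) mpoly) \<Rightarrow> ('v \<Rightarrow>\<^sub>0 nat) \<times> 'v set \<Rightarrow> 'a" where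
  "koszul_coeffs \<Delta> k i x = (\<lambda>(a, \<sigma>).
     if (a, \<sigma>) \<in> multideg_cells \<Delta> k \<and> card (keys a - \<sigma>) = i
     then lookup (x (keys a - \<sigma>)) (a - mon (keys a - \<sigma>)) else 0)"

text \<open>A section of \<open>koszul_coeffs\<close>: the term \<open>m\<close> at the exterior
  generator \<open>A\<close> has multidegree \<open>m + mon A\<close>, and its cell is the support
  of \<open>m\<close> without \<open>A\<close>. The argument \<open>j\<close> is the polynomial
  degree, that is internal minus homological degree.\<close>

definition koszul_lift ::
  "'v set \<Rightarrow> nat \<Rightarrow> nat \<Rightarrow> (('v \<Rightarrow>\<^sub>0 nat) \<times> 'v set \<Rightarrow> 'a::field) \<Rightarrow> 'v set \<Rightarrow> ('v, 'a) mpoly" where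
  "koszul_lift V i j f A = (if A \<subseteq> V \<and> card A = i
     then \<Sum>m\<in>monomials V j. Poly_Mapping.single m (f (m + mon A, keys m - A)) else 0)"

definition koszul_degree :: "'v set \<Rightarrow> nat \<Rightarrow> nat \<Rightarrow> ('v set \<Rightarrow> ('v, 'a::field) mpoly) set" where
  "koszul_degree V i k = free_mod V {A. A \<subseteq> V \<and> card A = i} \<inter> homogeneous_part (\<lambda>A. i) (int k)"

lemma koszul_degreeD:
  assumes "x \<in> koszul_degree V i k" "m \<in> keys (x A)"
  shows "A \<subseteq> V" "card A = i" "mdeg m + i = k" "keys m \<subseteq> V"
proof -
  show A: "A \<subseteq> V" "card A = i"
    using assms by (auto simp: koszul_degree_def free_mod_def)
  show "keys m \<subseteq> V"
    using assms A by (auto simp: koszul_degree_def free_mod_def polys_def)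
  have "int (mdeg m) + int i = int k"
    using assms by (auto simp: koszul_degree_def homogeneous_part_def)
  then show "mdeg m + i = k" by simp
qed

lemma koszul_degree_polys: "x \<in> koszul_degree V i k \<Longrightarrow> x A \<in> polys V"
  by (cases "A \<subseteq> V \<and> card A = i") (auto simp: koszul_degree_def free_mod_def)

lemma koszul_degreeI:
  assumes "\<And>A m. m \<in> keys (x A) \<Longrightarrow>
    A \<subseteq> V \<and> card A = i \<and> mdeg m + i = k \<and> keys m \<subseteq> V"
  shows "x \<in> koszul_degree V i k"
proof -
  have "x A = 0" if "\<not> (A \<subseteq> V \<and> card A = i)" for A
    using assms[of _ A] that by (metis ex_in_conv keys_eq_empty)
  moreover have "int (mdeg m) + int i = int k" if "m \<in> keys (x A)" for A m
    using assms[OF that] by (metis of_nat_add)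
  moreover have "x A \<in> polys V" for A using assms by (auto simp: polys_def)
  ultimately show ?thesis by (auto simp: koszul_degree_def free_mod_def homogeneous_part_def)
qed

lemma multideg_cellsD:
  assumes "(a, \<sigma>) \<in> multideg_cells \<Delta> k"
  shows "keys a \<subseteq> \<Union>\<Delta>" "mdeg a = k" "\<sigma> \<subseteq> keys a"
    "keys (a - mon (keys a - \<sigma>)) \<in> \<Delta>"
  using assms by (auto simp: multideg_cells_def multideg_faces_def monomials_def)

lemma cell_of_term:
  assumes "finite (\<Union>\<Delta>)" "A \<subseteq> \<Union>\<Delta>" "keys m \<in> \<Delta>" "mdeg m + card A = k"
  shows "(m + mon A, keys m - A) \<in> multideg_cells \<Delta> k"
    and "keys (m + mon A) - (keys m - A) = A"
proof -
  have fin: "finite A" using assms(1,2) finite_subset by blast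
  have k: "keys (m + mon A) = keys m \<union> A"
    by (simp add: keys_add_nat keys_mon[OF fin])
  show d: "keys (m + mon A) - (keys m - A) = A" unfolding k by auto
  show "(m + mon A, keys m - A) \<in> multideg_cells \<Delta> k"
    unfolding multideg_cells_def multideg_faces_def monomials_def
    using assms d by (auto simp: add_mon_minus_mon k mdeg_add mdeg_mon[OF fin])
qed

lemma koszul_coeffs_cell:
  assumes "finite (\<Union>\<Delta>)" "A \<subseteq> \<Union>\<Delta>" "keys m \<in> \<Delta>" "mdeg m + card A = k" "card A = i"
  shows "koszul_coeffs \<Delta> k i x (m + mon A, keys m - A) = lookup (x A) m"
  using cell_of_term[OF assms(1-4)] assms(5) by (simp add: koszul_coeffs_def add_mon_minus_mon)

lemma cells_down:
  assumes "down_closed \<Delta>" "(a, \<tau>) \<in> multideg_cells \<Delta> k"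
  shows "(a, \<tau> - {v}) \<in> multideg_cells \<Delta> k"
  using assms down_closedD[OF down_closed_multideg_faces[OF assms(1)], of \<tau> a "\<tau> - {v}"]
  by (auto simp: multideg_cells_def)

lemma card_cell_remove:
  assumes "(a, \<tau>) \<in> multideg_cells \<Delta> k" "v \<in> \<tau>"
  shows "keys a - (\<tau> - {v}) = insert v (keys a - \<tau>)"
    and "card (keys a - (\<tau> - {v})) = Suc (card (keys a - \<tau>))"
proof -
  show e: "keys a - (\<tau> - {v}) = insert v (keys a - \<tau>)"
    using multideg_cellsD(3)[OF assms(1)] assms(2) by auto
  show "card (keys a - (\<tau> - {v})) = Suc (card (keys a - \<tau>))"
    unfolding e using assms(2) by simp
qed

lemma multideg_op_apply:
  "multideg_op V f (a, \<tau>) = (\<Sum>v\<in>\<tau>. koszul_sign V (keys a - \<tau>) v * f (a, \<tau> - {v}))"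
  by (simp add: multideg_op_def sigma_op_def coface_def hsign_def)

lemma koszul_sign_insert_self: "koszul_sign V (insert v C) v = koszul_sign V C v"
proof -
  have "{u \<in> insert v C. to_nat_on V u < to_nat_on V v} = {u \<in> C. to_nat_on V u < to_nat_on V v}" by auto
  then show ?thesis by (simp add: koszul_sign_def)
qed

text \<open>The coefficient map intertwines the Koszul differential with the coboundary on cells;
  this is the point where the two sign conventions meet.\<close>

lemma multideg_op_coeffs:
  assumes fin: "finite (\<Union>\<Delta>)" and dc: "down_closed \<Delta>"
    and c: "(a, \<tau>) \<in> multideg_cells \<Delta> k" "card (keys a - \<tau>) = i"
  shows "multideg_op (\<Union>\<Delta>) (koszul_coeffs \<Delta> k (Suc i) x) (a, \<tau>) =
    lookup (boundary (koszul (\<Union>\<Delta>)) (Suc i) x (keys a - \<tau>))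
      (a - mon (keys a - \<tau>))"
proof -
  let ?V = "\<Union>\<Delta>" and ?C = "keys a - \<tau>"
  note D = multideg_cellsD[OF c(1)]
  have finC: "finite ?C" by simp
  \<comment> \<open>The variables outside the exterior part that divide the polynomial factor are
    precisely the elements of \<open>\<tau>\<close>. Repeated variables of the exterior part also
    divide it, but they are excluded from the sum.\<close>
  have key: "v \<in> ?V - ?C \<and> v \<in> keys (a - mon ?C) \<longleftrightarrow> v \<in> \<tau>" for v
    using D(1,3) finC by (auto simp: in_keys_iff lookup_minus lookup_mon split: if_splits)
  have fintau: "finite \<tau>" using D(3) finite_keys finite_subset by blast
  have "lookup (boundary (koszul ?V) (Suc i) x ?C) (a - mon ?C) =
    (\<Sum>v\<in>?V - ?C. if v \<in> keys (a - mon ?C) then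
       lookup (x (insert v ?C)) (a - mon ?C - Poly_Mapping.single v 1) *
         koszul_sign ?V (insert v ?C) v else 0)"
    using D(1) c(2) by (intro lookup_koszul_boundary[OF fin]) auto
  also have "\<dots> = (\<Sum>v\<in>\<tau>. lookup (x (insert v ?C)) (a - mon ?C - Poly_Mapping.single v 1) *
         koszul_sign ?V (insert v ?C) v)"
    using fin fintau key by (intro sum.mono_neutral_cong_right) auto
  also have "\<dots> = (\<Sum>v\<in>\<tau>. koszul_sign ?V ?C v * koszul_coeffs \<Delta> k (Suc i) x (a, \<tau> - {v}))"
  proof (rule sum.cong[OF refl])
    fix v assume v: "v \<in> \<tau>"
    have m: "mon (insert v ?C) = mon ?C + Poly_Mapping.single v 1"
      using v by (simp add: mon_def add.commute)
    have "koszul_coeffs \<Delta> k (Suc i) x (a, \<tau> - {v}) =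
        lookup (x (insert v ?C)) (a - mon (insert v ?C))"
      using cells_down[OF dc c(1), of v] card_cell_remove[OF c(1) v] c(2) by (simp add: koszul_coeffs_def)
    then show "lookup (x (insert v ?C)) (a - mon ?C - Poly_Mapping.single v 1) *
         koszul_sign ?V (insert v ?C) v = koszul_sign ?V ?C v * koszul_coeffs \<Delta> k (Suc i) x (a, \<tau> - {v})"
      unfolding m by (simp add: koszul_sign_insert_self diff_diff_eq)
  qed
  finally show ?thesis by (simp add: multideg_op_apply)
qed

lemma multideg_op_coeffs_0:
  assumes c: "(a, \<tau>) \<in> multideg_cells \<Delta> k" "Suc (card (keys a - \<tau>)) \<noteq> i"
  shows "multideg_op V (koszul_coeffs \<Delta> k i x) (a, \<tau>) = 0"
  unfolding multideg_op_apply
proof (rule sum.neutral, rule ballI)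
  fix v assume "v \<in> \<tau>"
  then have "card (keys a - (\<tau> - {v})) \<noteq> i"
    using card_cell_remove(2)[OF c(1)] c(2) by simp
  then show "koszul_sign V (keys a - \<tau>) v * koszul_coeffs \<Delta> k i x (a, \<tau> - {v}) = 0"
    by (simp add: koszul_coeffs_def)
qed

lemma boundary_koszul_degree:
  assumes fin: "finite V" and x: "x \<in> koszul_degree V (Suc i) k"
  shows "boundary (koszul V) (Suc i) x \<in> koszul_degree V i k"
proof (rule koszul_degreeI)
  fix C m assume m: "m \<in> keys (boundary (koszul V) (Suc i) x C)"
  have C: "C \<subseteq> V" "card C = i"
    using m koszul_boundary_notin[of C V i x] by (metis empty_iff keys_zero)+
  have "\<exists>v\<in>V - C. v \<in> keys m \<and> lookup (x (insert v C)) (m - Poly_Mapping.single v 1) \<noteq> 0"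
  proof (rule ccontr)
    assume "\<not> ?thesis"
    then have "lookup (boundary (koszul V) (Suc i) x C) m = 0"
      unfolding lookup_koszul_boundary[OF fin C] by (intro sum.neutral) auto
    then show False using m by (simp add: in_keys_iff)
  qed
  then obtain v where v: "v \<in> V" "v \<in> keys m"
    and "m - Poly_Mapping.single v 1 \<in> keys (x (insert v C))"
    by (auto simp: in_keys_iff)
  note D = koszul_degreeD[OF x this(3)]
  have sub: "{v} \<subseteq> keys m" using v by simp
  have mv: "mon {v} = Poly_Mapping.single v 1" by (simp add: mon_def)
  have e: "m = (m - mon {v}) + mon {v}" by (rule minus_mon_add_mon[OF sub, symmetric])
  have "mdeg m = mdeg (m - mon {v}) + 1" using mdeg_minus_mon[OF sub] by simp
  moreover have "keys m = keys (m - mon {v}) \<union> {v}"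
    by (subst e) (simp add: keys_add_nat keys_mon)
  ultimately show "C \<subseteq> V \<and> card C = i \<and> mdeg m + i = k \<and> keys m \<subseteq> V"
    using D C v unfolding mv by simp
qed

text \<open>An exterior part in degree \<open>k\<close> has at most \<open>k\<close> elements, so
  together with \<open>i \<le> k\<close> truncated subtraction from \<open>k\<close> loses no
  information.\<close>

lemma multideg_levels:
  assumes "i \<le> k"
  shows "{c \<in> multideg_cells \<Delta> k. (case c of (a, \<sigma>) \<Rightarrow> multideg_grade k a \<sigma>) = k - i} =
      {(a, \<sigma>) \<in> multideg_cells \<Delta> k. card (keys a - \<sigma>) = i}"
    and "{c \<in> multideg_cells \<Delta> k. Suc (case c of (a, \<sigma>) \<Rightarrow> multideg_grade k a \<sigma>) = k - i} =
      {(a, \<sigma>) \<in> multideg_cells \<Delta> k. card (keys a - \<sigma>) = Suc i}"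
proof -
  have "k - card (keys a - \<sigma>) = k - i \<longleftrightarrow> card (keys a - \<sigma>) = i"
    "Suc (k - card (keys a - \<sigma>)) = k - i \<longleftrightarrow> card (keys a - \<sigma>) = Suc i"
    if "(a, \<sigma>) \<in> multideg_cells \<Delta> k" for a \<sigma>
    using card_keys_diff_le[OF multideg_cellsD(2)[OF that], of \<sigma>] assms by arith+
  then show "{c \<in> multideg_cells \<Delta> k. (case c of (a, \<sigma>) \<Rightarrow> multideg_grade k a \<sigma>) = k - i} =
      {(a, \<sigma>) \<in> multideg_cells \<Delta> k. card (keys a - \<sigma>) = i}"
    and "{c \<in> multideg_cells \<Delta> k. Suc (case c of (a, \<sigma>) \<Rightarrow> multideg_grade k a \<sigma>) = k - i} =
      {(a, \<sigma>) \<in> multideg_cells \<Delta> k. card (keys a - \<sigma>) = Suc i}"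
    by (auto simp: multideg_grade_def)
qed

lemma koszul_coeffs_supported:
  "koszul_coeffs \<Delta> k i x \<in> supported {(a, \<sigma>) \<in> multideg_cells \<Delta> k. card (keys a - \<sigma>) = i}"
  by (auto simp: koszul_coeffs_def supported_def)

lemma koszul_lift:
  assumes fin: "finite (\<Union>\<Delta>)" and ij: "i + j = k"
    and f: "f \<in> supported {(a, \<sigma>) \<in> multideg_cells \<Delta> k. card (keys a - \<sigma>) = i}"
  shows "koszul_lift (\<Union>\<Delta>) i j f \<in> koszul_degree (\<Union>\<Delta>) i k"
    and "koszul_coeffs \<Delta> k i (koszul_lift (\<Union>\<Delta>) i j f) = f"
proof -
  let ?V = "\<Union>\<Delta>"
  have l: "lookup (koszul_lift ?V i j f A) m = (if A \<subseteq> ?V \<and> card A = i \<and> m \<in> monomials ?V j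
    then f (m + mon A, keys m - A) else 0)" for A m
    using finite_monomials[OF fin, of j]
    by (auto simp: koszul_lift_def lookup_sum lookup_single when_def sum.delta')
  show "koszul_lift ?V i j f \<in> koszul_degree ?V i k"
    by (rule koszul_degreeI) (use ij in \<open>auto simp: in_keys_iff[of _ "koszul_lift _ _ _ _ _"] l monomials_def split: if_splits\<close>)
  show "koszul_coeffs \<Delta> k i (koszul_lift ?V i j f) = f"
  proof
    fix c :: "('a \<Rightarrow>\<^sub>0 nat) \<times> 'a set"
    obtain a \<sigma> where c: "c = (a, \<sigma>)" by force
    let ?A = "keys a - \<sigma>"
    show "koszul_coeffs \<Delta> k i (koszul_lift ?V i j f) c = f c"
    proof (cases "(a, \<sigma>) \<in> multideg_cells \<Delta> k \<and> card ?A = i")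
      case True
      note D = multideg_cellsD[of a \<sigma> \<Delta> k]
      have A: "?A \<subseteq> keys a" by auto
      have "mdeg (a - mon ?A) = j" using mdeg_minus_mon[OF A] D(2) True ij by auto
      moreover have "keys (a - mon ?A) \<subseteq> ?V" using keys_minus_mon(1)[OF A] D(1) True by auto
      ultimately have m: "a - mon ?A \<in> monomials ?V j" by (simp add: monomials_def)
      have "keys (a - mon ?A) - ?A = \<sigma>"
        using keys_minus_mon[OF A] D(3) True by auto
      moreover have "?A \<subseteq> ?V" using D(1) True by auto
      ultimately show ?thesis
        using True m minus_mon_add_mon[OF A] by (simp add: c koszul_coeffs_def l)
    next
      case False
      then show ?thesis using f by (auto simp: c koszul_coeffs_def supported_def)
    qed
  qed
qed

lemma SR_ideal_0: "0 \<in> SR_ideal \<Delta>"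
  unfolding SR_ideal_def by (rule CollectI, rule exI[of _ "\<lambda>_. 0"]) simp

lemma mem_SR_idealI:
  assumes "finite (\<Union>\<Delta>)" "down_closed \<Delta>" "x \<in> koszul_degree (\<Union>\<Delta>) i k"
    and "\<And>m. keys m \<in> \<Delta> \<Longrightarrow> A \<subseteq> \<Union>\<Delta> \<Longrightarrow> card A = i \<Longrightarrow> mdeg m + i = k \<Longrightarrow>
      lookup (x A) m = 0"
  shows "x A \<in> SR_ideal \<Delta>"
  unfolding SR_ideal_iff[OF assms(1,2) koszul_degree_polys[OF assms(3)]]
proof (intro ballI notI)
  fix m assume m: "m \<in> keys (x A)" and f: "keys m \<in> \<Delta>"
  have "lookup (x A) m = 0"
    by (rule assms(4)[OF f koszul_degreeD(1-3)[OF assms(3) m]])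
  then show False using m by (simp add: in_keys_iff)
qed

lemma SR_ideal_lookup:
  assumes "finite (\<Union>\<Delta>)" "down_closed \<Delta>" "p \<in> polys (\<Union>\<Delta>)" "p \<in> SR_ideal \<Delta>" "keys m \<in> \<Delta>"
  shows "lookup p m = 0"
  using SR_ideal_iff[OF assms(1-3)] assms(4,5) by (auto simp: in_keys_iff)

abbreviation cell_grade :: "nat \<Rightarrow> ('v \<Rightarrow>\<^sub>0 nat) \<times> 'v set \<Rightarrow> nat" where
  "cell_grade k \<equiv> (\<lambda>(a, \<sigma>). multideg_grade k a \<sigma>)"

lemma koszul_cycle_iff:
  fixes x :: "'v set \<Rightarrow> ('v, 'a::field) mpoly"
  assumes fin: "finite (\<Union>\<Delta>)" and dc: "down_closed \<Delta>" and ik: "i \<le> k"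
    and x: "x \<in> koszul_degree (\<Union>\<Delta>) i k"
  shows "(\<forall>C. boundary (koszul (\<Union>\<Delta>)) i x C \<in> SR_ideal \<Delta>) \<longleftrightarrow>
    koszul_coeffs \<Delta> k i x \<in> cocycles (multideg_op (\<Union>\<Delta>)) (cell_grade k) (multideg_cells \<Delta> k) (k - i)"
proof (cases i)
  case 0
  \<comment> \<open>In homological degree 0 every chain is a cycle; correspondingly, every
    coboundary of cells with empty exterior part is zero, since a removal step would leave an
    exterior part of size -1.\<close>
  have "multideg_op (\<Union>\<Delta>) (koszul_coeffs \<Delta> k i x) c = 0" if "c \<in> multideg_cells \<Delta> k" for c
    using that 0 by (cases c) (auto intro!: multideg_op_coeffs_0)
  then show ?thesis
    using 0 koszul_coeffs_supported[of \<Delta> k i x] multideg_levels(1)[OF ik, of \<Delta>]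
    by (simp add: cocycles_def SR_ideal_0)
next
  case (Suc i')
  let ?V = "\<Union>\<Delta>"
  have deg: "boundary (koszul ?V) (Suc i') x \<in> koszul_degree ?V i' k"
    using boundary_koszul_degree[OF fin] x Suc by blast
  have "(\<forall>C. boundary (koszul ?V) (Suc i') x C \<in> SR_ideal \<Delta>) \<longleftrightarrow>
    (\<forall>c\<in>multideg_cells \<Delta> k. multideg_op ?V (koszul_coeffs \<Delta> k (Suc i') x) c = 0)"
  proof
    assume I: "\<forall>C. boundary (koszul ?V) (Suc i') x C \<in> SR_ideal \<Delta>"
    show "\<forall>c\<in>multideg_cells \<Delta> k. multideg_op ?V (koszul_coeffs \<Delta> k (Suc i') x) c = 0"
    proof
      fix c assume c: "c \<in> multideg_cells \<Delta> k"
      obtain a \<tau> where at: "c = (a, \<tau>)" by force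
      show "multideg_op ?V (koszul_coeffs \<Delta> k (Suc i') x) c = 0"
      proof (cases "card (keys a - \<tau>) = i'")
        case True
        then show ?thesis
          using multideg_op_coeffs[OF fin dc, of a \<tau> k i' x] c at
            SR_ideal_lookup[OF fin dc koszul_degree_polys[OF deg]] I multideg_cellsD(4)[of a \<tau> \<Delta> k]
          by (simp del: boundary.simps)
      next
        case False
        then show ?thesis using multideg_op_coeffs_0[of a \<tau> \<Delta> k "Suc i'"] c at by simp
      qed
    qed
  next
    assume Z: "\<forall>c\<in>multideg_cells \<Delta> k. multideg_op ?V (koszul_coeffs \<Delta> k (Suc i') x) c = 0"
    show "\<forall>C. boundary (koszul ?V) (Suc i') x C \<in> SR_ideal \<Delta>"
    proof
      fix C show "boundary (koszul ?V) (Suc i') x C \<in> SR_ideal \<Delta>"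
      proof (rule mem_SR_idealI[OF fin dc deg])
        fix m assume m: "keys m \<in> \<Delta>" and C: "C \<subseteq> ?V" "card C = i'" and km: "mdeg m + i' = k"
        have "mdeg m + card C = k" using km C by simp
        note c = cell_of_term[OF fin C(1) m this]
        show "lookup (boundary (koszul ?V) (Suc i') x C) m = 0"
          using multideg_op_coeffs[OF fin dc c(1), of i' x] Z c C(2) by (simp add: add_mon_minus_mon del: boundary.simps)
      qed
    qed
  qed
  then show ?thesis
    using Suc koszul_coeffs_supported[of \<Delta> k i x] multideg_levels(1)[OF ik, of \<Delta>]
    by (simp add: cocycles_def del: boundary.simps)
qed

text \<open>The chain \<open>y\<close> is not assumed homogeneous, but \<open>koszul_coeffs\<close>
  reads only its coefficients in internal degree \<open>k\<close>. In the other direction a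
  primitive among the cochains is lifted to a homogeneous chain.\<close>

lemma koszul_boundary_iff:
  fixes x :: "'v set \<Rightarrow> ('v, 'a::field) mpoly"
  assumes fin: "finite (\<Union>\<Delta>)" and dc: "down_closed \<Delta>" and ik: "i \<le> k"
    and x: "x \<in> koszul_degree (\<Union>\<Delta>) i k"
  shows "(\<exists>y\<in>free_mod (\<Union>\<Delta>) (basis (koszul (\<Union>\<Delta>) :: ('v set, 'v, 'a) free_complex) (Suc i)).
      \<forall>C. x C - boundary (koszul (\<Union>\<Delta>)) (Suc i) y C \<in> SR_ideal \<Delta>) \<longleftrightarrow>
    koszul_coeffs \<Delta> k i x \<in> coboundaries (multideg_op (\<Union>\<Delta>)) (cell_grade k) (multideg_cells \<Delta> k) (k - i)"
    (is "?L \<longleftrightarrow> ?R")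
proof
  let ?V = "\<Union>\<Delta>"
  assume ?L
  then obtain y where y: "y \<in> free_mod ?V {A. A \<subseteq> ?V \<and> card A = Suc i}"
    and I: "\<And>C. x C - boundary (koszul ?V) (Suc i) y C \<in> SR_ideal \<Delta>"
    by (auto simp del: boundary.simps)
  have fm: "boundary (koszul ?V) (Suc i) y \<in> free_mod ?V {A. A \<subseteq> ?V \<and> card A = i}"
    by (rule koszul_boundary_free_mod[OF fin y])
  have bpol: "boundary (koszul ?V) (Suc i) y C \<in> polys ?V" for C
    using fm by (cases "C \<subseteq> ?V \<and> card C = i") (auto simp: free_mod_def simp del: boundary.simps)
  have neg: "- p \<in> polys ?V" if "p \<in> polys ?V" for p :: "('v, 'a) mpoly"
    using that by (simp add: polys_def)
  have pol: "x C - boundary (koszul ?V) (Suc i) y C \<in> polys ?V" for C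
    using polys_add[OF koszul_degree_polys[OF x, of C] neg[OF bpol[of C]]] by (simp del: boundary.simps)
  have "koszul_coeffs \<Delta> k i x c =
      restrict_fun (multideg_cells \<Delta> k) (multideg_op ?V (koszul_coeffs \<Delta> k (Suc i) y)) c" for c
  proof -
    obtain a \<sigma> where c: "c = (a, \<sigma>)" by force
    let ?A = "keys a - \<sigma>"
    consider "c \<notin> multideg_cells \<Delta> k" | "c \<in> multideg_cells \<Delta> k" "card ?A = i"
      | "c \<in> multideg_cells \<Delta> k" "card ?A \<noteq> i" by blast
    then show ?thesis
    proof cases
      case 1
      then show ?thesis by (simp add: c koszul_coeffs_def restrict_fun_apply)
    next
      case 2
      have "lookup (x ?A - boundary (koszul ?V) (Suc i) y ?A) (a - mon ?A) = 0"
        using SR_ideal_lookup[OF fin dc pol I] multideg_cellsD(4)[of a \<sigma> \<Delta> k] 2(1) c by blast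
      then show ?thesis
        using 2 multideg_op_coeffs[OF fin dc, of a \<sigma> k i y] c
        by (simp add: koszul_coeffs_def[of _ _ _ x] restrict_fun_apply lookup_minus del: boundary.simps)
    next
      case 3
      then show ?thesis using multideg_op_coeffs_0[of a \<sigma> \<Delta> k "Suc i" ?V y] c
        by (simp add: koszul_coeffs_def[of _ _ _ x] restrict_fun_apply)
    qed
  qed
  then have "koszul_coeffs \<Delta> k i x =
      restrict_fun (multideg_cells \<Delta> k) (multideg_op ?V (koszul_coeffs \<Delta> k (Suc i) y))" by (rule ext)
  then show ?R
    unfolding coboundaries_def multideg_levels(2)[OF ik] using koszul_coeffs_supported by blast
next
  let ?V = "\<Union>\<Delta>"
  assume ?R
  then obtain h where h: "h \<in> supported {(a, \<sigma>) \<in> multideg_cells \<Delta> k. card (keys a - \<sigma>) = Suc i}"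
    and e: "koszul_coeffs \<Delta> k i x = restrict_fun (multideg_cells \<Delta> k) (multideg_op ?V h)"
    unfolding coboundaries_def multideg_levels(2)[OF ik] by blast
  obtain y where y: "y \<in> koszul_degree ?V (Suc i) k" "koszul_coeffs \<Delta> k (Suc i) y = h"
  proof (cases "Suc i \<le> k")
    case True
    then have "Suc i + (k - Suc i) = k" by simp
    then show ?thesis using koszul_lift[OF fin _ h] that by blast
  next
    case False
    \<comment> \<open>Here \<open>i = k\<close>, and no cell of degree \<open>k\<close> has an
      exterior part of size \<open>k + 1\<close>. The primitive is then zero and lifts to
      zero.\<close>
    have "{(a, \<sigma>) \<in> multideg_cells \<Delta> k. card (keys a - \<sigma>) = Suc i} = {}"
    proof -
      have "card (keys a - \<sigma>) \<noteq> Suc i" if "(a, \<sigma>) \<in> multideg_cells \<Delta> k" for a \<sigma>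
        using False card_keys_diff_le[OF multideg_cellsD(2)[OF that], of \<sigma>] by simp
      then show ?thesis by blast
    qed
    then have "h = 0" using h by (auto simp: supported_def)
    moreover have "koszul_coeffs \<Delta> k (Suc i) 0 = (0 :: _ \<Rightarrow> 'a)" by (auto simp: koszul_coeffs_def fun_eq_iff)
    moreover have "0 \<in> koszul_degree ?V (Suc i) k" by (rule koszul_degreeI) simp
    ultimately show ?thesis using that by metis
  qed
  have bd: "boundary (koszul ?V) (Suc i) y \<in> koszul_degree ?V i k"
    by (rule boundary_koszul_degree[OF fin y(1)])
  let ?z = "\<lambda>C. x C - boundary (koszul ?V) (Suc i) y C"
  have z: "?z \<in> koszul_degree ?V i k"
  proof (rule koszul_degreeI)
    fix A m assume "m \<in> keys (x A - boundary (koszul ?V) (Suc i) y A)"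
    then have "m \<in> keys (x A) \<or> m \<in> keys (boundary (koszul ?V) (Suc i) y A)"
      using keys_diff[of "x A" "boundary (koszul ?V) (Suc i) y A"] by (auto simp del: boundary.simps)
    then show "A \<subseteq> ?V \<and> card A = i \<and> mdeg m + i = k \<and> keys m \<subseteq> ?V"
      using koszul_degreeD[OF x, of m A] koszul_degreeD[OF bd, of m A] by blast
  qed
  have "?z C \<in> SR_ideal \<Delta>" for C
  proof (rule mem_SR_idealI[OF fin dc z])
    fix m assume m: "keys m \<in> \<Delta>" and C: "C \<subseteq> ?V" "card C = i" and km: "mdeg m + i = k"
    have km': "mdeg m + card C = k" using km C by simp
    note c = cell_of_term[OF fin C(1) m km']
    have "lookup (x C) m = multideg_op ?V h (m + mon C, keys m - C)"
      using koszul_coeffs_cell[OF fin C(1) m km' C(2), of x] c(1) unfolding e by (simp add: restrict_fun_apply)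
    also have "\<dots> = lookup (boundary (koszul ?V) (Suc i) y C) m"
      using multideg_op_coeffs[OF fin dc c(1), of i y] c(2) C(2) y(2)
      by (simp add: add_mon_minus_mon del: boundary.simps)
    finally show "lookup (?z C) m = 0" by (simp add: lookup_minus del: boundary.simps)
  qed
  moreover have "y \<in> free_mod ?V {A. A \<subseteq> ?V \<and> card A = Suc i}"
    using y(1) by (simp add: koszul_degree_def)
  ultimately show ?L by (auto simp del: boundary.simps)
qed

interpretation mpoly_space: vector_space "scale :: 'a::field \<Rightarrow> ('b \<Rightarrow> ('v, 'a) mpoly) \<Rightarrow> 'b \<Rightarrow> ('v, 'a) mpoly"
  by (rule vector_space_scale)

interpretation mpoly_fun_pair: vector_space_pair
  "scale :: 'a::field \<Rightarrow> ('b \<Rightarrow> ('v, 'a) mpoly) \<Rightarrow> 'b \<Rightarrow> ('v, 'a) mpoly"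
  "fscale :: 'a \<Rightarrow> ('d \<Rightarrow> 'a) \<Rightarrow> 'd \<Rightarrow> 'a"
  by unfold_locales

text \<open>Provides the finite spanning set that the dimension count needs: single monomials placed
  on single exterior generators.\<close>

lemma koszul_degree_in_span:
  assumes fin: "finite V"
  shows "\<exists>G. finite G \<and> (koszul_degree V i k :: ('v set \<Rightarrow> ('v, 'a::field) mpoly) set) \<subseteq> mpoly_space.span G"
proof -
  define e where "e = (\<lambda>(A :: 'v set, m) B. if B = A then Poly_Mapping.single m 1 else 0 :: ('v, 'a) mpoly)"
  let ?S = "Pow V \<times> monomials V (k - i)"
  have finS: "finite ?S" using fin finite_monomials by blast
  have "x \<in> mpoly_space.span (e ` ?S)" if x: "x \<in> koszul_degree V i k" for x :: "'v set \<Rightarrow> ('v, 'a) mpoly"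
  proof -
    let ?y = "\<Sum>p\<in>?S. scale (lookup (x (fst p)) (snd p)) (e p)"
    have sum_ap: "(\<Sum>p\<in>T. f p) B = (\<Sum>p\<in>T. f p B)" for T B and f :: "'v set \<times> ('v \<Rightarrow>\<^sub>0 nat) \<Rightarrow> 'v set \<Rightarrow> ('v, 'a) mpoly"
      by (induction T rule: infinite_finite_induct) simp_all
    have "x = ?y"
    proof (rule ext, rule poly_mapping_eqI)
      fix B m
      have "lookup (?y B) m =
        (\<Sum>p\<in>?S. if p = (B, m) then lookup (x B) m else 0)"
        unfolding sum_ap lookup_sum
        by (rule sum.cong[OF refl]) (auto simp: scale_def e_def lookup_Const_times lookup_single when_def split: if_splits)
      also have "\<dots> = (if (B, m) \<in> ?S then lookup (x B) m else 0)"
        using finS by (simp only: sum.delta' sum.delta)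
      also have "\<dots> = lookup (x B) m"
      proof (cases "m \<in> keys (x B)")
        case True
        then show ?thesis using koszul_degreeD[OF x True] by (auto simp: monomials_def)
      qed (auto simp: in_keys_iff)
      finally show "lookup (x B) m = lookup (?y B) m" by simp
    qed
    also have "?y \<in> mpoly_space.span (e ` ?S)"
      by (intro mpoly_space.span_sum mpoly_space.span_scale mpoly_space.span_base imageI)
    finally show ?thesis .
  qed
  then show ?thesis using finS by blast
qed

text \<open>On the degree \<open>k\<close> part of the Koszul module, taking coefficients is onto
  the cochains of degree \<open>k - i\<close>, and whatever it kills lies in the ideal and so
  already among the boundaries. Hence cycles modulo boundaries have the dimension of the cohomology
  of the cells. Degree \<open>k - i\<close> is reduced cohomology in dimension
  \<open>card W - i - 1\<close>, the usual form of the formula.\<close>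

theorem hochster_formula:
  fixes \<Delta> :: "'v set set"
  assumes fin: "finite (\<Union>\<Delta>)" and dc: "down_closed \<Delta>" and ik: "i \<le> k"
  shows "Tor_dim (\<Union>\<Delta>) (SR_ideal \<Delta> :: ('v, 'a::field) mpoly set) (koszul (\<Union>\<Delta>)) i (int k) =
    (\<Sum>W | W \<subseteq> \<Union>\<Delta> \<and> card W = k. face_hdim (hsign (\<Union>\<Delta>) W :: 'v set \<Rightarrow> 'v \<Rightarrow> 'a) (induced \<Delta> W) (k - i))"
proof -
  let ?V = "\<Union>\<Delta>" and ?I = "SR_ideal \<Delta> :: ('v, 'a) mpoly set"
  let ?H = "koszul_degree ?V i k :: ('v set \<Rightarrow> ('v, 'a) mpoly) set"
  let ?\<Phi> = "koszul_coeffs \<Delta> k i :: ('v set \<Rightarrow> ('v, 'a) mpoly) \<Rightarrow> _"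
  let ?op = "multideg_op ?V :: (('v \<Rightarrow>\<^sub>0 nat) \<times> 'v set \<Rightarrow> 'a) \<Rightarrow> _" and ?Q = "multideg_cells \<Delta> k"
  let ?Z = "cocycles ?op (cell_grade k) ?Q (k - i)" and ?B = "coboundaries ?op (cell_grade k) ?Q (k - i)"
  have H: "?H = free_mod ?V (basis (koszul ?V :: ('v set, 'v, 'a) free_complex) i)
      \<inter> homogeneous_part (shift (koszul ?V :: ('v set, 'v, 'a) free_complex) i) (int k)"
    by (simp add: koszul_degree_def) (simp add: koszul_def)
  have Z: "Tor_cycles ?V ?I (koszul ?V) i (int k) = {x \<in> ?H. ?\<Phi> x \<in> ?Z}"
    unfolding Tor_cycles_def H[symmetric] using koszul_cycle_iff[OF fin dc ik] by blast
  have B: "Tor_boundaries ?V ?I (koszul ?V) i (int k) = {x \<in> ?H. ?\<Phi> x \<in> ?B}"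
    unfolding Tor_boundaries_def H[symmetric] using koszul_boundary_iff[OF fin dc ik] by blast
  have cc: "cochain_complex ?op (cell_grade k) ?Q"
    unfolding multideg_op_def multideg_cells_def
    by (rule cochain_complex_sigma[OF finite_monomials[OF fin] flinear_coface multideg_family(4)[OF fin dc]])
  then have lin: "flinear ?op" by (simp add: cochain_complex_def)
  have BZ: "?B \<subseteq> ?Z" by (rule coboundaries_subset_cocycles[OF cc])
  have \<Phi>: "Vector_Spaces.linear scale fscale ?\<Phi>"
    by (simp add: Vector_Spaces.linear_iff mpoly_space.vector_space_axioms fun_space.vector_space_axioms)
      (auto simp: koszul_coeffs_def fun_eq_iff lookup_add scale_def lookup_Const_times)
  have Hsub: "mpoly_space.subspace ?H"
    unfolding mpoly_space.subspace_def
  proof (intro conjI allI ballI)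
    show "0 \<in> ?H" by (rule koszul_degreeI) simp
    fix x y assume x: "x \<in> ?H"
    show "scale c x \<in> ?H" for c
    proof (rule koszul_degreeI)
      fix A m assume "m \<in> keys (scale c x A)"
      then have "m \<in> keys (x A)" by (auto simp: in_keys_iff scale_def lookup_Const_times)
      then show "A \<subseteq> ?V \<and> card A = i \<and> mdeg m + i = k \<and> keys m \<subseteq> ?V"
        using koszul_degreeD[OF x, of m A] by blast
    qed
    assume y: "y \<in> ?H"
    show "x + y \<in> ?H"
    proof (rule koszul_degreeI)
      fix A m assume "m \<in> keys ((x + y) A)"
      then have "m \<in> keys (x A) \<or> m \<in> keys (y A)"
        using Poly_Mapping.keys_add[of "x A" "y A"] by auto
      then show "A \<subseteq> ?V \<and> card A = i \<and> mdeg m + i = k \<and> keys m \<subseteq> ?V"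
        using koszul_degreeD[OF x, of m A] koszul_degreeD[OF y, of m A] by blast
    qed
  qed
  have sub: "mpoly_space.subspace {x \<in> ?H. ?\<Phi> x \<in> S}" if "fun_space.subspace S" for S
    unfolding mpoly_space.subspace_def
  proof (intro conjI allI ballI)
    show "0 \<in> {x \<in> ?H. ?\<Phi> x \<in> S}"
      using mpoly_space.subspace_0[OF Hsub] fun_space.subspace_0[OF that]
      unfolding mem_Collect_eq mpoly_fun_pair.linear_0[OF \<Phi>] by (rule conjI)
    fix x y assume x: "x \<in> {x \<in> ?H. ?\<Phi> x \<in> S}"
    show "scale c x \<in> {x \<in> ?H. ?\<Phi> x \<in> S}" for c
      using mpoly_space.subspace_scale[OF Hsub, of x c] fun_space.subspace_scale[OF that, of "?\<Phi> x" c] x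
      unfolding mem_Collect_eq mpoly_fun_pair.linear_scale[OF \<Phi>] by blast
    assume y: "y \<in> {x \<in> ?H. ?\<Phi> x \<in> S}"
    show "x + y \<in> {x \<in> ?H. ?\<Phi> x \<in> S}"
      using mpoly_space.subspace_add[OF Hsub, of x y] fun_space.subspace_add[OF that, of "?\<Phi> x" "?\<Phi> y"] x y
      unfolding mem_Collect_eq mpoly_fun_pair.linear_add[OF \<Phi>] by blast
  qed
  have onto: "?\<Phi> ` {x \<in> ?H. ?\<Phi> x \<in> S} = S" if "S \<subseteq> ?Z" for S
  proof (intro equalityI subsetI)
    fix f assume f: "f \<in> S"
    then have "f \<in> supported {(a, \<sigma>) \<in> ?Q. card (keys a - \<sigma>) = i}"
      using that multideg_levels(1)[OF ik, of \<Delta>] by (auto simp: cocycles_def)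
    note l = koszul_lift[OF fin le_add_diff_inverse[OF ik] this]
    then show "f \<in> ?\<Phi> ` {x \<in> ?H. ?\<Phi> x \<in> S}" using f unfolding image_iff by (intro bexI[of _ "koszul_lift ?V i (k - i) f"]) auto
  qed blast
  obtain G where G: "finite G" "?H \<subseteq> mpoly_space.span G"
    using koszul_degree_in_span[OF fin] by blast
  have "Tor_dim ?V ?I (koszul ?V) i (int k) =
      fdim (?\<Phi> ` {x \<in> ?H. ?\<Phi> x \<in> ?Z}) - fdim (?\<Phi> ` {x \<in> ?H. ?\<Phi> x \<in> ?B})"
    unfolding Tor_dim_def Z B
  proof (rule mpoly_fun_pair.dim_diff_image[OF \<Phi> sub[OF subspace_cocycles[OF lin]] sub[OF subspace_coboundaries[OF lin]] _ _ _ G(1)])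
    show "{x \<in> ?H. ?\<Phi> x \<in> ?B} \<subseteq> {x \<in> ?H. ?\<Phi> x \<in> ?Z}" using BZ by blast
    show "{x \<in> ?H. ?\<Phi> x \<in> ?Z} \<subseteq> mpoly_space.span G" using G(2) by blast
    fix x assume "x \<in> {x \<in> ?H. ?\<Phi> x \<in> ?Z}" "?\<Phi> x = 0"
    then show "x \<in> {x \<in> ?H. ?\<Phi> x \<in> ?B}"
      using subspace_coboundaries[OF lin, of "cell_grade k" ?Q "k - i"] by (simp add: fun_space.subspace_def)
  qed
  also have "\<dots> = hdim ?op (cell_grade k) ?Q (k - i)"
    by (simp only: onto[OF subset_refl] onto[OF BZ] hdim_def)
  also have "\<dots> = (\<Sum>W | W \<subseteq> ?V \<and> card W = k. face_hdim (hsign ?V W :: 'v set \<Rightarrow> 'v \<Rightarrow> 'a) (induced \<Delta> W) (k - i))"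
    by (rule hdim_multideg_cells[OF fin dc])
  finally show ?thesis .
qed

text \<open>A term on an exterior generator of degree \<open>i\<close> cannot have internal degree
  below \<open>i\<close>.\<close>

lemma Tor_dim_below:
  fixes \<Delta> :: "'v set set"
  assumes "k < int i"
  shows "Tor_dim (\<Union>\<Delta>) (SR_ideal \<Delta> :: ('v, 'a::field) mpoly set) (koszul (\<Union>\<Delta>)) i k = 0"
proof -
  let ?V = "\<Union>\<Delta>" and ?I = "SR_ideal \<Delta> :: ('v, 'a) mpoly set"
  have "x A = 0" if "x \<in> homogeneous_part (shift (koszul ?V :: ('v set, 'v, 'a) free_complex) i) k" for x :: "'v set \<Rightarrow> ('v, 'a) mpoly" and A
  proof -
    have "m \<notin> keys (x A)" for m
      using that assms by (auto simp: homogeneous_part_def koszul_def)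
    then show ?thesis by (metis ex_in_conv keys_eq_empty)
  qed
  then have "Tor_cycles ?V ?I (koszul ?V) i k \<subseteq> {0}"
    by (auto simp: Tor_cycles_def fun_eq_iff simp del: boundary.simps)
  then have "Tor_cycles ?V ?I (koszul ?V) i k \<subseteq> mpoly_space.span {}" by simp
  then have "mpoly_space.dim (Tor_cycles ?V ?I (koszul ?V) i k) \<le> card ({} :: ('v set \<Rightarrow> ('v, 'a) mpoly) set)"
    by (intro mpoly_space.dim_le_card) auto
  then show ?thesis by (simp add: Tor_dim_def)
qed

theorem betti_hochster:
  fixes \<Delta> :: "'v set set"
  assumes fin: "finite (\<Union>\<Delta>)" and dc: "down_closed \<Delta>"
  shows "betti TYPE('a::field) \<Delta> i (i + j) = (if i < 0 \<or> j < 0 then 0 else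
    (\<Sum>W | W \<subseteq> \<Union>\<Delta> \<and> card W = nat i + nat j.
       face_hdim (hsign (\<Union>\<Delta>) W :: 'v set \<Rightarrow> 'v \<Rightarrow> 'a) (induced \<Delta> W) (nat j)))"
proof -
  consider "i < 0" | "i \<ge> 0" "j < 0" | "i \<ge> 0" "j \<ge> 0" by linarith
  then show ?thesis
  proof cases
    case 1 then show ?thesis by (simp add: betti_def)
  next
    case 2
    then show ?thesis
      using Tor_dim_below[of "i + j" "nat i" \<Delta>, where 'a = 'a] by (simp add: betti_def)
  next
    case 3
    then have "i + j = int (nat i + nat j)" by simp
    then show ?thesis
      using 3 hochster_formula[OF fin dc, of "nat i" "nat i + nat j", where 'a = 'a] by (simp add: betti_def)
  qed
qed

section \<open>Cross-polytopes\<close>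

text \<open>\<open>opp\<close> maps each vertex of \<open>T\<close> to its antipode; \<open>cap A T opp\<close> consists of the faces of the
  cross-polytope boundary \<open>cross A T opp\<close> that are not contained in \<open>A\<close>.\<close>

definition cap :: "'v set \<Rightarrow> 'v set \<Rightarrow> ('v \<Rightarrow> 'v) \<Rightarrow> 'v set set" where
  "cap A T opp = {\<sigma>. \<sigma> \<subseteq> A \<union> T \<and> \<sigma> \<inter> T \<noteq> {} \<and> \<sigma> \<inter> A \<inter> opp ` (\<sigma> \<inter> T) = {}}"

definition cross :: "'v set \<Rightarrow> 'v set \<Rightarrow> ('v \<Rightarrow> 'v) \<Rightarrow> 'v set set" where
  "cross A T opp = {\<sigma>. \<sigma> \<subseteq> A \<union> T \<and> \<sigma> \<inter> A \<inter> opp ` (\<sigma> \<inter> T) = {}}"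

lemma cross_eq: "A \<inter> T = {} \<Longrightarrow> cross A T opp = Pow A \<union> cap A T opp"
  by (auto simp: cross_def cap_def)

lemma down_closed_cross: "down_closed (cross A T opp)"
  unfolding down_closed_def cross_def by blast

text \<open>The base \<open>A\<close> and the opposite facet \<open>T\<close> play symmetric roles;
  this transports statements about \<open>T\<close> to \<open>A\<close>.\<close>

lemma cross_swap:
  assumes "bij_betw opp T A"
  shows "cross A T opp = cross T A (inv_into T opp)"
proof -
  have "\<sigma> \<inter> A \<inter> opp ` (\<sigma> \<inter> T) = {} \<longleftrightarrow> \<sigma> \<inter> T \<inter> inv_into T opp ` (\<sigma> \<inter> A) = {}" for \<sigma>
  proof -
    have "(\<exists>w\<in>\<sigma> \<inter> T. opp w \<in> \<sigma> \<inter> A) \<longleftrightarrow> (\<exists>a\<in>\<sigma> \<inter> A. inv_into T opp a \<in> \<sigma> \<inter> T)"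
      using assms bij_betw_inv_into_left[OF assms] bij_betw_inv_into_right[OF assms]
      by (metis IntE IntI)
    then show ?thesis by blast
  qed
  then show ?thesis by (auto simp: cross_def Un_commute)
qed

lemma cross_extend:
  assumes fin: "finite A" and AT: "A \<inter> T = {}" and opp: "bij_betw opp T A" and s: "\<sigma> \<in> cross A T opp"
  obtains \<tau> where "\<tau> \<in> cross A T opp" "\<sigma> \<subseteq> \<tau>" "card \<tau> = card A" "finite \<tau>"
proof
  let ?B = "\<sigma> \<inter> T"
  \<comment> \<open>The new vertices of the face are kept, and all base vertices not antipodal to
    one of them are added.\<close>
  let ?\<tau> = "?B \<union> (A - opp ` ?B)"
  have fB: "finite ?B" using bij_betw_finite[OF opp] fin by simp
  have im: "opp ` ?B \<subseteq> A" using opp by (auto simp: bij_betw_def)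
  have "inj_on opp ?B" using opp by (auto simp: bij_betw_def intro: inj_on_subset)
  then have "card (opp ` ?B) = card ?B" by (rule card_image)
  then show "card ?\<tau> = card A"
    using card_Diff_subset[OF finite_subset[OF im fin] im] card_mono[OF fin im] fB fin AT
    by (subst card_Un_disjoint) auto
  have "?\<tau> \<inter> T = ?B" using AT by auto
  then show "?\<tau> \<in> cross A T opp" using AT by (auto simp: cross_def)
  show "\<sigma> \<subseteq> ?\<tau>" using s by (auto simp: cross_def)
  show "finite ?\<tau>" using fB fin by simp
qed

lemma null_faceE:
  assumes "null_face t X \<sigma>"
  obtains h where "\<And>c. Suc (card c) \<noteq> card \<sigma> \<Longrightarrow> h c = 0" "\<And>\<tau>. \<tau> \<in> X \<Longrightarrow> coface t h \<tau> = unit_fun \<sigma> \<tau>"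
proof -
  obtain h where h: "h \<in> supported {c \<in> X. Suc (card c) = card \<sigma>}" "unit_fun \<sigma> = restrict_fun X (coface t h)"
    using assms by (auto simp: null_face_def coboundaries_def)
  show ?thesis
  proof (rule that)
    show "h c = 0" if "Suc (card c) \<noteq> card \<sigma>" for c using h(1) that by (auto simp: supported_def)
    show "coface t h \<tau> = unit_fun \<sigma> \<tau>" if "\<tau> \<in> X" for \<tau>
      using fun_cong[OF h(2), of \<tau>] that by (simp add: restrict_fun_apply)
  qed
qed

text \<open>The primitive may be nonzero outside \<open>X\<close>: on a down-closed family, cutting
  it off leaves its coboundary unchanged.\<close>

lemma null_faceI:
  assumes X: "down_closed X" "\<sigma> \<in> X" and h: "\<And>c. Suc (card c) \<noteq> card \<sigma> \<Longrightarrow> h c = 0"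
    and e: "\<And>\<tau>. \<tau> \<in> X \<Longrightarrow> coface t h \<tau> = unit_fun \<sigma> \<tau>"
  shows "null_face t X \<sigma>"
proof -
  have "unit_fun \<sigma> = restrict_fun X (coface t (restrict_fun X h))"
    using X(2) by (intro ext) (auto simp: restrict_fun_apply restrict_coface[OF X(1)] e unit_fun_def)
  moreover have "restrict_fun X h \<in> supported {c \<in> X. Suc (card c) = card \<sigma>}"
    using h by (auto simp: supported_def restrict_fun_def)
  ultimately show ?thesis unfolding null_face_def coboundaries_def by blast
qed

text \<open>\<open>Y\<close> models the old part of an induced subcomplex, possibly with the gluing
  facet already deleted. \<open>A\<close> models the vertices of that facet that are present, and
  \<open>T\<close> the new vertices that are present.\<close>

locale capped_complex =
  fixes W T A :: "'v set" and t :: "'v set \<Rightarrow> 'v \<Rightarrow> 'a::field" and Y :: "'v set set" and opp :: "'v \<Rightarrow> 'v"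
  assumes cx: "is_complex_on (W \<union> T) t (Y \<union> cap A T opp)"
    and Y: "Y \<subseteq> Pow W" and A: "A \<subseteq> W" and WT: "W \<inter> T = {}"
begin

lemma Y_eq: "{\<sigma> \<in> Y \<union> cap A T opp. \<sigma> \<inter> T = {}} = Y"
  using Y WT by (auto simp: cap_def)

lemma fin: "finite W" "finite T" "finite A"
  using is_complex_onD(1)[OF cx] A finite_subset by auto

lemma in_cap: "\<sigma> \<in> Y \<union> cap A T opp \<Longrightarrow> \<sigma> \<inter> T \<noteq> {} \<Longrightarrow> \<sigma> \<in> cap A T opp"
  using Y WT by blast

text \<open>The vertex \<open>x\<close> is compatible with every set of new vertices, so it is a
  cone point for all fibres over nonempty subsets of \<open>T\<close>.\<close>

lemma hdim_unpaired_old: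
  assumes x: "x \<in> A" "x \<notin> opp ` T"
  shows "face_hdim t (Y \<union> cap A T opp) j = face_hdim t Y j"
proof -
  have "face_hdim t (Y \<union> cap A T opp) j = face_hdim t {\<sigma> \<in> Y \<union> cap A T opp. \<sigma> \<inter> T = {}} j"
  proof (rule hdim_fibres[OF cx, where p = "\<lambda>_. x"])
    fix \<sigma> assume "\<sigma> \<in> Y \<union> cap A T opp" "\<sigma> \<inter> T \<noteq> {}"
    then have s: "\<sigma> \<in> cap A T opp" by (rule in_cap)
    have "x \<notin> T" using x A WT by blast
    then show "x \<notin> T \<and> insert x \<sigma> \<in> Y \<union> cap A T opp"
      using s x by (auto simp: cap_def)
  qed
  then show ?thesis by (simp only: Y_eq)
qed

text \<open>The vertex \<open>w\<close> is joined to every face of the cap, so the fibres over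
  nonempty subsets of \<open>T - {w}\<close> collapse. What survives of the cap is the cone with
  apex \<open>w\<close> over the simplex on \<open>A\<close>, without its base.\<close>

lemma hdim_unpaired_new_aux:
  assumes w: "w \<in> T" "opp w \<notin> A"
  shows "face_hdim t (Y \<union> cap A T opp) j = face_hdim t (Y \<union> insert w ` Pow A) j"
    and "is_complex_on (W \<union> T) t (Y \<union> insert w ` Pow A)"
proof -
  let ?X = "Y \<union> cap A T opp"
  have wA: "w \<notin> A" "w \<notin> W" using w A WT by auto
  have eq: "{\<sigma> \<in> ?X. \<sigma> \<inter> (T - {w}) = {}} = Y \<union> insert w ` Pow A"
  proof (intro equalityI subsetI)
    fix \<sigma> assume s: "\<sigma> \<in> {\<sigma> \<in> ?X. \<sigma> \<inter> (T - {w}) = {}}"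
    show "\<sigma> \<in> Y \<union> insert w ` Pow A"
    proof (cases "\<sigma> \<inter> T = {}")
      case True
      then show ?thesis using s Y_eq by blast
    next
      case False
      then have c: "\<sigma> \<in> cap A T opp" using s in_cap by blast
      have "\<sigma> = insert w (\<sigma> \<inter> A)" using s c False by (auto simp: cap_def)
      then show ?thesis by blast
    qed
  next
    fix \<sigma> assume "\<sigma> \<in> Y \<union> insert w ` Pow A"
    then show "\<sigma> \<in> {\<sigma> \<in> ?X. \<sigma> \<inter> (T - {w}) = {}}"
    proof
      assume "\<sigma> \<in> Y" then show ?thesis using Y WT by auto
    next
      assume "\<sigma> \<in> insert w ` Pow A"
      then obtain B where B: "\<sigma> = insert w B" "B \<subseteq> A" by blast
      have "B \<inter> T = {}" using B A WT by blast
      then have "\<sigma> \<inter> T = {w}" using B w by auto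
      then show ?thesis using B w wA by (auto simp: cap_def)
    qed
  qed
  have "face_hdim t ?X j = face_hdim t {\<sigma> \<in> ?X. \<sigma> \<inter> (T - {w}) = {}} j"
  proof (rule hdim_fibres[OF cx, where p = "\<lambda>_. w"])
    fix \<sigma> assume s: "\<sigma> \<in> ?X" "\<sigma> \<inter> (T - {w}) \<noteq> {}"
    then have c: "\<sigma> \<in> cap A T opp" using in_cap by blast
    then have "insert w \<sigma> \<in> cap A T opp"
      using w wA by (auto simp: cap_def)
    then show "w \<notin> T - {w} \<and> insert w \<sigma> \<in> ?X" by simp
  qed
  then show "face_hdim t ?X j = face_hdim t (Y \<union> insert w ` Pow A) j" by (simp only: eq)
  have "down_closed {\<sigma> \<in> ?X. \<sigma> \<inter> (T - {w}) = {}}"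
    using is_complex_onD(4)[OF cx] unfolding down_closed_def by blast
  then show "is_complex_on (W \<union> T) t (Y \<union> insert w ` Pow A)"
    unfolding eq[symmetric] by (intro is_complex_on_subset[OF cx]) auto
qed

text \<open>The surviving faces all contain \<open>w\<close>, and any vertex of \<open>A\<close> can
  be toggled in them.\<close>

lemma hdim_unpaired_new:
  assumes w: "w \<in> T" "opp w \<notin> A" and "A \<noteq> {}"
  shows "face_hdim t (Y \<union> cap A T opp) j = face_hdim t Y j"
proof -
  obtain a where a: "a \<in> A" using assms by blast
  note aux = hdim_unpaired_new_aux[OF w]
  let ?X = "Y \<union> insert w ` Pow A"
  have "w \<notin> W" using w WT by blast
  have "face_hdim t ?X j = face_hdim t {\<sigma> \<in> ?X. \<sigma> \<inter> {w} = {}} j"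
  proof (rule hdim_fibres[OF aux(2), where p = "\<lambda>_. a"])
    fix \<sigma> assume "\<sigma> \<in> ?X" "\<sigma> \<inter> {w} \<noteq> {}"
    then have "\<sigma> \<in> insert w ` Pow A" using Y \<open>w \<notin> W\<close> by blast
    then have "insert a \<sigma> \<in> insert w ` Pow A" using a by (auto simp: image_iff)
    then show "a \<notin> {w} \<and> insert a \<sigma> \<in> ?X" using a A \<open>w \<notin> W\<close> by auto
  qed
  also have "{\<sigma> \<in> ?X. \<sigma> \<inter> {w} = {}} = Y" using Y \<open>w \<notin> W\<close> by auto
  finally show ?thesis using aux(1) by simp
qed

text \<open>With \<open>A\<close> empty the cap shrinks to the isolated point \<open>w\<close>. Its
  indicator is not a coboundary: a primitive is a value at the empty face, which the old vertex
  \<open>u\<close> forces to be 0 and \<open>w\<close> forces to be nonzero.\<close>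

lemma hdim_isolated_new:
  assumes w: "w \<in> T" "opp w \<notin> A" and "A = {}" and u: "{u} \<in> Y"
  shows "face_hdim t (Y \<union> cap A T opp) j = face_hdim t Y j + (if j = 1 then 1 else 0)"
proof -
  note aux = hdim_unpaired_new_aux[OF w]
  have wW: "w \<notin> W" using w WT by blast
  have X: "Y \<union> insert w ` Pow A = insert {w} Y" using assms(3) by auto
  have uw: "u \<noteq> w" using u Y wW by auto
  have "\<not> null_face t (insert {w} Y) {w}"
  proof
    assume "null_face t (insert {w} Y) {w}"
    then obtain h where h: "\<And>\<tau>. \<tau> \<in> insert {w} Y \<Longrightarrow> coface t h \<tau> = unit_fun {w} \<tau>"
      using null_faceE by blast
    have "t {u} u * h {} = 0" "t {w} w * h {} = 1"
      using h[of "{u}"] h[of "{w}"] u uw by (simp_all add: coface_def unit_fun_def)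
    moreover have "t {u} u * t {u} u = 1"
      using incidence_square[OF is_complex_onD(2)[OF cx], of "{u}" u] u Y by auto
    ultimately show False by auto
  qed
  moreover have "insert {w} Y - {{w}} = Y" using Y wW by auto
  moreover have "\<tau> = {w}" if "\<tau> \<in> insert {w} Y" "{w} \<subseteq> \<tau>" for \<tau> using that Y wW by auto
  ultimately have "int (face_hdim t (insert {w} Y) j) = int (face_hdim t Y j) + (if j = 1 then 1 else 0)"
    using hdim_remove_facet[OF aux(2)[unfolded X], of "{w}" j] by simp
  then show ?thesis using aux(1)[unfolded X] by (simp split: if_splits)
qed

context
  assumes opp: "bij_betw opp T A" and Ane: "A \<noteq> {}"
begin

lemma antipode_facet:
  shows "T \<in> Y \<union> cap A T opp" "T \<noteq> {}" "T \<notin> Y" "\<And>\<tau>. \<tau> \<in> Y \<union> cap A T opp \<Longrightarrow> T \<subseteq> \<tau> \<Longrightarrow> \<tau> = T"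
proof -
  have img: "opp ` T = A" using opp by (simp add: bij_betw_def)
  show T: "T \<noteq> {}" using img Ane by auto
  show "T \<in> Y \<union> cap A T opp" using T A WT by (auto simp: cap_def)
  show "T \<notin> Y" using Y T WT by auto
  fix \<tau> assume t: "\<tau> \<in> Y \<union> cap A T opp" "T \<subseteq> \<tau>"
  then have "\<tau> \<in> cap A T opp" using T by (intro in_cap) auto
  moreover have "\<tau> \<inter> T = T" using t by blast
  ultimately show "\<tau> = T" using img by (auto simp: cap_def)
qed

text \<open>Over a proper nonempty subset \<open>B\<close> of \<open>T\<close> some base vertex has
  its antipode outside \<open>B\<close>, and it serves as cone point of that fibre. Only the full
  trace \<open>T\<close> has none.\<close>

lemma hdim_minus_antipode:
  "face_hdim t (Y \<union> cap A T opp - {T}) j = face_hdim t Y j"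
proof -
  let ?X = "Y \<union> cap A T opp"
  note F = antipode_facet
  have img: "opp ` T = A" and inj: "inj_on opp T" using opp by (auto simp: bij_betw_def)
  have "down_closed (?X - {T})"
    using is_complex_onD(4)[OF cx] F(4) unfolding down_closed_def by blast
  then have X: "is_complex_on (W \<union> T) t (?X - {T})" by (intro is_complex_on_subset[OF cx]) auto
  \<comment> \<open>The choice depends on the trace alone, as the removal by fibres
    requires.\<close>
  define p where "p B = (SOME a. a \<in> A - opp ` B)" for B
  have "face_hdim t (?X - {T}) j = face_hdim t {\<sigma> \<in> ?X - {T}. \<sigma> \<inter> T = {}} j"
  proof (rule hdim_fibres[OF X, where p = p])
    fix \<sigma> assume s: "\<sigma> \<in> ?X - {T}" "\<sigma> \<inter> T \<noteq> {}"
    then have c: "\<sigma> \<in> cap A T opp" using in_cap by blast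
    have "\<sigma> \<inter> T \<noteq> T" using s F(4) by blast
    then have "opp ` (\<sigma> \<inter> T) \<noteq> A" using inj img by (metis inf_le2 inj_on_image_eq_iff order_refl)
    moreover have "opp ` (\<sigma> \<inter> T) \<subseteq> A" using img by blast
    ultimately have "\<exists>a. a \<in> A - opp ` (\<sigma> \<inter> T)" by blast
    then have p: "p (\<sigma> \<inter> T) \<in> A - opp ` (\<sigma> \<inter> T)" unfolding p_def by (rule someI_ex)
    then have pT: "p (\<sigma> \<inter> T) \<notin> T" using A WT by blast
    have "insert (p (\<sigma> \<inter> T)) \<sigma> \<in> cap A T opp" using c p pT by (auto simp: cap_def)
    then show "p (\<sigma> \<inter> T) \<notin> T \<and> insert (p (\<sigma> \<inter> T)) \<sigma> \<in> ?X - {T}" using pT by auto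
  qed
  also have "{\<sigma> \<in> ?X - {T}. \<sigma> \<inter> T = {}} = Y"
    using Y_eq F(3) by blast
  finally show ?thesis .
qed

end

end

lemma incidence_complexI:
  "finite W \<Longrightarrow> incidence W t \<Longrightarrow> X \<subseteq> Pow W \<Longrightarrow> down_closed X \<Longrightarrow> is_complex_on W t X"
  by (simp add: is_complex_on_def)

lemma down_closed_Pow: "down_closed (Pow A)"
  by (auto simp: down_closed_def)

lemma capped_cross:
  assumes "finite (A \<union> T)" "incidence (A \<union> T) t" "A \<inter> T = {}"
  shows "capped_complex A T A t (Pow A) opp"
proof
  show "is_complex_on (A \<union> T) t (Pow A \<union> cap A T opp)"
    unfolding cross_eq[OF assms(3), symmetric]
    by (rule incidence_complexI[OF assms(1,2) _ down_closed_cross]) (auto simp: cross_def)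
qed (use assms in auto)

lemma hdim_Pow:
  assumes "finite A" "incidence A t" "A \<noteq> {}"
  shows "face_hdim t (Pow A) j = 0"
proof -
  obtain a where "a \<in> A" using assms by blast
  then show ?thesis
    by (intro hdim_cone[OF incidence_complexI[OF assms(1,2) _ down_closed_Pow], of _ a]) auto
qed

text \<open>Without \<open>T\<close> the cross-polytope boundary collapses to the simplex on
  \<open>A\<close>, which is acyclic, so there is no class for \<open>T\<close> to kill. The
  indicator of \<open>T\<close> therefore represents the fundamental class.\<close>

lemma cross_antipode_not_null:
  assumes "finite (A \<union> T)" "incidence (A \<union> T) t" "A \<inter> T = {}" "bij_betw opp T A" "A \<noteq> {}"
  shows "\<not> null_face t (cross A T opp) T"
proof -
  interpret capped_complex A T A t "Pow A" opp by (rule capped_cross[OF assms(1-3)])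
  have iA: "incidence A t" by (rule incidence_mono[OF assms(2)]) auto
  show ?thesis
    unfolding cross_eq[OF assms(3)]
  proof (rule not_null_face_if_acyclic[OF cx])
    show "T \<in> Pow A \<union> cap A T opp" "T \<noteq> {}" using antipode_facet[OF assms(4,5)] by auto
    show "\<tau> = T" if "\<tau> \<in> Pow A \<union> cap A T opp" "T \<subseteq> \<tau>" for \<tau>
      using antipode_facet(4)[OF assms(4,5)] that by blast
    show "face_hdim t (Pow A \<union> cap A T opp - {T}) (card T - 1) = 0"
      unfolding hdim_minus_antipode[OF assms(4,5)] by (rule hdim_Pow[OF fin(3) iA assms(5)])
  qed
qed

lemma cross_base_not_null:
  assumes "finite (A \<union> T)" "incidence (A \<union> T) t" "A \<inter> T = {}" "bij_betw opp T A" "A \<noteq> {}"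
  shows "\<not> null_face t (cross A T opp) A"
proof -
  have "T \<noteq> {}" using assms(4,5) by (auto simp: bij_betw_def)
  then show ?thesis
    unfolding cross_swap[OF assms(4)]
    using assms bij_betw_inv_into[OF assms(4)]
    by (intro cross_antipode_not_null) (auto simp: Un_commute)
qed

text \<open>All of the cap except \<open>T\<close> collapses onto \<open>Y\<close>, and
  \<open>T\<close> creates a class rather than killing one: since \<open>Y\<close> contains the
  simplex on \<open>A\<close>, the whole cross-polytope boundary is a subcomplex, where
  \<open>T\<close> is not null.\<close>

lemma (in capped_complex) hdim_antipode:
  assumes "bij_betw opp T A" "A \<noteq> {}" "Pow A \<subseteq> Y"
  shows "face_hdim t (Y \<union> cap A T opp) j = face_hdim t Y j + (if j = card T then 1 else 0)"
proof -
  let ?X = "Y \<union> cap A T opp"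
  note F = antipode_facet[OF assms(1,2)]
  have AT: "A \<inter> T = {}" using A WT by blast
  have inc: "incidence (A \<union> T) t"
    by (rule incidence_mono[OF is_complex_onD(2)[OF cx]]) (use A in auto)
  have "\<not> null_face t ?X T"
  proof
    assume n: "null_face t ?X T"
    have sub: "cross A T opp \<subseteq> ?X" unfolding cross_eq[OF AT] using assms(3) by blast
    have "T \<in> cross A T opp" using F(2) AT by (auto simp: cross_def)
    then have "null_face t (cross A T opp) T"
      by (rule null_face_subcomplex[OF n sub down_closed_cross])
    then show False using cross_antipode_not_null[OF _ inc AT assms(1,2)] fin by blast
  qed
  then have "int (face_hdim t ?X j) = int (face_hdim t Y j) + (if j = card T then 1 else 0)"
    using hdim_remove_facet[OF cx F(1) F(4), of j] hdim_minus_antipode[OF assms(1,2), of j] by simp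
  then show ?thesis by (simp split: if_splits)
qed

text \<open>A vertex without antipode is a cone point. If all vertices are paired, only the
  fundamental class remains; the case without vertices is the complex with just the empty
  face.\<close>

lemma hdim_cross:
  assumes fin: "finite (A \<union> T)" and t: "incidence (A \<union> T) t" and AT: "A \<inter> T = {}" and opp: "inj_on opp T"
  shows "face_hdim t (cross A T opp) j = (if opp ` T = A \<and> j = card T then 1 else 0)"
proof -
  have cx: "is_complex_on (A \<union> T) t (cross A T opp)"
    by (rule incidence_complexI[OF fin t _ down_closed_cross]) (auto simp: cross_def)
  consider x where "x \<in> A" "x \<notin> opp ` T" | w where "w \<in> T" "opp w \<notin> A" | "opp ` T = A" by blast
  then show ?thesis
  proof cases
    case 1
    have "insert x \<sigma> \<in> cross A T opp" if "\<sigma> \<in> cross A T opp" for \<sigma>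
      using that 1 AT by (auto simp: cross_def)
    then have "face_hdim t (cross A T opp) j = 0" by (rule hdim_cone[OF cx])
    moreover have "opp ` T \<noteq> A" using 1 by blast
    ultimately show ?thesis by simp
  next
    case 2
    have "insert w \<sigma> \<in> cross A T opp" if "\<sigma> \<in> cross A T opp" for \<sigma>
      using that 2 AT by (auto simp: cross_def)
    then have "face_hdim t (cross A T opp) j = 0" by (rule hdim_cone[OF cx])
    moreover have "opp ` T \<noteq> A" using 2 by blast
    ultimately show ?thesis by simp
  next
    case 3
    then have bij: "bij_betw opp T A" using opp by (simp add: bij_betw_def)
    show ?thesis
    proof (cases "A = {}")
      case True
      then have "T = {}" using 3 by simp
      then have "cross A T opp = {{}}" using True by (auto simp: cross_def)
      then show ?thesis using hdim_empty_face[OF fin t, of j] 3 \<open>T = {}\<close> by simp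
    next
      case False
      interpret capped_complex A T A t "Pow A" opp by (rule capped_cross[OF fin t AT])
      have "incidence A t" by (rule incidence_mono[OF t]) auto
      then have "face_hdim t (Pow A) j = 0" using fin False by (intro hdim_Pow) auto
      then show ?thesis
        using hdim_antipode[OF bij False subset_refl, of j] 3 unfolding cross_eq[OF AT] by simp
    qed
  qed
qed


section \<open>Changing the base facet of a cross-polytope\<close>

definition paired :: "('v \<Rightarrow> 'v) \<Rightarrow> 'v set \<Rightarrow> bool" where
  "paired q U \<longleftrightarrow> finite U \<and> (\<forall>x\<in>U. q x \<in> U \<and> q (q x) = x \<and> q x \<noteq> x)"

text \<open>The cross-polytope boundary described by its antipodal involution alone, with no facet
  distinguished.\<close>

definition pair_free :: "('v \<Rightarrow> 'v) \<Rightarrow> 'v set \<Rightarrow> 'v set set" where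
  "pair_free q U = {\<sigma>. \<sigma> \<subseteq> U \<and> (\<forall>x\<in>\<sigma>. q x \<notin> \<sigma>)}"

lemma pair_free_cross:
  assumes q: "paired q U" and AT: "A \<inter> T = {}" "A \<union> T = U" "q ` T = A"
  shows "cross A T q = pair_free q U" "bij_betw q T A"
proof -
  have qq: "q (q x) = x" if "x \<in> A \<union> T" for x using q AT(2) that by (auto simp: paired_def)
  have AtoT: "q x \<in> T" if x: "x \<in> A" for x
  proof -
    obtain w where "w \<in> T" "x = q w" using AT(3) x by blast
    then show ?thesis using qq[of w] by simp
  qed
  show "cross A T q = pair_free q U"
  proof (intro equalityI subsetI)
    fix \<sigma> assume s: "\<sigma> \<in> cross A T q"
    have "q x \<notin> \<sigma>" if x: "x \<in> \<sigma>" for x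
    proof
      assume qx: "q x \<in> \<sigma>"
      have no: "\<not> (w \<in> \<sigma> \<and> w \<in> T \<and> q w \<in> \<sigma> \<and> q w \<in> A)" for w
        using s by (auto simp: cross_def)
      have "x \<in> A \<union> T" using x s by (auto simp: cross_def)
      then show False
      proof
        assume "x \<in> A"
        then show False using no[of "q x"] AtoT[of x] qq[of x] x qx by auto
      next
        assume "x \<in> T"
        then show False using no[of x] AT(3) x qx by blast
      qed
    qed
    then show "\<sigma> \<in> pair_free q U" using s AT(2) by (auto simp: cross_def pair_free_def)
  next
    fix \<sigma> assume "\<sigma> \<in> pair_free q U"
    then show "\<sigma> \<in> cross A T q" using AT by (auto simp: cross_def pair_free_def)
  qed
  have "inj_on q T" using qq by (intro inj_onI) (metis UnI2)
  then show "bij_betw q T A" using AT(3) by (simp add: bij_betw_def)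
qed

text \<open>The involution maps \<open>G\<close> into its complement, and counting makes this
  onto.\<close>

lemma pair_free_facet:
  assumes q: "paired q U" and G: "G \<in> pair_free q U" "2 * card G = card U"
  shows "q ` (U - G) = G"
proof -
  have finU: "finite U" and GU: "G \<subseteq> U" using q G by (auto simp: paired_def pair_free_def)
  have sub: "q ` G \<subseteq> U - G" using q G by (auto simp: paired_def pair_free_def)
  have inj: "inj_on q U" using q by (intro inj_onI) (metis paired_def)
  have "card (q ` G) = card G" using inj GU by (intro card_image) (rule inj_on_subset)
  also have "\<dots> = card (U - G)"
    using card_Diff_subset[OF finite_subset[OF GU finU] GU] G(2) by simp
  finally have "q ` G = U - G" using card_subset_eq[OF _ sub] finU by simp
  then have "q ` (U - G) = q ` q ` G" by simp
  also have "\<dots> = (\<lambda>x. x) ` G"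
    unfolding image_image by (rule image_cong) (use q GU in \<open>auto simp: paired_def\<close>)
  finally show ?thesis by simp
qed

text \<open>Any facet can take over the role of \<open>A\<close>. This is needed because a connected
  sum may glue along an arbitrary facet of the new cross-polytope, and because nullity has been
  excluded so far only for \<open>A\<close> and \<open>T\<close>.\<close>

lemma cross_facet:
  assumes fin: "finite A" and AT: "A \<inter> T = {}" and opp: "bij_betw opp T A"
    and G: "G \<in> cross A T opp" "card G = card A"
  obtains q where "cross A T opp = cross G (A \<union> T - G) q" "bij_betw q (A \<union> T - G) G"
    "G \<subseteq> A \<union> T" "card (A \<union> T - G) = card A"
proof -
  define q where "q x = (if x \<in> T then opp x else inv_into T opp x)" for x
  have img: "opp ` T = A" using opp by (simp add: bij_betw_def)
  have cT: "card T = card A" using opp by (rule bij_betw_same_card)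
  have finT: "finite T" using bij_betw_finite[OF opp] fin by simp
  have iT: "inv_into T opp x \<in> T" if "x \<in> A" for x using that img by (metis inv_into_into)
  have q: "paired q (A \<union> T)"
    unfolding paired_def
  proof (intro conjI ballI)
    show "finite (A \<union> T)" using fin finT by simp
    fix x assume "x \<in> A \<union> T"
    then consider "x \<in> A" "x \<notin> T" | "x \<in> T" "x \<notin> A" using AT by blast
    then have "q x \<in> A \<union> T \<and> q (q x) = x \<and> q x \<noteq> x"
    proof cases
      case 1
      then have "q x \<in> T" "q (q x) = opp (inv_into T opp x)" using iT[of x] by (simp_all add: q_def)
      then show ?thesis using 1 bij_betw_inv_into_right[OF opp, of x] by auto
    next
      case 2
      then have "q x = opp x" "opp x \<in> A" using img by (auto simp: q_def)
      moreover have "opp x \<notin> T" using calculation AT by blast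
      ultimately show ?thesis using 2 bij_betw_inv_into_left[OF opp, of x] by (auto simp: q_def)
    qed
    then show "q x \<in> A \<union> T" "q (q x) = x" "q x \<noteq> x" by auto
  qed
  have "q ` T = A" using img by (auto simp: q_def)
  note c = pair_free_cross[OF q AT refl this]
  have "cross A T q = cross A T opp" by (auto simp: cross_def q_def)
  then have e: "cross A T opp = pair_free q (A \<union> T)" using c(1) by simp
  have cU: "card (A \<union> T) = 2 * card A" using card_Un_disjoint[OF fin finT AT] cT by simp
  have GU: "G \<subseteq> A \<union> T" using G(1) by (simp add: cross_def)
  have f: "q ` (A \<union> T - G) = G" using G e cU by (intro pair_free_facet[OF q]) auto
  have "G \<inter> (A \<union> T - G) = {}" "G \<union> (A \<union> T - G) = A \<union> T" using GU by auto
  note d = pair_free_cross[OF q this f]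
  show thesis
  proof (rule that)
    show "cross A T opp = cross G (A \<union> T - G) q" using d(1) e by simp
    show "bij_betw q (A \<union> T - G) G" by (rule d)
    then show "card (A \<union> T - G) = card A" using G(2) by (metis bij_betw_same_card)
  qed (rule GU)
qed

lemma cross_facet_not_null:
  assumes "finite A" "A \<inter> T = {}" "bij_betw opp T A" "A \<noteq> {}" "incidence (A \<union> T) t"
    and G: "G \<in> cross A T opp" "card G = card A"
  shows "\<not> null_face t (cross A T opp) G"
proof -
  obtain q where q: "cross A T opp = cross G (A \<union> T - G) q" "bij_betw q (A \<union> T - G) G" "G \<subseteq> A \<union> T"
    "card (A \<union> T - G) = card A" by (rule cross_facet[OF assms(1-3) G])
  have "finite T" using bij_betw_finite[OF assms(3)] assms(1) by simp
  moreover have "G \<union> (A \<union> T - G) = A \<union> T" using q(3) by blast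
  moreover have "G \<noteq> {}" using G(2) assms(1,4) by auto
  ultimately show ?thesis
    unfolding q(1) using assms(1,5) q(2) by (intro cross_base_not_null) auto
qed

lemma cross_polytope_boundary_cross:
  assumes "cross_polytope_boundary d \<Delta>"
  obtains A T opp where "finite A" "card A = d" "A \<inter> T = {}" "bij_betw opp T A" "\<Delta> = cross A T opp"
proof -
  obtain v w :: "nat \<Rightarrow> 'a" where vw: "inj_on v {..<d}" "inj_on w {..<d}" "v ` {..<d} \<inter> w ` {..<d} = {}"
    and D: "\<Delta> = {\<Union>(\<sigma> ` {..<d}) | \<sigma>. \<forall>i<d. \<sigma> i \<in> {{}, {v i}, {w i}}}"
    using assms unfolding cross_polytope_boundary_def by blast
  let ?I = "{..<d}"
  let ?opp = "v \<circ> inv_into ?I w"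
  have iw: "inv_into ?I w (w i) = i" if "i < d" for i using inv_into_f_f[OF vw(2)] that by simp
  have bij: "bij_betw ?opp (w ` ?I) (v ` ?I)"
    using vw by (intro bij_betw_trans[of _ _ ?I] bij_betw_inv_into) (auto simp: bij_betw_def)
  have ne: "v i \<noteq> w k" if "i < d" "k < d" for i k using vw(3) that by blast
  have memv: "v i = v k \<longleftrightarrow> i = k" "w i = w k \<longleftrightarrow> i = k" if "i < d" "k < d" for i k
    using vw that by (auto dest: inj_onD)
  have "\<Delta> = cross (v ` ?I) (w ` ?I) ?opp"
  proof (intro equalityI subsetI)
    fix S assume "S \<in> \<Delta>"
    then obtain \<sigma> where s: "S = \<Union>(\<sigma> ` ?I)" "\<And>i. i < d \<Longrightarrow> \<sigma> i \<in> {{}, {v i}, {w i}}" unfolding D by blast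
    have sv: "\<sigma> i = {v i}" if vi: "v i \<in> S" "i < d" for i
    proof -
      obtain k where k: "k < d" "v i \<in> \<sigma> k" using vi s(1) by blast
      then have "k = i" using s(2)[OF k(1)] memv(1)[OF vi(2) k(1)] ne[OF vi(2) k(1)] by auto
      then show ?thesis using k s(2)[OF k(1)] ne[OF vi(2) vi(2)] by auto
    qed
    have sw: "\<sigma> i = {w i}" if wi: "w i \<in> S" "i < d" for i
    proof -
      obtain k where k: "k < d" "w i \<in> \<sigma> k" using wi s(1) by blast
      then have "k = i" using s(2)[OF k(1)] memv(2)[OF wi(2) k(1)] ne[OF k(1) wi(2)] by auto
      then show ?thesis using k s(2)[OF k(1)] ne[OF wi(2) wi(2)] by auto
    qed
    have sub: "S \<subseteq> v ` ?I \<union> w ` ?I"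
    proof
      fix x assume "x \<in> S"
      then obtain k where "k < d" "x \<in> \<sigma> k" using s(1) by blast
      then show "x \<in> v ` ?I \<union> w ` ?I" using s(2)[of k] by auto
    qed
    have "\<not> (v i \<in> S \<and> w i \<in> S)" if "i < d" for i using sv[of i] sw[of i] ne[OF that that] that by auto
    then have "S \<inter> v ` ?I \<inter> ?opp ` (S \<inter> w ` ?I) = {}" using iw by auto
    then show "S \<in> cross (v ` ?I) (w ` ?I) ?opp" using sub by (simp add: cross_def)
  next
    fix S assume S: "S \<in> cross (v ` ?I) (w ` ?I) ?opp"
    define \<sigma> where "\<sigma> i = S \<inter> {v i, w i}" for i
    have nb: "\<not> (v i \<in> S \<and> w i \<in> S)" if "i < d" for i
    proof
      assume "v i \<in> S \<and> w i \<in> S"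
      then have "v i \<in> S \<inter> v ` ?I \<inter> ?opp ` (S \<inter> w ` ?I)" using that iw[OF that] by (auto simp: image_iff intro!: bexI[of _ "w i"])
      moreover have "S \<inter> v ` ?I \<inter> ?opp ` (S \<inter> w ` ?I) = {}" using S unfolding cross_def by blast
      ultimately show False by blast
    qed
    have "\<sigma> i \<in> {{}, {v i}, {w i}}" if "i < d" for i using nb[OF that] by (auto simp: \<sigma>_def)
    moreover have "S = \<Union>(\<sigma> ` ?I)" using S by (auto simp: \<sigma>_def cross_def)
    ultimately show "S \<in> \<Delta>" unfolding D by blast
  qed
  moreover have "card (v ` ?I) = d" using card_image[OF vw(1)] by simp
  ultimately show thesis using that[of "v ` ?I" "w ` ?I" ?opp] vw(3) bij by simp
qed

section \<open>Stacking a cross-polytope on a facet\<close>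

text \<open>\<open>d\<close> counts the vertices of a facet, so the dimension is
  \<open>d - 1\<close>. The empty face is included, as degree 0 refers to it.\<close>

definition pure_complex :: "nat \<Rightarrow> 'v set set \<Rightarrow> bool" where
  "pure_complex d \<Delta> \<longleftrightarrow> finite (\<Union>\<Delta>) \<and> down_closed \<Delta> \<and> {} \<in> \<Delta> \<and>
     (\<forall>\<sigma>\<in>\<Delta>. \<exists>\<tau>\<in>\<Delta>. \<sigma> \<subseteq> \<tau> \<and> card \<tau> = d) \<and> (\<forall>\<sigma>\<in>\<Delta>. card \<sigma> \<le> d)"

lemma pure_complexD:
  assumes "pure_complex d \<Delta>"
  shows "finite (\<Union>\<Delta>)" "down_closed \<Delta>" "{} \<in> \<Delta>" "\<And>\<sigma>. \<sigma> \<in> \<Delta> \<Longrightarrow> \<exists>\<tau>\<in>\<Delta>. \<sigma> \<subseteq> \<tau> \<and> card \<tau> = d"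
    "\<And>\<sigma>. \<sigma> \<in> \<Delta> \<Longrightarrow> card \<sigma> \<le> d" "\<And>\<sigma>. \<sigma> \<in> \<Delta> \<Longrightarrow> finite \<sigma>"
  using assms finite_subset[of _ "\<Union>\<Delta>"] by (auto simp: pure_complex_def)

lemma pure_complex_facet:
  assumes "pure_complex d \<Delta>" "F \<in> \<Delta>" "card F = d" "\<tau> \<in> \<Delta>" "F \<subseteq> \<tau>"
  shows "\<tau> = F"
  using card_seteq[OF pure_complexD(6)[OF assms(1,4)] assms(5)] pure_complexD(5)[OF assms(1,4)] assms(3) by simp

lemma facets_pure_complex:
  assumes "pure_complex d \<Delta>"
  shows "F \<in> facets \<Delta> \<longleftrightarrow> F \<in> \<Delta> \<and> card F = d"
proof
  assume F: "F \<in> facets \<Delta>"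
  then obtain \<tau> where "\<tau> \<in> \<Delta>" "F \<subseteq> \<tau>" "card \<tau> = d"
    using pure_complexD(4)[OF assms] by (auto simp: facets_def)
  then show "F \<in> \<Delta> \<and> card F = d" using F by (auto simp: facets_def)
next
  assume "F \<in> \<Delta> \<and> card F = d"
  then show "F \<in> facets \<Delta>" using pure_complex_facet[OF assms] by (auto simp: facets_def)
qed

lemma vertex_in_complex: "down_closed \<Delta> \<Longrightarrow> v \<in> \<Union>\<Delta> \<Longrightarrow> {v} \<in> \<Delta>"
  by (auto simp: down_closed_def)

lemma induced_complex:
  assumes "down_closed \<Delta>" "finite W" "incidence W t"
  shows "is_complex_on W t (induced \<Delta> W)"
  using assms by (intro incidence_complexI) (auto simp: induced_def down_closed_def)

text \<open>The homological facts about a sphere that survive stacking: proper induced subcomplexes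
  have no class in top degree, the whole complex has the fundamental class and nothing else, and
  every facet cochain represents a nonzero class. The last clause determines what happens when the
  facet is deleted from the whole complex.\<close>

definition sphere_type :: "'a::field itself \<Rightarrow> nat \<Rightarrow> 'v set set \<Rightarrow> bool" where
  "sphere_type K d \<Delta> \<longleftrightarrow>
     (\<forall>W\<subseteq>\<Union>\<Delta>. \<forall>t :: 'v set \<Rightarrow> 'v \<Rightarrow> 'a. incidence W t \<longrightarrow>
        face_hdim t (induced \<Delta> W) d = (if W = \<Union>\<Delta> then 1 else 0)) \<and>
     (\<forall>t :: 'v set \<Rightarrow> 'v \<Rightarrow> 'a. \<forall>j. incidence (\<Union>\<Delta>) t \<longrightarrow> j \<noteq> d \<longrightarrow>
        face_hdim t (induced \<Delta> (\<Union>\<Delta>)) j = 0) \<and>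
     (\<forall>t :: 'v set \<Rightarrow> 'v \<Rightarrow> 'a. \<forall>F\<in>\<Delta>. incidence (\<Union>\<Delta>) t \<longrightarrow> card F = d \<longrightarrow> \<not> null_face t \<Delta> F)"

text \<open>\<open>N\<close> consists of the vertices of the added cross-polytope outside the gluing
  facet \<open>F\<close>, and \<open>opp\<close> sends each of them to its antipode in
  \<open>F\<close>.\<close>

locale stacking =
  fixes d :: nat and \<Delta> :: "'v set set" and F N :: "'v set" and opp :: "'v \<Rightarrow> 'v"
  assumes pure: "pure_complex d \<Delta>" and d2: "d \<ge> 2" and F: "F \<in> \<Delta>" "card F = d"
    and N: "finite N" "N \<inter> \<Union>\<Delta> = {}" and opp: "bij_betw opp N F"
begin

definition stacked :: "'v set set" where "stacked = (\<Delta> - {F}) \<union> cap F N opp"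

text \<open>Keeping \<open>F\<close> makes both the old sphere and the full cross-polytope boundary
  subcomplexes, so nullity can be tested on either one. The connected sum arises by deleting
  \<open>F\<close> afterwards.\<close>

definition glued :: "'v set set" where "glued = \<Delta> \<union> cap F N opp"

lemmas pureD = pure_complexD[OF pure]

lemma finF: "finite F" using F(2) d2 by (intro card_ge_0_finite) simp

lemma FV: "F \<subseteq> \<Union>\<Delta>" using F by blast

lemma FN: "F \<inter> N = {}" using FV N by blast

lemma cardN: "card N = d" using opp F(2) by (metis bij_betw_same_card)

lemma F_notin_cap: "F \<notin> cap F N opp" using FN by (auto simp: cap_def)

lemma stacked_eq: "stacked = glued - {F}"
  using F_notin_cap by (auto simp: stacked_def glued_def)

lemma down_closed_glued: "down_closed glued"
  unfolding down_closed_def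
proof (intro ballI allI impI)
  fix \<sigma> \<tau> assume s: "\<sigma> \<in> glued" "\<tau> \<subseteq> \<sigma>"
  show "\<tau> \<in> glued"
  proof (cases "\<sigma> \<in> \<Delta>")
    case True
    then show ?thesis using s pureD(2) by (auto simp: glued_def dest: down_closedD)
  next
    case False
    then have c: "\<sigma> \<in> cap F N opp" using s by (simp add: glued_def)
    show ?thesis
    proof (cases "\<tau> \<inter> N = {}")
      case True
      then have "\<tau> \<subseteq> F" using s c by (auto simp: cap_def)
      then show ?thesis using down_closedD[OF pureD(2) F(1)] by (simp add: glued_def)
    next
      case False
      then show ?thesis using s c by (auto simp: glued_def cap_def)
    qed
  qed
qed

lemma F_facet_glued:
  assumes "\<tau> \<in> glued" "F \<subseteq> \<tau>"
  shows "\<tau> = F"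
proof (cases "\<tau> \<in> \<Delta>")
  case True
  then show ?thesis using pure_complex_facet[OF pure F] assms by blast
next
  case False
  then have c: "\<tau> \<in> cap F N opp" using assms by (simp add: glued_def)
  have "opp ` (\<tau> \<inter> N) \<subseteq> F" using opp by (auto simp: bij_betw_def)
  moreover have "\<tau> \<inter> N \<noteq> {}" "\<tau> \<inter> F \<inter> opp ` (\<tau> \<inter> N) = {}" using c by (auto simp: cap_def)
  ultimately show ?thesis using assms(2) by blast
qed

lemma down_closed_stacked: "down_closed stacked"
  using down_closed_glued F_facet_glued unfolding stacked_eq down_closed_def by blast

lemma cap_subset: "\<sigma> \<in> cap F N opp \<Longrightarrow> \<sigma> \<subseteq> F \<union> N" by (simp add: cap_def)

lemma vertices_stacked: "\<Union>stacked = \<Union>\<Delta> \<union> N"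
proof
  show "\<Union>stacked \<subseteq> \<Union>\<Delta> \<union> N" using cap_subset FV by (auto simp: stacked_def)
  have "v \<in> \<Union>stacked" if "v \<in> \<Union>\<Delta>" for v
  proof -
    \<comment> \<open>By \<open>d \<ge> 2\<close> no vertex is itself the deleted facet, so no
      vertex is lost.\<close>
    have "{v} \<noteq> F" using F(2) d2 by auto
    then show ?thesis using vertex_in_complex[OF pureD(2) that] by (auto simp: stacked_def)
  qed
  moreover have "{w} \<in> stacked" if "w \<in> N" for w
    using that FN by (auto simp: stacked_def cap_def)
  ultimately show "\<Union>\<Delta> \<union> N \<subseteq> \<Union>stacked" by blast
qed

lemma card_cap_facet:
  assumes "\<sigma> \<in> cap F N opp"
  shows "card \<sigma> \<le> d" "\<exists>\<tau>\<in>cap F N opp. \<sigma> \<subseteq> \<tau> \<and> card \<tau> = d"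
proof -
  have "\<sigma> \<in> cross F N opp" and ne: "\<sigma> \<inter> N \<noteq> {}"
    using assms cross_eq[OF FN, of opp] by (auto simp: cap_def)
  then obtain \<tau> where t: "\<tau> \<in> cross F N opp" "\<sigma> \<subseteq> \<tau>" "card \<tau> = card F" "finite \<tau>"
    using cross_extend[OF finF FN opp] by blast
  then have "\<tau> \<in> cap F N opp" using ne by (auto simp: cross_def cap_def)
  then show "\<exists>\<tau>\<in>cap F N opp. \<sigma> \<subseteq> \<tau> \<and> card \<tau> = d" using t F(2) by auto
  show "card \<sigma> \<le> d" using card_mono[OF t(4,2)] t(3) F(2) by simp
qed

lemma pure_stacked: "pure_complex d stacked"
  unfolding pure_complex_def
proof (intro conjI ballI)
  show "finite (\<Union>stacked)" using pureD(1) N by (simp add: vertices_stacked)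
  show "down_closed stacked" by (rule down_closed_stacked)
  have "F \<noteq> {}" using F(2) d2 by auto
  then show "{} \<in> stacked" using pureD(3) by (simp add: stacked_def)
  fix \<sigma> assume s: "\<sigma> \<in> stacked"
  show "card \<sigma> \<le> d" using s card_cap_facet pureD(5) by (auto simp: stacked_def)
  show "\<exists>\<tau>\<in>stacked. \<sigma> \<subseteq> \<tau> \<and> card \<tau> = d"
  proof (cases "\<sigma> \<in> cap F N opp")
    case True
    then show ?thesis using card_cap_facet(2) by (auto simp: stacked_def)
  next
    case False
    then have sD: "\<sigma> \<in> \<Delta>" "\<sigma> \<noteq> F" using s by (auto simp: stacked_def)
    obtain \<tau> where t: "\<tau> \<in> \<Delta>" "\<sigma> \<subseteq> \<tau>" "card \<tau> = d" using pureD(4)[OF sD(1)] by blast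
    show ?thesis
    proof (cases "\<tau> = F")
      case True
      then obtain v where v: "v \<in> F" "v \<notin> \<sigma>" using t sD by blast
      \<comment> \<open>A proper face of the deleted facet lies in a new facet: the antipode of a
        missing vertex \<open>v\<close> can be added to it.\<close>
      then obtain w where w: "w \<in> N" "opp w = v" using opp by (auto simp: bij_betw_def)
      have sF: "\<sigma> \<subseteq> F" using t True by simp
      then have "insert w \<sigma> \<inter> N = {w}" using w FN by auto
      moreover have "w \<notin> F" using w FN by blast
      ultimately have "insert w \<sigma> \<in> cap F N opp" using sF w v by (auto simp: cap_def)
      then show ?thesis using card_cap_facet(2)[of "insert w \<sigma>"] by (auto simp: stacked_def)
    next
      case False
      then show ?thesis using t by (auto simp: stacked_def)
    qed
  qed
qed

lemma induced_cap:
  assumes "W \<subseteq> \<Union>\<Delta>" "T \<subseteq> N"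
  shows "{\<sigma> \<in> cap F N opp. \<sigma> \<subseteq> W \<union> T} = cap (F \<inter> W) T opp"
proof (intro equalityI subsetI)
  fix \<sigma> assume s: "\<sigma> \<in> {\<sigma> \<in> cap F N opp. \<sigma> \<subseteq> W \<union> T}"
  have "\<sigma> \<inter> N = \<sigma> \<inter> T" using s assms N(2) by blast
  then show "\<sigma> \<in> cap (F \<inter> W) T opp" using s assms FN N(2) by (auto simp: cap_def)
next
  fix \<sigma> assume s: "\<sigma> \<in> cap (F \<inter> W) T opp"
  have "\<sigma> \<subseteq> W \<union> T" using s by (auto simp: cap_def)
  moreover have "\<sigma> \<inter> N = \<sigma> \<inter> T" using calculation assms N(2) by blast
  moreover have "\<sigma> \<inter> F = \<sigma> \<inter> (F \<inter> W)" using calculation assms FN by blast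
  ultimately show "\<sigma> \<in> {\<sigma> \<in> cap F N opp. \<sigma> \<subseteq> W \<union> T}" using s by (auto simp: cap_def)
qed

lemma induced_old: "W \<subseteq> \<Union>\<Delta> \<Longrightarrow> T \<subseteq> N \<Longrightarrow> induced \<Delta> (W \<union> T) = induced \<Delta> W"
  using N(2) by (auto simp: induced_def)

lemma induced_stacked:
  assumes "W \<subseteq> \<Union>\<Delta>" "T \<subseteq> N"
  shows "induced stacked (W \<union> T) = (induced \<Delta> W - {F}) \<union> cap (F \<inter> W) T opp"
  using induced_old[OF assms] induced_cap[OF assms] by (auto simp: stacked_def induced_def)

lemma induced_glued:
  assumes "W \<subseteq> \<Union>\<Delta>" "T \<subseteq> N"
  shows "induced glued (W \<union> T) = induced \<Delta> W \<union> cap (F \<inter> W) T opp"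
  using induced_old[OF assms] induced_cap[OF assms] by (auto simp: glued_def induced_def)

text \<open>In order: \<open>T\<close> is an extra component; the class of the empty old part is
  lost when new vertices appear; \<open>T\<close> completes a cross-polytope with
  \<open>W \<inter> F\<close>; deleting \<open>F\<close> opens a hole; deleting \<open>F\<close>
  destroys the fundamental class. The last three exclude \<open>T = N\<close>: if all of
  \<open>F\<close> is present too, then gluing and deletion cancel, and otherwise \<open>W\<close>
  contains too few vertices for any of them.\<close>

definition hdim_change :: "nat \<Rightarrow> 'v set \<Rightarrow> 'v set \<Rightarrow> int" where
  "hdim_change j W T =
     (if T \<noteq> {} \<and> W \<inter> F = {} \<and> W \<noteq> {} \<and> j = 1 then 1 else 0)
     - (if T \<noteq> {} \<and> W = {} \<and> j = 0 then 1 else 0)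
     + (if T \<noteq> {} \<and> T \<noteq> N \<and> opp ` T = W \<inter> F \<and> j = card T then 1 else 0)
     + (if F \<subseteq> W \<and> T \<noteq> N \<and> W \<noteq> \<Union>\<Delta> \<and> Suc j = d then 1 else 0)
     - (if W = \<Union>\<Delta> \<and> T \<noteq> N \<and> j = d then 1 else 0)"

context
  assumes sph: "sphere_type TYPE('a::field) d \<Delta>"
begin

lemma sphere_hdim_top:
  fixes t :: "'v set \<Rightarrow> 'v \<Rightarrow> 'a"
  assumes "W \<subseteq> \<Union>\<Delta>" "incidence W t"
  shows "face_hdim t (induced \<Delta> W) d = (if W = \<Union>\<Delta> then 1 else 0)"
  using sph assms unfolding sphere_type_def by blast

lemma sphere_hdim_other:
  fixes t :: "'v set \<Rightarrow> 'v \<Rightarrow> 'a"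
  assumes "incidence (\<Union>\<Delta>) t" "j \<noteq> d"
  shows "face_hdim t (induced \<Delta> (\<Union>\<Delta>)) j = 0"
  using sph assms unfolding sphere_type_def by blast

lemma sphere_facet_not_null:
  fixes t :: "'v set \<Rightarrow> 'v \<Rightarrow> 'a"
  assumes "incidence (\<Union>\<Delta>) t" "G \<in> \<Delta>" "card G = d"
  shows "\<not> null_face t \<Delta> G"
  using sph assms unfolding sphere_type_def by blast

text \<open>In a proper induced subcomplex there is no class in top degree, so \<open>F\<close> is
  null there and its deletion frees a class one degree below. In the whole sphere \<open>F\<close>
  is not null and carries the fundamental class away.\<close>

lemma hdim_remove_F:
  fixes t :: "'v set \<Rightarrow> 'v \<Rightarrow> 'a"
  assumes W: "W \<subseteq> \<Union>\<Delta>" "incidence W t"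
  shows "int (face_hdim t (induced \<Delta> W - {F}) j) = int (face_hdim t (induced \<Delta> W) j)
     + (if F \<subseteq> W \<and> W \<noteq> \<Union>\<Delta> \<and> Suc j = d then 1 else 0) - (if W = \<Union>\<Delta> \<and> j = d then 1 else 0)"
proof (cases "F \<subseteq> W")
  case False
  then have "induced \<Delta> W - {F} = induced \<Delta> W" by (auto simp: induced_def)
  moreover have "W \<noteq> \<Union>\<Delta>" using False FV by blast
  ultimately show ?thesis using False by simp
next
  case True
  have finW: "finite W" using W pureD(1) finite_subset by blast
  note cx = induced_complex[OF pureD(2) finW W(2)]
  have FW: "F \<in> induced \<Delta> W" using True F by (simp add: induced_def)
  have top: "\<tau> = F" if "\<tau> \<in> induced \<Delta> W" "F \<subseteq> \<tau>" for \<tau>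
    using that pure_complex_facet[OF pure F] by (auto simp: induced_def)
  note rem = hdim_remove_facet[OF cx FW top, of j]
  show ?thesis
  proof (cases "W = \<Union>\<Delta>")
    case True
    then have "induced \<Delta> W = \<Delta>" by (auto simp: induced_def)
    then have "\<not> null_face t (induced \<Delta> W) F" using sphere_facet_not_null[of t F] W F True by simp
    then show ?thesis using rem True F(2) by (simp split: if_splits)
  next
    case False
    have "face_hdim t (induced \<Delta> W) (card F) = 0" using sphere_hdim_top[OF W] False F(2) by simp
    then have "null_face t (induced \<Delta> W) F"
      by (intro null_face_if_hdim_zero[OF cx FW top])
    then show ?thesis using rem True False F(2) by (simp split: if_splits)
  qed
qed

text \<open>The cases follow the pairing between \<open>T\<close> and \<open>F \<inter> W\<close>:
  no new vertices, an old vertex without antipode, a new vertex without antipode, or a perfect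
  matching. The matching with \<open>T = N\<close> is special, because then \<open>F\<close> lies in
  \<open>W\<close> and the old part lacks precisely the simplex that \<open>hdim_antipode\<close>
  requires.\<close>

lemma hdim_stacked:
  fixes t :: "'v set \<Rightarrow> 'v \<Rightarrow> 'a"
  assumes W: "W \<subseteq> \<Union>\<Delta>" and T: "T \<subseteq> N" and t: "incidence (W \<union> T) t"
  shows "int (face_hdim t (induced stacked (W \<union> T)) j) = int (face_hdim t (induced \<Delta> W) j) + hdim_change j W T"
proof -
  let ?Y = "induced \<Delta> W - {F}" and ?A = "F \<inter> W"
  have finW: "finite W" using W pureD(1) finite_subset by blast
  have finT: "finite T" using T N finite_subset by blast
  have tW: "incidence W t" by (rule incidence_mono[OF t]) simp
  have WT: "W \<inter> T = {}" using W T N by blast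
  have Nne: "N \<noteq> {}" using cardN d2 by auto
  have img: "opp ` N = F" "inj_on opp N" using opp by (auto simp: bij_betw_def)
  have injT: "inj_on opp T" using img T inj_on_subset by blast
  have NT: "T \<noteq> N" if "x \<in> ?A" "x \<notin> opp ` T" for x using that img by blast
  have cap: "capped_complex W T ?A t ?Y opp"
  proof
    show "is_complex_on (W \<union> T) t (?Y \<union> cap ?A T opp)"
      unfolding induced_stacked[OF W T, symmetric]
      using induced_complex[OF down_closed_stacked _ t] finW finT by blast
  qed (use WT in \<open>auto simp: induced_def\<close>)
  interpret Y: capped_complex W T ?A t ?Y opp by (rule cap)
  note S = induced_stacked[OF W T] and R = hdim_remove_F[OF W tW, of j]
  consider (none) "T = {}" | (old) x where "T \<noteq> {}" "x \<in> ?A" "x \<notin> opp ` T"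
    | (new) w where "T \<noteq> {}" "w \<in> T" "opp w \<notin> ?A" | (all) "T \<noteq> {}" "opp ` T = ?A" by blast
  then show ?thesis
  proof cases
    case none
    then have "cap ?A T opp = {}" by (auto simp: cap_def)
    then show ?thesis unfolding S using R none Nne by (simp add: hdim_change_def)
  next
    case old
    have "opp ` T \<noteq> W \<inter> F" "W \<inter> F \<noteq> {}" "W \<noteq> {}" "T \<noteq> N" using old NT by auto
    then show ?thesis unfolding S Y.hdim_unpaired_old[OF old(2,3)] R by (simp add: hdim_change_def)
  next
    case new
    have "opp w \<in> F" using new(2) T img by blast
    then have nF: "\<not> F \<subseteq> W" using new(3) by blast
    then have WV: "W \<noteq> \<Union>\<Delta>" using FV by blast
    have YD: "?Y = induced \<Delta> W" using nF by (auto simp: induced_def)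
    have im: "opp ` T \<noteq> W \<inter> F" using new by blast
    show ?thesis
    proof (cases "?A = {}")
      case False
      then have "W \<inter> F \<noteq> {}" "W \<noteq> {}" by auto
      then show ?thesis using Y.hdim_unpaired_new[OF new(2,3) False, of j] nF WV im
        unfolding S YD by (simp add: hdim_change_def)
    next
      case True
      show ?thesis
      proof (cases "W = {}")
        case True
        have "induced \<Delta> W = {{}}" using pureD(3) True by (auto simp: induced_def)
        \<comment> \<open>With no old vertices the new ones collapse to the single point
          \<open>w\<close>, whose complex is a cone, whereas the old part alone has the class of the
          empty face.\<close>
        have "insert w \<sigma> \<in> ?Y \<union> insert w ` Pow ?A" if "\<sigma> \<in> ?Y \<union> insert w ` Pow ?A" for \<sigma>
          using that \<open>induced \<Delta> W = {{}}\<close> True by auto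
        then have "face_hdim t (?Y \<union> insert w ` Pow ?A) j = 0"
          by (rule hdim_cone[OF Y.hdim_unpaired_new_aux(2)[OF new(2,3)]])
        then have "face_hdim t (induced stacked (W \<union> T)) j = 0"
          unfolding S Y.hdim_unpaired_new_aux(1)[OF new(2,3)] .
        moreover have "face_hdim t (induced \<Delta> W) j = (if j = 0 then 1 else 0)"
          unfolding \<open>induced \<Delta> W = {{}}\<close> by (rule hdim_empty_face[OF finW tW])
        ultimately show ?thesis using True new(1) im nF WV by (simp add: hdim_change_def)
      next
        case False
        then obtain u where u: "u \<in> W" by blast
        then have "{u} \<in> ?Y" using W vertex_in_complex[OF pureD(2), of u] unfolding YD by (auto simp: induced_def)
        then have "face_hdim t (induced stacked (W \<union> T)) j = face_hdim t (induced \<Delta> W) j + (if j = 1 then 1 else 0)"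
          using Y.hdim_isolated_new[OF new(2,3) True, of u] unfolding S YD by simp
        then show ?thesis using True False new(1) im nF WV by (auto simp: hdim_change_def)
      qed
    qed
  next
    case all
    then have Ane: "?A \<noteq> {}" by auto
    then have c1: "W \<inter> F \<noteq> {}" "W \<noteq> {}" by auto
    have bij: "bij_betw opp T ?A" using injT all by (simp add: bij_betw_def)
    show ?thesis
    proof (cases "T = N")
      case False
      \<comment> \<open>If \<open>F\<close> were contained in \<open>W\<close>, then
        \<open>opp\<close> would map \<open>T\<close> onto all of \<open>F\<close> and injectivity
        would give \<open>T = N\<close>. So \<open>F\<close> has not been deleted from this old
        part.\<close>
      have nF: "\<not> F \<subseteq> W"
      proof
        assume "F \<subseteq> W"
        then have "opp ` T = opp ` N" using all img by auto
        then show False using False T img(2) by (metis inj_on_image_eq_iff order_refl)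
      qed
      then have WV: "W \<noteq> \<Union>\<Delta>" using FV by blast
      have YD: "?Y = induced \<Delta> W" using nF by (auto simp: induced_def)
      have "Pow ?A \<subseteq> ?Y" unfolding YD using down_closedD[OF pureD(2) F(1)] by (auto simp: induced_def)
      then show ?thesis using Y.hdim_antipode[OF bij Ane \<open>Pow ?A \<subseteq> ?Y\<close>, of j] all(1,2) c1 nF WV False
        unfolding S YD by (simp add: hdim_change_def Int_commute)
    next
      case True
      then have FA: "?A = F" using all img by auto
      then have FW: "F \<subseteq> W" by blast
      \<comment> \<open>Gluing without deleting \<open>F\<close> adds one class in degree \<open>d\<close>, and deleting \<open>F\<close> afterwards removes it.\<close>
      let ?X = "induced glued (W \<union> T)"
      have X: "?X = induced \<Delta> W \<union> cap ?A T opp" by (rule induced_glued[OF W T])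
      have finWT: "finite (W \<union> T)" using finW finT by simp
      have cx: "is_complex_on (W \<union> T) t ?X" by (rule induced_complex[OF down_closed_glued finWT t])
      interpret X: capped_complex W T ?A t "induced \<Delta> W" opp
        using cx WT unfolding X by unfold_locales (auto simp: induced_def)
      have "Pow ?A \<subseteq> induced \<Delta> W" using down_closedD[OF pureD(2) F(1)] by (auto simp: induced_def)
      then have h: "face_hdim t ?X j = face_hdim t (induced \<Delta> W) j + (if j = d then 1 else 0)"
        unfolding X using X.hdim_antipode[OF bij Ane, of j] True cardN by simp
      have FX: "F \<in> ?X" using F FW unfolding X by (auto simp: induced_def)
      have "\<not> null_face t ?X F"
      proof
        assume n: "null_face t ?X F"
        have sub: "cross ?A T opp \<subseteq> ?X"
          using \<open>Pow ?A \<subseteq> induced \<Delta> W\<close> WT unfolding X by (subst cross_eq) auto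
        have "F \<in> cross ?A T opp" unfolding FA using FN T True by (auto simp: cross_def)
        then have "null_face t (cross ?A T opp) ?A"
          using null_face_subcomplex[OF n sub down_closed_cross] FA by simp
        moreover have "incidence (?A \<union> T) t" by (rule incidence_mono[OF t]) auto
        ultimately show False using cross_base_not_null[of ?A T t opp] bij Ane WT finF finT by auto
      qed
      moreover have "\<tau> = F" if "\<tau> \<in> ?X" "F \<subseteq> \<tau>" for \<tau>
        using that F_facet_glued by (auto simp: induced_def)
      ultimately have "int (face_hdim t ?X j) = int (face_hdim t (?X - {F}) j) + (if j = d then 1 else 0)"
        using hdim_remove_facet[OF cx FX, of j] F(2) by simp
      moreover have "?X - {F} = induced stacked (W \<union> T)" by (auto simp: stacked_eq induced_def)
      ultimately have "face_hdim t (induced stacked (W \<union> T)) j = face_hdim t (induced \<Delta> W) j"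
        using h by (simp split: if_splits)
      then show ?thesis using True c1 by (simp add: hdim_change_def)
    qed
  qed
qed

text \<open>The cohomological clauses are values of \<open>hdim_change\<close>. For nullity, a
  primitive for a facet \<open>G\<close> of the connected sum is examined on \<open>glued\<close>,
  where the only further value of its coboundary is the one at \<open>F\<close>. If that value were
  nonzero, \<open>F\<close> would be null in the summand not containing \<open>G\<close>. So it is
  zero, and then \<open>G\<close> would be null in the summand that contains it.\<close>

lemma sphere_type_stacked: "sphere_type TYPE('a) d stacked"
proof -
  let ?V = "\<Union>\<Delta>"
  have split: "W = W \<inter> ?V \<union> W \<inter> N" if "W \<subseteq> \<Union>stacked" for W using that vertices_stacked by blast
  have Fne: "F \<noteq> {}" using F(2) d2 by auto
  have 1: "face_hdim t (induced stacked W) d = (if W = \<Union>stacked then 1 else 0)"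
    if W: "W \<subseteq> \<Union>stacked" "incidence W t" for W and t :: "'v set \<Rightarrow> 'v \<Rightarrow> 'a"
  proof -
    let ?W = "W \<inter> ?V" and ?T = "W \<inter> N"
    have eq: "?W \<union> ?T = W" using split[OF W(1)] by blast
    have iW: "incidence ?W t" by (rule incidence_mono[OF W(2)]) simp
    have h: "int (face_hdim t (induced stacked W) d) = (if ?W = ?V then 1 else 0) + hdim_change d ?W ?T"
      using hdim_stacked[of ?W ?T t d] W(2) sphere_hdim_top[OF _ iW] unfolding eq by simp
    \<comment> \<open>A proper subset of \<open>N\<close> is too small to carry a cross-polytope
      class in degree \<open>d\<close>. With \<open>d \<ge> 2\<close> only the term for the
      fundamental class survives in this degree.\<close>
    have "card ?T \<noteq> d" if "?T \<noteq> N"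
      using that cardN N(1) card_subset_eq[of N ?T] by auto
    then have c: "hdim_change d ?W ?T = - (if ?W = ?V \<and> ?T \<noteq> N then 1 else 0)"
      using d2 by (auto simp: hdim_change_def)
    have "W = \<Union>stacked \<longleftrightarrow> ?W = ?V \<and> ?T = N"
      unfolding vertices_stacked using eq N(2) by blast
    then show ?thesis using h c by (cases "?W = ?V"; cases "?T = N") simp_all
  qed
  have 2: "face_hdim t (induced stacked (\<Union>stacked)) j = 0"
    if t: "incidence (\<Union>stacked) t" "j \<noteq> d" for j and t :: "'v set \<Rightarrow> 'v \<Rightarrow> 'a"
  proof -
    have "incidence ?V t" by (rule incidence_mono[OF t(1)]) (simp add: vertices_stacked)
    then have "int (face_hdim t (induced stacked (\<Union>stacked)) j) = hdim_change j ?V N"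
      using hdim_stacked[of ?V N t j] t sphere_hdim_other[of t j] by (simp add: vertices_stacked)
    moreover have "hdim_change j ?V N = 0" using Fne FV by (auto simp: hdim_change_def)
    ultimately show ?thesis by simp
  qed
  have 3: "\<not> null_face t stacked G"
    if t: "incidence (\<Union>stacked) t" and G: "G \<in> stacked" "card G = d" for G and t :: "'v set \<Rightarrow> 'v \<Rightarrow> 'a"
  proof
    assume "null_face t stacked G"
    then obtain h where h0: "\<And>c. Suc (card c) \<noteq> d \<Longrightarrow> h c = 0"
      and h: "\<And>\<tau>. \<tau> \<in> stacked \<Longrightarrow> coface t h \<tau> = unit_fun G \<tau>"
      using null_faceE[of t stacked G] G(2) by metis
    \<comment> \<open>The uncontrolled value: \<open>F\<close> is not a face of the connected sum,
      so the primitive satisfies no condition there.\<close>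
    define c where "c = coface t h F"
    have GF: "G \<noteq> F" using G(1) by (auto simp: stacked_eq)
    have tV: "incidence ?V t" by (rule incidence_mono[OF t]) (simp add: vertices_stacked)
    have tC: "incidence (F \<union> N) t" by (rule incidence_mono[OF t]) (use FV in \<open>auto simp: vertices_stacked\<close>)
    have finC: "finite (F \<union> N)" using finF N by simp
    have C: "cross F N opp = Pow F \<union> cap F N opp" by (rule cross_eq[OF FN])
    have PF: "Pow F \<subseteq> \<Delta>" using down_closedD[OF pureD(2) F(1)] by blast
    have subD: "\<Delta> \<subseteq> glued" by (simp add: glued_def)
    have subC: "cross F N opp \<subseteq> glued" using PF by (auto simp: C glued_def)
    have Dv: "coface t h \<tau> = (if \<tau> = F then c else unit_fun G \<tau>)" if "\<tau> \<in> glued" for \<tau>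
      using h[of \<tau>] that by (auto simp: c_def stacked_eq)
    have null: "null_face t X H" if X: "down_closed X" "X \<subseteq> glued" "H \<in> X" "card H = d" and "a \<noteq> 0"
      and e: "\<And>\<tau>. \<tau> \<in> X \<Longrightarrow> coface t h \<tau> = a * unit_fun H \<tau>" for X H a
    proof (rule null_faceI[where h = "fscale (1 / a) h", OF X(1,3)])
      show "fscale (1 / a) h c = 0" if "Suc (card c) \<noteq> card H" for c using h0 that X(4) by simp
      show "coface t (fscale (1 / a) h) \<tau> = unit_fun H \<tau>" if "\<tau> \<in> X" for \<tau>
        using e[OF that] \<open>a \<noteq> 0\<close> by (simp add: flinear_scale[OF flinear_coface])
    qed
    have F0: "c = 0" if "G \<in> cap F N opp"
    proof (rule ccontr)
      assume "c \<noteq> 0"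
      have "G \<inter> N \<noteq> {}" using that by (simp add: cap_def)
      then have GD: "G \<notin> \<Delta>" using N(2) by blast
      have "null_face t \<Delta> F"
      proof (rule null[OF pureD(2) subD F(1,2) \<open>c \<noteq> 0\<close>])
        fix \<tau> assume "\<tau> \<in> \<Delta>"
        then have "\<tau> \<noteq> G" "\<tau> \<in> glued" using GD subD by auto
        then show "coface t h \<tau> = c * unit_fun F \<tau>" using Dv by (simp add: unit_fun_def)
      qed
      then show False using sphere_facet_not_null[OF tV F] by blast
    qed
    have F1: "c = 0" if "G \<notin> cap F N opp"
    proof (rule ccontr)
      assume "c \<noteq> 0"
      have "\<not> G \<subseteq> F" using GF G(2) F(2) finF card_subset_eq by metis
      then have GC: "G \<notin> cross F N opp" using that unfolding C by blast
      have "F \<in> cross F N opp" unfolding C by blast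
      then have "null_face t (cross F N opp) F"
      proof (rule null[OF down_closed_cross subC _ F(2) \<open>c \<noteq> 0\<close>])
        fix \<tau> assume "\<tau> \<in> cross F N opp"
        then have "\<tau> \<noteq> G" "\<tau> \<in> glued" using GC subC by auto
        then show "coface t h \<tau> = c * unit_fun F \<tau>" using Dv by (simp add: unit_fun_def)
      qed
      then show False using cross_base_not_null[OF finC tC FN opp Fne] by blast
    qed
    have c0: "c = 0" using F0 F1 by blast
    show False
    proof (cases "G \<in> cap F N opp")
      case True
      have GC: "G \<in> cross F N opp" using True unfolding C by blast
      have "null_face t (cross F N opp) G"
      proof (rule null[OF down_closed_cross subC GC G(2), of 1])
        fix \<tau> assume "\<tau> \<in> cross F N opp"
        then show "coface t h \<tau> = 1 * unit_fun G \<tau>" using subsetD[OF subC] c0 GF by (cases "\<tau> = G") (simp_all add: Dv unit_fun_def)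
      qed simp
      moreover note GC
      ultimately show False using cross_facet_not_null[OF finF FN opp Fne tC, of G] G(2) F(2) by simp
    next
      case False
      then have GD: "G \<in> \<Delta>" using G(1) by (simp add: stacked_def)
      have "null_face t \<Delta> G"
      proof (rule null[OF pureD(2) subD GD G(2), of 1])
        fix \<tau> assume "\<tau> \<in> \<Delta>"
        then show "coface t h \<tau> = 1 * unit_fun G \<tau>" using subsetD[OF subD] c0 GF by (cases "\<tau> = G") (simp_all add: Dv unit_fun_def)
      qed simp
      then show False using sphere_facet_not_null[OF tV GD G(2)] by blast
    qed
  qed
  show ?thesis unfolding sphere_type_def using 1 2 3 by blast
qed

end

end

section \<open>Betti numbers of stacked cross-polytopal spheres\<close>

lemma sum_subsets_disjoint_union:
  fixes f :: "'v set \<Rightarrow> 'b::comm_monoid_add"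
  assumes V: "finite V" and N: "finite N" and VN: "V \<inter> N = {}"
  shows "(\<Sum>W | W \<subseteq> V \<union> N \<and> card W = p. f W) =
    (\<Sum>s\<le>min (card N) p. \<Sum>T | T \<subseteq> N \<and> card T = s. \<Sum>W | W \<subseteq> V \<and> card W = p - s. f (W \<union> T))"
proof -
  let ?P = "\<lambda>T. {W. W \<subseteq> V \<and> card W = p - card T}"
  let ?N = "{T. T \<subseteq> N \<and> card T \<le> p}"
  have finN: "finite ?N" using N by simp
  have finP: "finite (?P T)" for T using V by simp
  have card_Un: "card (W \<union> T) = card W + card T" if "W \<subseteq> V" "T \<subseteq> N" for W T
    using VN that finite_subset[OF that(1) V] finite_subset[OF that(2) N] by (intro card_Un_disjoint) auto
  have "(\<Sum>s\<le>min (card N) p. \<Sum>T | T \<subseteq> N \<and> card T = s. \<Sum>W | W \<subseteq> V \<and> card W = p - s. f (W \<union> T))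
    = (\<Sum>s\<le>min (card N) p. \<Sum>T | T \<in> ?N \<and> card T = s. \<Sum>W\<in>?P T. f (W \<union> T))"
    by (intro sum.cong) auto
  also have "\<dots> = (\<Sum>T\<in>?N. \<Sum>W\<in>?P T. f (W \<union> T))"
    by (rule sum.group[OF finN]) (auto simp: card_mono[OF N])
  also have "\<dots> = (\<Sum>(T, W)\<in>Sigma ?N ?P. f (W \<union> T))"
    by (rule sum.Sigma) (use finN finP in auto)
  also have "\<dots> = (\<Sum>W | W \<subseteq> V \<union> N \<and> card W = p. f W)"
  proof (rule sum.reindex_bij_witness[where i = "\<lambda>W. (W \<inter> N, W \<inter> V)" and j = "\<lambda>(T, W). W \<union> T"])
    fix W assume W: "W \<in> {W. W \<subseteq> V \<union> N \<and> card W = p}"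
    then have e: "(W \<inter> V) \<union> (W \<inter> N) = W" by blast
    then have "card W = card (W \<inter> V) + card (W \<inter> N)" using card_Un[of "W \<inter> V" "W \<inter> N"] by simp
    then show "(W \<inter> N, W \<inter> V) \<in> Sigma ?N ?P" using W by auto
    show "(case (W \<inter> N, W \<inter> V) of (T, W) \<Rightarrow> W \<union> T) = W" using e by simp
  next
    fix x assume x: "x \<in> Sigma ?N ?P"
    then obtain T W where TW: "x = (T, W)" "T \<subseteq> N" "card T \<le> p" "W \<subseteq> V" "card W = p - card T" by blast
    show "((case x of (T, W) \<Rightarrow> W \<union> T) \<inter> N, (case x of (T, W) \<Rightarrow> W \<union> T) \<inter> V) = x"
      using TW VN by auto
    show "(case x of (T, W) \<Rightarrow> W \<union> T) \<in> {W. W \<subseteq> V \<union> N \<and> card W = p}"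
      using TW card_Un[of W T] by auto
    show "f (case x of (T, W) \<Rightarrow> W \<union> T) = (case x of (T, W) \<Rightarrow> f (W \<union> T))" using TW by simp
  qed
  finally show ?thesis by simp
qed

text \<open>Such a set consists of \<open>D\<close> and an arbitrary selection of vertices outside
  \<open>F\<close>.\<close>

lemma card_subsets_trace:
  assumes V: "finite V" and DF: "D \<subseteq> F" "F \<subseteq> V"
  shows "card {W. W \<subseteq> V \<and> card W = q \<and> W \<inter> F = D} =
    (if card D \<le> q then card (V - F) choose (q - card D) else 0)"
proof -
  have finD: "finite D" using DF by (intro finite_subset[OF _ V]) auto
  have card_Un: "card (R \<union> D) = card R + card D" if "R \<subseteq> V - F" for R
    using that finD DF finite_subset[OF that finite_Diff[OF V]] by (intro card_Un_disjoint) auto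
  show ?thesis
  proof (cases "card D \<le> q")
    case True
    have bij: "bij_betw (\<lambda>R. R \<union> D) {R. R \<subseteq> V - F \<and> card R = q - card D} {W. W \<subseteq> V \<and> card W = q \<and> W \<inter> F = D}"
    proof (rule bij_betw_byWitness[where f' = "\<lambda>W. W - F"])
      show "(\<lambda>R. R \<union> D) ` {R. R \<subseteq> V - F \<and> card R = q - card D} \<subseteq> {W. W \<subseteq> V \<and> card W = q \<and> W \<inter> F = D}"
        using DF True card_Un by auto
      show "(\<lambda>W. W - F) ` {W. W \<subseteq> V \<and> card W = q \<and> W \<inter> F = D} \<subseteq> {R. R \<subseteq> V - F \<and> card R = q - card D}"
      proof (intro image_subsetI)
        fix W assume W: "W \<in> {W. W \<subseteq> V \<and> card W = q \<and> W \<inter> F = D}"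
        then have "(W - F) \<union> D = W" "W - F \<subseteq> V - F" by blast+
        then have "card W = card (W - F) + card D" using card_Un[of "W - F"] by simp
        then show "W - F \<in> {R. R \<subseteq> V - F \<and> card R = q - card D}" using W by auto
      qed
    qed (use DF in auto)
    show ?thesis using bij_betw_same_card[OF bij] True V by (simp add: n_subsets)
  next
    case False
    have "{W. W \<subseteq> V \<and> card W = q \<and> W \<inter> F = D} = {}"
    proof -
      have "card D \<le> card W" if "W \<subseteq> V" "W \<inter> F = D" for W
        using that V finite_subset by (intro card_mono) auto
      then show ?thesis using False by auto
    qed
    then show ?thesis using False by (simp only: card.empty if_False)
  qed
qed

text \<open>The five terms of \<open>hdim_change\<close>, summed over the old sets of size
  \<open>q\<close> for a fixed new set of size \<open>s\<close>. Of the \<open>(m + 2) * d\<close>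
  old vertices, \<open>(m + 1) * d\<close> lie outside the gluing facet.\<close>

definition hdim_change_sum :: "nat \<Rightarrow> nat \<Rightarrow> nat \<Rightarrow> nat \<Rightarrow> nat \<Rightarrow> int" where
  "hdim_change_sum d m s q j =
     (if s \<ge> 1 \<and> q \<ge> 1 \<and> j = 1 then int ((m + 1) * d choose q) else 0)
     - (if s \<ge> 1 \<and> q = 0 \<and> j = 0 then 1 else 0)
     + (if s \<ge> 1 \<and> s < d \<and> j = s \<and> s \<le> q then int ((m + 1) * d choose (q - s)) else 0)
     + (if s < d \<and> Suc j = d \<and> d \<le> q \<and> q \<noteq> (m + 2) * d then int ((m + 1) * d choose (q - d)) else 0)
     - (if s < d \<and> j = d \<and> q = (m + 2) * d then 1 else 0)"

text \<open>Here \<open>m\<close> counts connected sums, so the complex has \<open>(m + 2) * d\<close> vertices; \<open>p\<close> is the internal degree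
  and \<open>p - j\<close> the homological one.\<close>

fun stacked_betti :: "nat \<Rightarrow> nat \<Rightarrow> nat \<Rightarrow> nat \<Rightarrow> int" where
  "stacked_betti d 0 p j = (if p = 2 * j then int (d choose j) else 0)"
| "stacked_betti d (Suc m) p j =
     (\<Sum>s\<le>min d p. int (d choose s) * (stacked_betti d m (p - s) j + hdim_change_sum d m s (p - s) j))"

text \<open>The signs are indexed by \<open>W\<close>, as in Hochster's formula. In the induction
  step this allows the family to be replaced by the signs of \<open>W \<union> T\<close>, restricted
  to \<open>W\<close>.\<close>

definition has_stacked_betti :: "'a::field itself \<Rightarrow> nat \<Rightarrow> nat \<Rightarrow> 'v set set \<Rightarrow> bool" where
  "has_stacked_betti K d m \<Delta> \<longleftrightarrow> card (\<Union>\<Delta>) = (m + 2) * d \<and>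
     (\<forall>t :: 'v set \<Rightarrow> 'v set \<Rightarrow> 'v \<Rightarrow> 'a. (\<forall>W\<subseteq>\<Union>\<Delta>. incidence W (t W)) \<longrightarrow>
        (\<forall>p j. (\<Sum>W | W \<subseteq> \<Union>\<Delta> \<and> card W = p. int (face_hdim (t W) (induced \<Delta> W) j)) = stacked_betti d m p j))"

lemma sum_indicator_card: "finite S \<Longrightarrow> (\<Sum>x\<in>S. if P x then 1 else 0 :: int) = int (card {x \<in> S. P x})"
  by (simp add: sum.If_cases Int_def)

context stacking
begin

lemma sum_hdim_change:
  assumes V: "card (\<Union>\<Delta>) = (m + 2) * d" and T: "T \<subseteq> N"
  shows "(\<Sum>W | W \<subseteq> \<Union>\<Delta> \<and> card W = q. hdim_change j W T) = hdim_change_sum d m (card T) q j"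
proof -
  let ?V = "\<Union>\<Delta>" and ?S = "{W. W \<subseteq> \<Union>\<Delta> \<and> card W = q}"
  have finV: "finite ?V" by (rule pureD(1))
  then have finS: "finite ?S" by simp
  have finT: "finite T" using T N finite_subset by blast
  have r: "card (?V - F) = (m + 1) * d"
    using card_Diff_subset[OF finF FV] V F(2) by (simp add: algebra_simps)
  have img: "opp ` N = F" "inj_on opp N" using opp by (auto simp: bij_betw_def)
  have Tne: "T \<noteq> {} \<longleftrightarrow> card T \<ge> 1" using finT by (simp add: Suc_le_eq card_gt_0_iff)
  have TN: "T \<noteq> N \<longleftrightarrow> card T < d" using psubset_card_mono[OF N(1), of T] T cardN by auto
  have empty: "W = {} \<longleftrightarrow> q = 0" if "W \<in> ?S" for W
    using that finV finite_subset[of W ?V] by auto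
  have full: "W = ?V \<longleftrightarrow> q = (m + 2) * d" if "W \<in> ?S" for W
    using that V card_subset_eq[OF finV, of W] by auto
  have 1: "(\<Sum>W\<in>?S. if T \<noteq> {} \<and> W \<inter> F = {} \<and> W \<noteq> {} \<and> j = 1 then 1 else 0 :: int) =
      (if card T \<ge> 1 \<and> q \<ge> 1 \<and> j = 1 then int ((m + 1) * d choose q) else 0)"
  proof -
    have "{W \<in> ?S. T \<noteq> {} \<and> W \<inter> F = {} \<and> W \<noteq> {} \<and> j = 1} =
      (if card T \<ge> 1 \<and> q \<ge> 1 \<and> j = 1 then {W. W \<subseteq> ?V \<and> card W = q \<and> W \<inter> F = {}} else {})"
      using empty Tne by auto
    then show ?thesis
      using card_subsets_trace[OF finV, of "{}" F q] FV
      by (simp only: sum_indicator_card[OF finS] r) auto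
  qed
  have 2: "(\<Sum>W\<in>?S. if T \<noteq> {} \<and> W = {} \<and> j = 0 then 1 else 0 :: int) =
      (if card T \<ge> 1 \<and> q = 0 \<and> j = 0 then 1 else 0)"
  proof -
    have "{W \<in> ?S. T \<noteq> {} \<and> W = {} \<and> j = 0} = (if card T \<ge> 1 \<and> q = 0 \<and> j = 0 then {{}} else {})"
      using empty Tne by auto
    then show ?thesis by (simp only: sum_indicator_card[OF finS]) auto
  qed
  have 3: "(\<Sum>W\<in>?S. if T \<noteq> {} \<and> T \<noteq> N \<and> opp ` T = W \<inter> F \<and> j = card T then 1 else 0 :: int) =
      (if card T \<ge> 1 \<and> card T < d \<and> j = card T \<and> card T \<le> q then int ((m + 1) * d choose (q - card T)) else 0)"
  proof -
    have sub: "opp ` T \<subseteq> F" using img T by blast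
    have c: "card (opp ` T) = card T" using img(2) T by (intro card_image) (rule inj_on_subset)
    have "{W \<in> ?S. T \<noteq> {} \<and> T \<noteq> N \<and> opp ` T = W \<inter> F \<and> j = card T} =
      (if card T \<ge> 1 \<and> card T < d \<and> j = card T then {W. W \<subseteq> ?V \<and> card W = q \<and> W \<inter> F = opp ` T} else {})"
      using Tne TN by auto
    then show ?thesis
      using card_subsets_trace[OF finV sub FV, of q] unfolding c
      by (simp only: sum_indicator_card[OF finS] r) auto
  qed
  have 4: "(\<Sum>W\<in>?S. if F \<subseteq> W \<and> T \<noteq> N \<and> W \<noteq> ?V \<and> Suc j = d then 1 else 0 :: int) =
      (if card T < d \<and> Suc j = d \<and> d \<le> q \<and> q \<noteq> (m + 2) * d then int ((m + 1) * d choose (q - d)) else 0)"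
  proof -
    have "{W \<in> ?S. F \<subseteq> W \<and> T \<noteq> N \<and> W \<noteq> ?V \<and> Suc j = d} =
      (if card T < d \<and> Suc j = d \<and> q \<noteq> (m + 2) * d then {W. W \<subseteq> ?V \<and> card W = q \<and> W \<inter> F = F} else {})"
      using TN full by auto
    then show ?thesis
      using card_subsets_trace[OF finV subset_refl FV, of q] unfolding F(2)
      by (simp only: sum_indicator_card[OF finS] r) auto
  qed
  have 5: "(\<Sum>W\<in>?S. if W = ?V \<and> T \<noteq> N \<and> j = d then 1 else 0 :: int) =
      (if card T < d \<and> j = d \<and> q = (m + 2) * d then 1 else 0)"
  proof -
    have "{W \<in> ?S. W = ?V \<and> T \<noteq> N \<and> j = d} = (if card T < d \<and> j = d \<and> q = (m + 2) * d then {?V} else {})"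
      using TN full V by auto
    then show ?thesis by (simp only: sum_indicator_card[OF finS]) auto
  qed
  show ?thesis
    unfolding hdim_change_def hdim_change_sum_def sum.distrib sum_subtractf 1 2 3 4 5 ..
qed

lemma has_stacked_betti_stacked:
  assumes sph: "sphere_type TYPE('a::field) d \<Delta>" and B: "has_stacked_betti TYPE('a) d m \<Delta>"
  shows "has_stacked_betti TYPE('a) d (Suc m) stacked"
  unfolding has_stacked_betti_def vertices_stacked
proof (intro conjI allI impI)
  let ?V = "\<Union>\<Delta>"
  have cV: "card ?V = (m + 2) * d" using B by (simp add: has_stacked_betti_def)
  then show "card (?V \<union> N) = (Suc m + 2) * d"
    using card_Un_disjoint[OF pureD(1) N(1)] N(2) cardN by (simp add: Int_commute)
  fix t :: "'v set \<Rightarrow> 'v set \<Rightarrow> 'v \<Rightarrow> 'a" and p j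
  assume t: "\<forall>W\<subseteq>?V \<union> N. incidence W (t W)"
  have VN: "?V \<inter> N = {}" using N by blast
  have inner: "(\<Sum>W | W \<subseteq> ?V \<and> card W = q. int (face_hdim (t (W \<union> T)) (induced stacked (W \<union> T)) j)) =
      stacked_betti d m q j + hdim_change_sum d m (card T) q j" if T: "T \<subseteq> N" for T q
  proof -
    have i: "incidence (W \<union> T) (t (W \<union> T))" if "W \<subseteq> ?V" for W
      using t Un_mono[OF that T] by simp
    have "(\<Sum>W | W \<subseteq> ?V \<and> card W = q. int (face_hdim (t (W \<union> T)) (induced stacked (W \<union> T)) j)) =
      (\<Sum>W | W \<subseteq> ?V \<and> card W = q. int (face_hdim (t (W \<union> T)) (induced \<Delta> W) j) + hdim_change j W T)"
      using i by (intro sum.cong refl hdim_stacked[OF sph _ T]) auto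
    also have "\<dots> = stacked_betti d m q j + hdim_change_sum d m (card T) q j"
    proof -
      \<comment> \<open>For fixed \<open>T\<close> the signs of the larger sets form a legitimate
        family of signs for the old sphere.\<close>
      have "\<forall>W\<subseteq>?V. incidence W (t (W \<union> T))" using i incidence_mono by blast
      then have "(\<Sum>W | W \<subseteq> ?V \<and> card W = q. int (face_hdim (t (W \<union> T)) (induced \<Delta> W) j)) = stacked_betti d m q j"
        using B unfolding has_stacked_betti_def by (elim conjE allE[of _ "\<lambda>W. t (W \<union> T)"]) blast
      then show ?thesis unfolding sum.distrib sum_hdim_change[OF cV T] by simp
    qed
    finally show ?thesis .
  qed
  have "(\<Sum>W | W \<subseteq> ?V \<union> N \<and> card W = p. int (face_hdim (t W) (induced stacked W) j)) =
      (\<Sum>s\<le>min d p. \<Sum>T | T \<subseteq> N \<and> card T = s. stacked_betti d m (p - s) j + hdim_change_sum d m s (p - s) j)"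
    unfolding sum_subsets_disjoint_union[OF pureD(1) N(1) VN] cardN
    by (intro sum.cong refl) (auto simp: inner)
  also have "\<dots> = stacked_betti d (Suc m) p j"
    using N(1) cardN by (simp add: n_subsets)
  finally show "(\<Sum>W | W \<subseteq> ?V \<union> N \<and> card W = p. int (face_hdim (t W) (induced stacked W) j)) =
    stacked_betti d (Suc m) p j" .
qed

end

section \<open>The cross-polytope as the base case\<close>

lemma vertices_cross: "\<Union>(cross A T opp) = A \<union> T" if "A \<inter> T = {}"
proof
  have "{x} \<in> cross A T opp" if "x \<in> A \<union> T" for x
    using that \<open>A \<inter> T = {}\<close> by (auto simp: cross_def)
  then show "A \<union> T \<subseteq> \<Union>(cross A T opp)" by blast
qed (auto simp: cross_def)

text \<open>The induced subcomplex has the same form with some antipodes missing; this is why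
  \<open>cross\<close> does not build in that \<open>opp\<close> is a bijection.\<close>

lemma induced_cross:
  assumes "A \<inter> T = {}" "W \<subseteq> A \<union> T"
  shows "induced (cross A T opp) W = cross (W \<inter> A) (W \<inter> T) opp"
proof (intro equalityI subsetI)
  fix \<sigma> assume s: "\<sigma> \<in> induced (cross A T opp) W"
  then have "\<sigma> \<inter> (W \<inter> A) = \<sigma> \<inter> A" "\<sigma> \<inter> (W \<inter> T) = \<sigma> \<inter> T" by (auto simp: induced_def)
  then show "\<sigma> \<in> cross (W \<inter> A) (W \<inter> T) opp" using s assms unfolding cross_def induced_def by auto
next
  fix \<sigma> assume s: "\<sigma> \<in> cross (W \<inter> A) (W \<inter> T) opp"
  then have "\<sigma> \<subseteq> W" by (auto simp: cross_def)
  then have "\<sigma> \<inter> (W \<inter> A) = \<sigma> \<inter> A" "\<sigma> \<inter> (W \<inter> T) = \<sigma> \<inter> T" by auto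
  then show "\<sigma> \<in> induced (cross A T opp) W" using s assms \<open>\<sigma> \<subseteq> W\<close> unfolding cross_def induced_def by auto
qed

context
  fixes d :: nat and A T :: "'v set" and opp :: "'v \<Rightarrow> 'v"
  assumes fin: "finite A" and cA: "card A = d" and AT: "A \<inter> T = {}" and opp: "bij_betw opp T A" and d1: "d \<ge> 1"
begin

lemma cross_finT: "finite T" "card T = d" "inj_on opp T" "opp ` T = A"
  using bij_betw_finite[OF opp] bij_betw_same_card[OF opp] fin cA opp by (auto simp: bij_betw_def)

lemma hdim_induced_cross:
  assumes W: "W \<subseteq> A \<union> T" "incidence W t"
  shows "face_hdim t (induced (cross A T opp) W) j =
    (if opp ` (W \<inter> T) = W \<inter> A \<and> j = card (W \<inter> T) then 1 else 0)"
  unfolding induced_cross[OF AT W(1)]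
proof (rule hdim_cross)
  have "(W \<inter> A) \<union> (W \<inter> T) = W" using W by blast
  then show "finite ((W \<inter> A) \<union> (W \<inter> T))" "incidence ((W \<inter> A) \<union> (W \<inter> T)) t"
    using W fin cross_finT(1) finite_subset[of W "A \<union> T"] by auto
  show "inj_on opp (W \<inter> T)" using cross_finT(3) by (rule inj_on_subset) auto
qed (use AT in auto)

lemma pure_cross: "pure_complex d (cross A T opp)"
  unfolding pure_complex_def
proof (intro conjI ballI)
  show "finite (\<Union>(cross A T opp))" using fin cross_finT(1) by (simp add: vertices_cross[OF AT])
  show "down_closed (cross A T opp)" by (rule down_closed_cross)
  show "{} \<in> cross A T opp" by (simp add: cross_def)
  fix \<sigma> assume "\<sigma> \<in> cross A T opp"
  then obtain \<tau> where t: "\<tau> \<in> cross A T opp" "\<sigma> \<subseteq> \<tau>" "card \<tau> = card A" "finite \<tau>"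
    by (rule cross_extend[OF fin AT opp])
  then show "\<exists>\<tau>\<in>cross A T opp. \<sigma> \<subseteq> \<tau> \<and> card \<tau> = d" using cA by auto
  show "card \<sigma> \<le> d" using card_mono[OF t(4,2)] t(3) cA by simp
qed

lemma sphere_type_cross: "sphere_type TYPE('a::field) d (cross A T opp)"
proof -
  let ?C = "cross A T opp"
  note V = vertices_cross[OF AT, of opp]
  have Ane: "A \<noteq> {}" using cA d1 by auto
  have 1: "face_hdim t (induced ?C W) d = (if W = A \<union> T then 1 else 0)"
    if "W \<subseteq> A \<union> T" "incidence W t" for W and t :: "'v set \<Rightarrow> 'v \<Rightarrow> 'a"
  proof -
    have "opp ` (W \<inter> T) = W \<inter> A \<and> d = card (W \<inter> T) \<longleftrightarrow> W = A \<union> T"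
    proof
      assume a: "opp ` (W \<inter> T) = W \<inter> A \<and> d = card (W \<inter> T)"
      have "W \<inter> T = T" using a cross_finT by (intro card_subset_eq) auto
      then have "W \<inter> A = A" using a cross_finT(4) by simp
      then show "W = A \<union> T" using \<open>W \<inter> T = T\<close> that(1) by blast
    next
      assume "W = A \<union> T"
      then have "W \<inter> T = T" "W \<inter> A = A" by auto
      then show "opp ` (W \<inter> T) = W \<inter> A \<and> d = card (W \<inter> T)" using cross_finT by simp
    qed
    then show ?thesis using hdim_induced_cross[OF that, of d] by simp
  qed
  have 2: "face_hdim t (induced ?C (A \<union> T)) j = 0"
    if "incidence (A \<union> T) t" "j \<noteq> d" for j and t :: "'v set \<Rightarrow> 'v \<Rightarrow> 'a"
  proof -
    have "(A \<union> T) \<inter> T = T" by blast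
    then show ?thesis using hdim_induced_cross[OF subset_refl that(1), of j] that(2) cross_finT(2) by simp
  qed
  have 3: "\<not> null_face t ?C G" if "incidence (A \<union> T) t" "G \<in> ?C" "card G = d" for G and t :: "'v set \<Rightarrow> 'v \<Rightarrow> 'a"
    using cross_facet_not_null[OF fin AT opp Ane that(1,2)] that(3) cA by simp
  show ?thesis unfolding sphere_type_def V using 1 2 3 by blast
qed

text \<open>A set \<open>W\<close> contributes exactly if it is a union of antipodal pairs, and then
  once, in the degree given by the number of pairs. These are the Betti numbers of a complete
  intersection of \<open>d\<close> quadrics.\<close>

lemma has_stacked_betti_cross: "has_stacked_betti TYPE('a::field) d 0 (cross A T opp)"
  unfolding has_stacked_betti_def vertices_cross[OF AT]
proof (intro conjI allI impI)
  show "card (A \<union> T) = (0 + 2) * d"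
    using card_Un_disjoint[OF fin cross_finT(1) AT] cA cross_finT(2) by simp
  fix t :: "'v set \<Rightarrow> 'v set \<Rightarrow> 'v \<Rightarrow> 'a" and p j
  assume t: "\<forall>W\<subseteq>A \<union> T. incidence W (t W)"
  let ?S = "{W. W \<subseteq> A \<union> T \<and> card W = p}"
  have finS: "finite ?S" using fin cross_finT(1) by simp
  have "(\<Sum>W\<in>?S. int (face_hdim (t W) (induced (cross A T opp) W) j)) =
      (\<Sum>W\<in>?S. if opp ` (W \<inter> T) = W \<inter> A \<and> j = card (W \<inter> T) then 1 else 0)"
    using t by (intro sum.cong refl) (simp add: hdim_induced_cross)
  also have "\<dots> = int (card {W \<in> ?S. opp ` (W \<inter> T) = W \<inter> A \<and> j = card (W \<inter> T)})"
    by (rule sum_indicator_card[OF finS])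
  also have "{W \<in> ?S. opp ` (W \<inter> T) = W \<inter> A \<and> j = card (W \<inter> T)} =
      (if p = 2 * j then (\<lambda>B. opp ` B \<union> B) ` {B. B \<subseteq> T \<and> card B = j} else {})" (is "?L = ?R")
  proof -
    have c: "card (opp ` B \<union> B) = 2 * card B" if "B \<subseteq> T" for B
    proof -
      have "finite B" "opp ` B \<inter> B = {}" using that cross_finT AT finite_subset by blast+
      moreover have "card (opp ` B) = card B" using cross_finT(3) that by (intro card_image) (rule inj_on_subset)
      ultimately show ?thesis by (simp add: card_Un_disjoint)
    qed
    have i: "(opp ` B \<union> B) \<inter> T = B" "(opp ` B \<union> B) \<inter> A = opp ` B" if "B \<subseteq> T" for B
      using that cross_finT(4) AT by auto
    have "W \<in> ?L \<longleftrightarrow> W \<in> ?R" for W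
    proof
      assume W: "W \<in> ?L"
      then have e: "W = opp ` (W \<inter> T) \<union> (W \<inter> T)" by blast
      then have "card W = 2 * card (W \<inter> T)" using c[of "W \<inter> T"] by simp
      then have "p = 2 * j" "W \<inter> T \<in> {B. B \<subseteq> T \<and> card B = j}" using W by auto
      then show "W \<in> ?R" using imageI[of "W \<inter> T" _ "\<lambda>B. opp ` B \<union> B"] e by simp
    next
      assume "W \<in> ?R"
      then obtain B where B: "W = opp ` B \<union> B" "B \<subseteq> T" "card B = j" "p = 2 * j" by (auto split: if_splits)
      then show "W \<in> ?L" using c[OF B(2)] i[OF B(2)] cross_finT(4) by auto
    qed
    then show ?thesis by (rule set_eqI)
  qed
  also have "int (card \<dots>) = stacked_betti d 0 p j"
  proof -
    have "inj_on (\<lambda>B. opp ` B \<union> B) {B. B \<subseteq> T \<and> card B = j}"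
    proof (rule inj_onI)
      fix B B' assume a: "B \<in> {B. B \<subseteq> T \<and> card B = j}" "B' \<in> {B. B \<subseteq> T \<and> card B = j}"
        and e: "opp ` B \<union> B = opp ` B' \<union> B'"
      have "(opp ` D \<union> D) \<inter> T = D" if "D \<subseteq> T" for D using that cross_finT(4) AT by auto
      then have "(opp ` B \<union> B) \<inter> T = B" "(opp ` B' \<union> B') \<inter> T = B'" using a by blast+
      then show "B = B'" unfolding e by simp
    qed
    then show ?thesis using cross_finT by (simp add: card_image n_subsets)
  qed
  finally show "(\<Sum>W\<in>?S. int (face_hdim (t W) (induced (cross A T opp) W) j)) = stacked_betti d 0 p j" .
qed

end

text \<open>Renaming \<open>G\<close> to \<open>F\<close> sends the proper faces of \<open>G\<close>
  to faces already present in \<open>\<Delta>\<close> and all other faces of the cross-polytope to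
  the cap. The antipode of a new vertex becomes the vertex of \<open>F\<close> identified with its
  old antipode.\<close>

lemma connected_sum_cross:
  assumes VN: "V \<inter> N = {}" and FV: "F \<subseteq> V" and GN: "G \<inter> N = {}" and \<phi>: "bij_betw \<phi> F G"
    and q: "bij_betw q N G" and D: "\<Delta> \<subseteq> Pow V" "Pow F \<subseteq> \<Delta>"
  shows "connected_sum \<Delta> F (cross G N q) G \<phi> = (\<Delta> - {F}) \<union> cap F N (inv_into F \<phi> \<circ> q)"
proof -
  let ?\<psi> = "inv_into F \<phi>"
  let ?\<rho> = "\<lambda>x. if x \<in> G then ?\<psi> x else x"
  have img: "\<phi> ` F = G" "inj_on \<phi> F" using \<phi> by (auto simp: bij_betw_def)
  have \<psi>F: "?\<psi> x \<in> F" if "x \<in> G" for x using that img by (metis inv_into_into)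
  have \<phi>\<psi>: "\<phi> (?\<psi> x) = x" if "x \<in> G" for x using bij_betw_inv_into_right[OF \<phi> that] .
  have \<psi>\<phi>: "?\<psi> (\<phi> x) = x" if "x \<in> F" for x using bij_betw_inv_into_left[OF \<phi> that] .
  have qG: "q w \<in> G" if "w \<in> N" for w using q that by (auto simp: bij_betw_def)
  have FN: "F \<inter> N = {}" using FV VN by blast
  have le: "(\<lambda>A. ?\<rho> ` A) ` (cross G N q - {G}) \<subseteq> (\<Delta> - {F}) \<union> cap F N (?\<psi> \<circ> q)"
  proof (intro image_subsetI)
    fix \<sigma> assume s: "\<sigma> \<in> cross G N q - {G}"
    have im: "?\<rho> ` \<sigma> = ?\<psi> ` (\<sigma> \<inter> G) \<union> (\<sigma> \<inter> N)"
      using s GN by (auto simp: cross_def image_iff)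
    show "?\<rho> ` \<sigma> \<in> (\<Delta> - {F}) \<union> cap F N (?\<psi> \<circ> q)"
    proof (cases "\<sigma> \<inter> N = {}")
      case True
      then have sG: "\<sigma> \<subseteq> G" "\<sigma> \<noteq> G" using s by (auto simp: cross_def)
      then have e: "?\<rho> ` \<sigma> = ?\<psi> ` \<sigma>" using True im by (simp add: Int_absorb2)
      have "?\<psi> ` \<sigma> \<subseteq> F" using \<psi>F sG by blast
      \<comment> \<open>The identification is injective, so a proper face of \<open>G\<close> cannot
        become the deleted facet \<open>F\<close>.\<close>
      moreover have "?\<psi> ` \<sigma> \<noteq> F"
      proof
        assume "?\<psi> ` \<sigma> = F"
        then have "\<phi> ` ?\<psi> ` \<sigma> = G" using img by simp
        moreover have "\<phi> ` ?\<psi> ` \<sigma> = (\<lambda>x. x) ` \<sigma>"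
          unfolding image_image by (rule image_cong) (use \<phi>\<psi> sG in auto)
        ultimately show False using sG by simp
      qed
      ultimately show ?thesis unfolding e using D(2) by blast
    next
      case False
      have iN: "?\<rho> ` \<sigma> \<inter> N = \<sigma> \<inter> N" unfolding im using \<psi>F FN by blast
      have iF: "?\<rho> ` \<sigma> \<inter> F = ?\<psi> ` (\<sigma> \<inter> G)" unfolding im using \<psi>F FN by blast
      have "?\<psi> ` (\<sigma> \<inter> G) \<inter> (?\<psi> \<circ> q) ` (\<sigma> \<inter> N) = {}"
      proof (rule ccontr)
        assume "\<not> ?thesis"
        then obtain x w where xw: "x \<in> \<sigma>" "x \<in> G" "w \<in> \<sigma>" "w \<in> N" "?\<psi> x = ?\<psi> (q w)" by auto
        then have "x = q w" using \<phi>\<psi>[of x] \<phi>\<psi>[of "q w"] qG by metis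
        then show False using s xw by (auto simp: cross_def)
      qed
      then have "?\<rho> ` \<sigma> \<in> cap F N (?\<psi> \<circ> q)"
        using False \<psi>F im unfolding cap_def mem_Collect_eq iN iF by auto
      then show ?thesis by blast
    qed
  qed
  have ge: "cap F N (?\<psi> \<circ> q) \<subseteq> (\<lambda>A. ?\<rho> ` A) ` (cross G N q - {G})"
  proof
    fix \<sigma> assume s: "\<sigma> \<in> cap F N (?\<psi> \<circ> q)"
    let ?\<tau> = "\<phi> ` (\<sigma> \<inter> F) \<union> (\<sigma> \<inter> N)"
    have tG: "?\<tau> \<inter> G = \<phi> ` (\<sigma> \<inter> F)" "?\<tau> \<inter> N = \<sigma> \<inter> N" using img GN by blast+
    have "\<phi> ` (\<sigma> \<inter> F) \<inter> q ` (\<sigma> \<inter> N) = {}"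
    proof (rule ccontr)
      assume "\<not> ?thesis"
      then obtain x w where xw: "x \<in> \<sigma>" "x \<in> F" "w \<in> \<sigma>" "w \<in> N" "\<phi> x = q w" by auto
      then have "x = (?\<psi> \<circ> q) w" using \<psi>\<phi>[of x] by simp
      then have "x \<in> \<sigma> \<inter> F \<inter> (?\<psi> \<circ> q) ` (\<sigma> \<inter> N)" using xw by blast
      then show False using s unfolding cap_def by blast
    qed
    then have "?\<tau> \<in> cross G N q" using img unfolding cross_def mem_Collect_eq tG by blast
    moreover have "?\<tau> \<noteq> G" using s tG(2) GN by (auto simp: cap_def)
    moreover have "?\<rho> ` ?\<tau> = \<sigma>"
    proof -
      have "?\<rho> ` ?\<tau> = ?\<rho> ` \<phi> ` (\<sigma> \<inter> F) \<union> ?\<rho> ` (\<sigma> \<inter> N)" by (rule image_Un)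
      also have "?\<rho> ` \<phi> ` (\<sigma> \<inter> F) = (\<lambda>x. x) ` (\<sigma> \<inter> F)"
        unfolding image_image by (rule image_cong) (use img \<psi>\<phi> in auto)
      also have "?\<rho> ` (\<sigma> \<inter> N) = (\<lambda>x. x) ` (\<sigma> \<inter> N)" by (rule image_cong) (use GN in auto)
      finally show ?thesis using s by (auto simp: cap_def)
    qed
    ultimately show "\<sigma> \<in> (\<lambda>A. ?\<rho> ` A) ` (cross G N q - {G})" by blast
  qed
  have "I \<subseteq> X \<union> C \<Longrightarrow> C \<subseteq> I \<Longrightarrow> X \<union> I = X \<union> C" for I X C :: "'a set set" by blast
  from this[OF le ge] show ?thesis unfolding connected_sum_def .
qed

definition stacked_sphere :: "'a::field itself \<Rightarrow> nat \<Rightarrow> nat \<Rightarrow> 'v set set \<Rightarrow> bool" where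
  "stacked_sphere K d m \<Delta> \<longleftrightarrow>
     pure_complex d \<Delta> \<and> sphere_type TYPE('a) d \<Delta> \<and> has_stacked_betti TYPE('a) d m \<Delta>"

lemma stacked_sphere_cross_polytope:
  assumes "cross_polytope_boundary d \<Delta>" "d \<ge> 1"
  shows "stacked_sphere TYPE('a::field) d 0 \<Delta>"
proof -
  obtain A T opp where C: "finite A" "card A = d" "A \<inter> T = {}" "bij_betw opp T A" "\<Delta> = cross A T opp"
    by (rule cross_polytope_boundary_cross[OF assms(1)])
  show ?thesis
    unfolding stacked_sphere_def C(5)
    using pure_cross[OF C(1-4) assms(2)] sphere_type_cross[OF C(1-4) assms(2)]
      has_stacked_betti_cross[OF C(1-4) assms(2)] by blast
qed

lemma stacked_sphere_connected_sum:
  assumes d: "d \<ge> 2" and \<Delta>: "stacked_sphere TYPE('a::field) d m \<Delta>" and \<Gamma>: "cross_polytope_boundary d \<Gamma>"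
    and disj: "\<Union>\<Delta> \<inter> \<Union>\<Gamma> = {}" and FG: "F \<in> facets \<Delta>" "G \<in> facets \<Gamma>" and \<phi>: "bij_betw \<phi> F G"
  shows "stacked_sphere TYPE('a) d (Suc m) (connected_sum \<Delta> F \<Gamma> G \<phi>)"
proof -
  have pure: "pure_complex d \<Delta>" and sph: "sphere_type TYPE('a) d \<Delta>" and B: "has_stacked_betti TYPE('a) d m \<Delta>"
    using \<Delta> by (auto simp: stacked_sphere_def)
  have d1: "d \<ge> 1" using d by simp
  obtain A T opp where C: "finite A" "card A = d" "A \<inter> T = {}" "bij_betw opp T A" "\<Gamma> = cross A T opp"
    by (rule cross_polytope_boundary_cross[OF \<Gamma>])
  have F: "F \<in> \<Delta>" "card F = d" using FG(1) facets_pure_complex[OF pure] by auto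
  have G: "G \<in> cross A T opp" "card G = card A"
    using FG(2) facets_pure_complex[OF pure_cross[OF C(1-4) d1]] C(2,5) by auto
  obtain q where q: "cross A T opp = cross G (A \<union> T - G) q" "bij_betw q (A \<union> T - G) G"
    "G \<subseteq> A \<union> T" "card (A \<union> T - G) = card A"
    by (rule cross_facet[OF C(1,3,4) G])
  let ?N = "A \<union> T - G"
  have V\<Gamma>: "\<Union>\<Gamma> = A \<union> T" unfolding C(5) by (rule vertices_cross[OF C(3)])
  have N: "finite ?N" "?N \<inter> \<Union>\<Delta> = {}"
    using C(1) bij_betw_finite[OF C(4)] disj V\<Gamma> by auto
  have q': "bij_betw (inv_into F \<phi> \<circ> q) ?N F"
    by (rule bij_betw_trans[OF q(2) bij_betw_inv_into[OF \<phi>]])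
  interpret stacking d \<Delta> F ?N "inv_into F \<phi> \<circ> q"
    by unfold_locales (fact pure d F N q')+
  have "connected_sum \<Delta> F \<Gamma> G \<phi> = stacked"
    unfolding C(5) q(1) stacked_def
  proof (rule connected_sum_cross[of "\<Union>\<Delta>"])
    show "\<Union>\<Delta> \<inter> ?N = {}" using N(2) by blast
    show "Pow F \<subseteq> \<Delta>" using down_closedD[OF pureD(2) F(1)] by blast
  qed (use F \<phi> q(2) in auto)
  then show ?thesis
    using pure_stacked sphere_type_stacked[OF sph] has_stacked_betti_stacked[OF sph B]
    by (simp add: stacked_sphere_def)
qed

lemma cross_polytope_boundary_1:
  "cross_polytope_boundary 1 \<Delta> \<longleftrightarrow> (\<exists>a b. a \<noteq> b \<and> \<Delta> = {{}, {a}, {b}})"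
proof -
  have S: "{\<Union>(\<sigma> ` {..<1::nat}) | \<sigma>. \<forall>i<1::nat. \<sigma> i \<in> {{}, {v i}, {w i}}} = {{}, {v 0}, {w 0}}" for v w :: "nat \<Rightarrow> 'a"
  proof -
    have "\<Union>(\<sigma> ` {..<1::nat}) = \<sigma> 0" for \<sigma> :: "nat \<Rightarrow> 'a set" by auto
    moreover have "\<exists>\<sigma>. \<sigma> (0::nat) = s" for s :: "'a set" by (rule exI[of _ "\<lambda>_. s"]) simp
    ultimately show ?thesis by (auto simp: less_Suc_eq)
  qed
  show ?thesis
    unfolding cross_polytope_boundary_def S
  proof
    assume "\<exists>(v :: nat \<Rightarrow> 'a) (w :: nat \<Rightarrow> 'a). inj_on v {..<1} \<and> inj_on w {..<1} \<and> v ` {..<1} \<inter> w ` {..<1} = {} \<and> \<Delta> = {{}, {v 0}, {w 0}}"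
    then show "\<exists>a b. a \<noteq> b \<and> \<Delta> = {{}, {a}, {b}}"
    proof (elim exE conjE)
      fix v w :: "nat \<Rightarrow> 'a"
      assume "v ` {..<1} \<inter> w ` {..<1} = {}" "\<Delta> = {{}, {v 0}, {w 0}}"
      then have "v 0 \<noteq> w 0 \<and> \<Delta> = {{}, {v 0}, {w 0}}" by auto
      then show ?thesis by (intro exI)
    qed
  next
    assume "\<exists>a b. a \<noteq> b \<and> \<Delta> = {{}, {a}, {b}}"
    then obtain a b where "a \<noteq> b" "\<Delta> = {{}, {a}, {b}}" by blast
    then show "\<exists>(v :: nat \<Rightarrow> 'a) (w :: nat \<Rightarrow> 'a). inj_on v {..<1} \<and> inj_on w {..<1} \<and> v ` {..<1} \<inter> w ` {..<1} = {} \<and> \<Delta> = {{}, {v 0}, {w 0}}"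
      by (intro exI[of _ "\<lambda>_. a"] exI[of _ "\<lambda>_. b"]) (auto simp: inj_on_def)
  qed
qed

text \<open>In dimension \<open>d = 1\<close> a connected sum loses both glued vertices, so it is again a
  zero-sphere and the number of vertices does not grow.\<close>

lemma stacked_dimension_1:
  assumes "stacked_cross_polytopal 1 \<Delta>"
  shows "cross_polytope_boundary 1 \<Delta>"
  using assms
proof (induction rule: stacked_cross_polytopal.induct)
  case (connected_sum \<Delta> \<Gamma> F G \<phi>)
  obtain a b where D: "a \<noteq> b" "\<Delta> = {{}, {a}, {b}}"
    using connected_sum.IH unfolding cross_polytope_boundary_1 by blast
  obtain g h where E: "g \<noteq> h" "\<Gamma> = {{}, {g}, {h}}"
    using connected_sum.hyps(2) unfolding cross_polytope_boundary_1 by blast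
  have "F \<in> {{a}, {b}}" "G \<in> {{g}, {h}}"
    using connected_sum.hyps(4,5) D E by (auto simp: facets_def)
  then obtain b' h' where b': "\<Delta> - {F} = {{}, {b'}}" "b' \<in> \<Union>\<Delta>"
    and h': "\<Gamma> - {G} = {{}, {h'}}" "h' \<in> \<Union>\<Gamma>" "h' \<notin> G"
    using D E by fastforce
  have "b' \<noteq> h'" using b'(2) h'(2) connected_sum.hyps(3) by blast
  moreover have "connected_sum \<Delta> F \<Gamma> G \<phi> = {{}, {b'}, {h'}}"
    unfolding connected_sum_def b'(1) h'(1) using h'(3) by auto
  ultimately show ?case unfolding cross_polytope_boundary_1 by blast
qed

text \<open>The number \<open>m\<close> counts the gluings that add vertices. For
  \<open>d = 1\<close> there are none, and \<open>m = 0\<close> serves throughout.\<close>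

lemma stacked_sphere_stacked:
  assumes "stacked_cross_polytopal d \<Delta>" "d \<ge> 1"
  shows "\<exists>m. stacked_sphere TYPE('a::field) d m \<Delta>"
proof (cases "d = 1")
  case True
  then show ?thesis
    using stacked_dimension_1 stacked_sphere_cross_polytope assms by blast
next
  case False
  with assms(2) have d: "d \<ge> 2" by simp
  from assms(1) show ?thesis
  proof (induction rule: stacked_cross_polytopal.induct)
    case (cross_polytope \<Delta>)
    then show ?case using stacked_sphere_cross_polytope assms(2) by blast
  next
    case (connected_sum \<Delta> \<Gamma> F G \<phi>)
    then show ?case using stacked_sphere_connected_sum[OF d] by blast
  qed
qed

text \<open>Since \<open>d \<ge> 1\<close>, the number of vertices determines \<open>m\<close>,
  however the gluing facets and identifications were chosen.\<close>

lemma betti_stacked: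
  fixes \<Delta> :: "'v set set"
  assumes "stacked_cross_polytopal_on d n \<Delta>" "d \<ge> 1" and n: "n = (m + 2) * d"
  shows "int (betti TYPE('a::field) \<Delta> i (i + j)) =
    (if i < 0 \<or> j < 0 then 0 else stacked_betti d m (nat i + nat j) (nat j))"
proof -
  obtain m' where s: "stacked_sphere TYPE('a) d m' \<Delta>"
    using stacked_sphere_stacked assms(1,2) unfolding stacked_cross_polytopal_on_def by blast
  have pure: "pure_complex d \<Delta>" and B: "has_stacked_betti TYPE('a) d m' \<Delta>"
    using s by (auto simp: stacked_sphere_def)
  have "(m' + 2) * d = (m + 2) * d"
    using assms(1) n B unfolding stacked_cross_polytopal_on_def has_stacked_betti_def by metis
  then have m: "m' = m" using assms(2) by simp
  note D = pure_complexD(1,2)[OF pure]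
  have "\<forall>W\<subseteq>\<Union>\<Delta>. incidence W (hsign (\<Union>\<Delta>) W :: 'v set \<Rightarrow> 'v \<Rightarrow> 'a)"
    using incidence_hsign[OF D(1)] by blast
  then have "(\<Sum>W | W \<subseteq> \<Union>\<Delta> \<and> card W = p. int (face_hdim (hsign (\<Union>\<Delta>) W :: 'v set \<Rightarrow> 'v \<Rightarrow> 'a) (induced \<Delta> W) j))
      = stacked_betti d m p j" for p j
    using B unfolding has_stacked_betti_def m by blast
  then show ?thesis unfolding betti_hochster[OF D] by simp
qed

section \<open>The numerical recursion and the closed formula\<close>

lemma stacked_betti_below: "q < j \<Longrightarrow> stacked_betti d m q j = 0"
proof (induction m arbitrary: q)
  case (Suc m)
  have "stacked_betti d m (q - s) j + hdim_change_sum d m s (q - s) j = 0" if "s \<le> min d q" for s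
  proof -
    have "d \<le> (m + 2) * d" by simp
    then have "hdim_change_sum d m s (q - s) j = 0" using Suc.prems that unfolding hdim_change_sum_def by auto
    then show ?thesis using Suc.IH[of "q - s"] Suc.prems by simp
  qed
  then show ?case by simp
qed simp

lemma sum_int_interval: "(\<Sum>l = 0..int d. f l) = (\<Sum>s\<le>d. f (int s))"
proof -
  have "{0..int d} = int ` {0..d}" using image_int_atLeastAtMost[of 0 d] by simp
  then show ?thesis by (simp add: sum.reindex atLeast0AtMost)
qed


lemma sum_int_interval_1: "(\<Sum>l = 1..int d. f l) = (\<Sum>s = 1..d. f (int s))"
proof -
  have "{1..int d} = int ` {1..d}" using image_int_atLeastAtMost[of 1 d] by simp
  then show ?thesis by (simp add: sum.reindex)
qed

lemma binom_of_nat [simp]: "binom n (int k) = n choose k"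
  by (simp add: binom_def)

text \<open>For \<open>1 \<le> j \<le> d - 2\<close> only two effects are left. New sets of size
  \<open>j\<close> matched exactly with \<open>W \<inter> F\<close> leave \<open>i - j\<close>
  vertices to be chosen outside \<open>F\<close>; for \<open>j = 1\<close> this is the term with
  \<open>i - 1\<close>. Extra components occur only for \<open>j = 1\<close>, with
  \<open>i + 1 - s\<close> old vertices outside \<open>F\<close>.\<close>

lemma stacked_betti_step:
  assumes "n = (m + 3) * d" "1 \<le> j" "j + 2 \<le> d"
  shows "stacked_betti d (Suc m) (i + j) j =
    (\<Sum>s\<le>d. if s \<le> i then int (d choose s) * stacked_betti d m (i - s + j) j else 0) +
    (if j = 1 then int (d * binom (n - 2 * d) (int i - 1))
       + (\<Sum>s = 1..min i d. int ((d choose s) * (n - 2 * d choose (i + 1 - s))))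
     else int ((d choose j) * binom (n - 2 * d) (int i - int j)))"
proof -
  let ?r = "n - 2 * d"
  have r: "(m + 1) * d = ?r" using assms(1) by (simp add: algebra_simps)
  \<comment> \<open>The summands with \<open>s > i\<close> would belong to negative homological
    degree and vanish, so the two ranges of summation agree.\<close>
  have A: "(\<Sum>s\<le>min d (i + j). int (d choose s) * stacked_betti d m (i + j - s) j) =
      (\<Sum>s\<le>d. if s \<le> i then int (d choose s) * stacked_betti d m (i - s + j) j else 0)"
  proof (rule sum.mono_neutral_cong_left)
    show "\<forall>s\<in>{..d} - {..min d (i + j)}. (if s \<le> i then int (d choose s) * stacked_betti d m (i - s + j) j else 0) = 0"
      by auto
    fix s assume "s \<in> {..min d (i + j)}"
    then show "int (d choose s) * stacked_betti d m (i + j - s) j =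
        (if s \<le> i then int (d choose s) * stacked_betti d m (i - s + j) j else 0)"
      using stacked_betti_below[of "i + j - s" j d m] assms(2) by auto
  qed auto
  have c: "hdim_change_sum d m s q j =
      (if s \<ge> 1 \<and> q \<ge> 1 \<and> j = 1 then int (?r choose q) else 0)
      + (if s = j \<and> j \<le> q then int (?r choose (q - j)) else 0)" for s q
    unfolding hdim_change_sum_def r using assms(2,3) by auto
  have D: "(\<Sum>s\<le>min d (i + j). int (d choose s) * (if s = j \<and> j \<le> i + j - s then int (?r choose (i + j - s - j)) else 0))
      = int ((d choose j) * binom ?r (int i - int j))"
  proof -
    have "(\<Sum>s\<le>min d (i + j). int (d choose s) * (if s = j \<and> j \<le> i + j - s then int (?r choose (i + j - s - j)) else 0))
      = (\<Sum>s\<le>min d (i + j). if s = j then int (d choose j) * (if j \<le> i then int (?r choose (i - j)) else 0) else 0)"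
      by (rule sum.cong) auto
    also have "\<dots> = int (d choose j) * (if j \<le> i then int (?r choose (i - j)) else 0)"
      using assms(3) by simp
    also have "\<dots> = int ((d choose j) * binom ?r (int i - int j))"
      by (auto simp: binom_def nat_diff_distrib)
    finally show ?thesis .
  qed
  \<comment> \<open>The index \<open>s = i + 1\<close> drops out, because an extra component
    requires at least one old vertex. This is where the upper bound by \<open>i\<close> comes
    from.\<close>
  have E: "(\<Sum>s\<le>min d (i + 1). int (d choose s) * (if s \<ge> 1 \<and> i + 1 - s \<ge> 1 then int (?r choose (i + 1 - s)) else 0))
      = (\<Sum>s = 1..min i d. int ((d choose s) * (?r choose (i + 1 - s))))"
    by (rule sum.mono_neutral_cong_right) auto
  show ?thesis
  proof (cases "j = 1")
    case True
    then have c1: "hdim_change_sum d m s q 1 = (if s \<ge> 1 \<and> q \<ge> 1 then int (?r choose q) else 0)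
      + (if s = 1 \<and> 1 \<le> q then int (?r choose (q - 1)) else 0)" for s q
      using c[of s q] by simp
    have "stacked_betti d (Suc m) (i + j) j =
      (\<Sum>s\<le>min d (i + j). int (d choose s) * stacked_betti d m (i + j - s) j) +
      ((\<Sum>s\<le>min d (i + 1). int (d choose s) * (if s \<ge> 1 \<and> i + 1 - s \<ge> 1 then int (?r choose (i + 1 - s)) else 0)) +
       (\<Sum>s\<le>min d (i + j). int (d choose s) * (if s = j \<and> j \<le> i + j - s then int (?r choose (i + j - s - j)) else 0)))"
      unfolding True stacked_betti.simps c1 distrib_left sum.distrib ..
    then show ?thesis unfolding A D E using True by simp
  next
    case False
    then have c1: "hdim_change_sum d m s q j = (if s = j \<and> j \<le> q then int (?r choose (q - j)) else 0)" for s q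
      unfolding c by simp
    have "stacked_betti d (Suc m) (i + j) j =
      (\<Sum>s\<le>min d (i + j). int (d choose s) * stacked_betti d m (i + j - s) j) +
      (\<Sum>s\<le>min d (i + j). int (d choose s) * (if s = j \<and> j \<le> i + j - s then int (?r choose (i + j - s - j)) else 0))"
      unfolding stacked_betti.simps c1 distrib_left sum.distrib ..
    then show ?thesis unfolding A D using False by simp
  qed
qed

text \<open>The count is purely combinatorial; the rationals are just one field over which the
  invariant is available.\<close>

lemma stacked_vertex_number:
  assumes "stacked_cross_polytopal_on d n \<Delta>" "d \<ge> 1"
  obtains m where "n = (m + 2) * d"
proof -
  obtain m where "stacked_sphere TYPE(rat) d m \<Delta>"
    using stacked_sphere_stacked assms unfolding stacked_cross_polytopal_on_def by blast
  then show thesis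
    using that assms(1) by (auto simp: stacked_sphere_def has_stacked_betti_def stacked_cross_polytopal_on_def)
qed

text \<open>All Betti numbers are values of a recursion in which only \<open>d\<close> and the
  number of gluings occur, and the latter is read off from \<open>n\<close>. The second part can
  therefore compare even different fields.\<close>

theorem theorem7p5:
  fixes d :: nat
  assumes "d \<ge> 1"
  shows
    "(\<forall>(n::nat) (\<Delta> :: 'v set set) (\<Gamma> :: 'w set set).
        n \<ge> 3 * d \<longrightarrow> d dvd n \<longrightarrow>
        stacked_cross_polytopal_on d n \<Delta> \<longrightarrow> stacked_cross_polytopal_on d (n - d) \<Gamma> \<longrightarrow>
        (\<forall>(i::int) (j::int). 1 \<le> j \<and> j \<le> int d - 2 \<longrightarrow>
           betti TYPE('a::field) \<Delta> i (i + j) =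
             (if j = 1 then
                (\<Sum>l = 0..int d. binom d l * betti TYPE('a) \<Gamma> (i - l) (i - l + 1))
                + d * binom (n - 2 * d) (i - 1)
                + (\<Sum>l = 1..min i (int d). binom d l * binom (n - 2 * d) (i + 1 - l))
              else
                (\<Sum>l = 0..int d. binom d l * betti TYPE('a) \<Gamma> (i - l) (i - l + j))
                + binom d j * binom (n - 2 * d) (i - j))))
     \<and>
     (\<forall>(n::nat) (\<Delta>\<^sub>1 :: 'v set set) (\<Delta>\<^sub>2 :: 'w set set).
        stacked_cross_polytopal_on d n \<Delta>\<^sub>1 \<longrightarrow> stacked_cross_polytopal_on d n \<Delta>\<^sub>2 \<longrightarrow>
        (\<forall>i j. betti TYPE('a) \<Delta>\<^sub>1 i (i + j) = betti TYPE('b::field) \<Delta>\<^sub>2 i (i + j)))"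
proof (intro conjI allI impI)
  fix n :: nat and \<Delta>1 :: "'v set set" and \<Delta>2 :: "'w set set" and i j :: int
  assume 1: "stacked_cross_polytopal_on d n \<Delta>1" and 2: "stacked_cross_polytopal_on d n \<Delta>2"
  obtain m where n: "n = (m + 2) * d" by (rule stacked_vertex_number[OF 1 assms])
  have "int (betti TYPE('a) \<Delta>1 i (i + j)) = int (betti TYPE('b) \<Delta>2 i (i + j))"
    unfolding betti_stacked[OF 1 assms n] betti_stacked[OF 2 assms n] ..
  then show "betti TYPE('a) \<Delta>1 i (i + j) = betti TYPE('b) \<Delta>2 i (i + j)" by simp
next
  fix n :: nat and \<Delta> :: "'v set set" and \<Gamma> :: "'w set set" and i j :: int
  assume n3: "n \<ge> 3 * d" and D: "stacked_cross_polytopal_on d n \<Delta>"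
    and G: "stacked_cross_polytopal_on d (n - d) \<Gamma>" and j: "1 \<le> j \<and> j \<le> int d - 2"
  obtain m where m: "n - d = (m + 2) * d" by (rule stacked_vertex_number[OF G assms])
  \<comment> \<open>The bound \<open>n \<ge> 3 * d\<close> rules out that \<open>n - d\<close> has
    been truncated.\<close>
  have n: "n = (m + 3) * d" using m n3 by (simp add: algebra_simps)
  have n': "n = (Suc m + 2) * d" using n by (simp add: algebra_simps)
  define J where "J = nat j"
  have J: "j = int J" "1 \<le> J" "J + 2 \<le> d" using j by (auto simp: J_def)
  note bD = betti_stacked[OF D assms n', where 'a = 'a] and bG = betti_stacked[OF G assms m, where 'a = 'a]
  \<comment> \<open>Summands with \<open>l > i\<close> are Betti numbers in negative homological
    degree, hence 0; this matches the condition on \<open>s\<close>.\<close>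
  have sG: "int (\<Sum>l = 0..int d. binom d l * betti TYPE('a) \<Gamma> (i - l) (i - l + j)) =
      (\<Sum>s\<le>d. if int s \<le> i then int (d choose s) * stacked_betti d m (nat i - s + J) J else 0)"
    unfolding sum_int_interval of_nat_sum of_nat_mult bG
    by (rule sum.cong) (auto simp: J(1) nat_diff_distrib)
  have "int (betti TYPE('a) \<Delta> i (i + j)) = int (
     (if j = 1 then
        (\<Sum>l = 0..int d. binom d l * betti TYPE('a) \<Gamma> (i - l) (i - l + j))
        + d * binom (n - 2 * d) (i - 1)
        + (\<Sum>l = 1..min i (int d). binom d l * binom (n - 2 * d) (i + 1 - l))
      else
        (\<Sum>l = 0..int d. binom d l * betti TYPE('a) \<Gamma> (i - l) (i - l + j))
        + binom d j * binom (n - 2 * d) (i - j)))"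
  proof (cases "i < 0")
    case True
    have "int (\<Sum>l = 0..int d. binom d l * betti TYPE('a) \<Gamma> (i - l) (i - l + j)) = 0"
      unfolding sG by (rule sum.neutral) (use True in auto)
    then have "(\<Sum>l = 0..int d. binom d l * betti TYPE('a) \<Gamma> (i - l) (i - l + j)) = 0"
      by (simp only: of_nat_eq_0_iff)
    then show ?thesis using True J by (simp only: bD) (simp add: binom_def)
  next
    case False
    then have I: "i = int (nat i)" by simp
    define I where "I = nat i"
    then have I: "i = int I" using I by simp
    have S: "(\<Sum>l = 1..min i (int d). binom d l * binom (n - 2 * d) (i + 1 - l)) =
        (\<Sum>s = 1..min I d. (d choose s) * (n - 2 * d choose (I + 1 - s)))"
    proof -
      have "min i (int d) = int (min I d)" using I by simp
      \<comment> \<open>In this range \<open>s \<le> I\<close>, so subtraction of integers and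
        truncated subtraction agree.\<close>
      moreover have "binom (n - 2 * d) (i + 1 - int s) = (n - 2 * d choose (I + 1 - s))" if "s \<in> {1..min I d}" for s
        using that I by (auto simp: binom_def nat_diff_distrib Suc_diff_le intro!: arg_cong[where f = "binomial _"])
      ultimately show ?thesis by (simp only: sum_int_interval_1) (auto intro!: sum.cong)
    qed
    have "int (betti TYPE('a) \<Delta> i (i + j)) = stacked_betti d (Suc m) (I + J) J"
      using bD I J(1) by simp
    also have "\<dots> = (\<Sum>s\<le>d. if s \<le> I then int (d choose s) * stacked_betti d m (I - s + J) J else 0) +
      (if J = 1 then int (d * binom (n - 2 * d) (int I - 1))
         + (\<Sum>s = 1..min I d. int ((d choose s) * (n - 2 * d choose (I + 1 - s))))
       else int ((d choose J) * binom (n - 2 * d) (int I - int J)))"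
      by (rule stacked_betti_step[OF n J(2,3)])
    also have "(\<Sum>s\<le>d. if s \<le> I then int (d choose s) * stacked_betti d m (I - s + J) J else 0) =
      int (\<Sum>l = 0..int d. binom d l * betti TYPE('a) \<Gamma> (i - l) (i - l + j))"
      unfolding sG by (simp only: I nat_int of_nat_le_iff)
    finally show ?thesis using S I J(1) by simp
  qed
  then show "betti TYPE('a) \<Delta> i (i + j) =
     (if j = 1 then
        (\<Sum>l = 0..int d. binom d l * betti TYPE('a) \<Gamma> (i - l) (i - l + 1))
        + d * binom (n - 2 * d) (i - 1)
        + (\<Sum>l = 1..min i (int d). binom d l * binom (n - 2 * d) (i + 1 - l))
      else
        (\<Sum>l = 0..int d. binom d l * betti TYPE('a) \<Gamma> (i - l) (i - l + j))
        + binom d j * binom (n - 2 * d) (i - j))"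
    unfolding of_nat_eq_iff by (simp only: split: if_split) auto
qed

end
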